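(* (Harmonic generalized CK-extension.) Let $\Omega_0\subseteq\mathbb{R}^{p+1}$ be a domain and $A_0,A_1\in C^{\omega}(\Omega_0,\mathbb{A})$. Then there exists a unique sequence of real analytic functions $\{A_k\}_{k\ge2}\subset C^{\omega}(\Omega_0,\mathbb{A})$ such that the series $$f(\mathbf{x})=\sum_{k=0}^{\infty}\underline{\mathbf{x}}_q^{\,k}A_k(\mathbf{x}_p)$$ converges in a p-symmetric slice domain $\Omega\subseteq\Omega_0^*$ with $\Omega_0\subset\Omega$ and its sum $f$ is harmonic (i.e. $\Delta_{\mathbf{x}}f=0$) in $\Omega$. Furthermore, $f$ can be written formally as $$f(\mathbf{x})=\Gamma\Big(\frac q2\Big)\Big(\frac{r\sqrt{\Delta_{\mathbf{x}_p}}}{2}\Big)^{-\frac q2}\Big[\frac{r\sqrt{\Delta_{\mathbf{x}_p}}}{2}J_{\frac q2-1}\big(r\sqrt{\Delta_{\mathbf{x}_p}}\big)[A_0(\mathbf{x}_p)]+\frac{q\,\underline{\mathbf{x}}_q}{2}J_{\frac q2}\big(r\sqrt{\Delta_{\mathbf{x}_p}}\big)[A_1(\mathbf{x}_p)]\Big],$$ and satisfies $f(\mathbf{x})|_{\underline{\mathbf{x}}_q=0}=A_0(\mathbf{x}_p)$ and $D_{\underline{\mathbf{x}}_q}f(\mathbf{x})|_{\underline{\mathbf{x}}_q=0}=-qA_1(\mathbf{x}_p)$.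
   Context: Let $\mathbb{A}$ be a real alternative algebra (the associator $[a,b,c]=(ab)c-a(bc)$ is an alternating trilinear function) with unity $1$, of finite real dimension $d>1$, equipped with an anti-involution $a\mapsto a^c$ (real linear, $a^c=a$ for real $a$, $(a^c)^c=a$, $(ab)^c=b^ca^c$). Let $t(x)=x+x^c$, $n(x)=xx^c$, $\mathbb{S}_{\mathbb{A}}=\{x: t(x)=0,\ n(x)=1\}$ (assumed nonempty) and $Q_{\mathbb{A}}=\mathbb{R}\cup\{x: t(x)\in\mathbb{R},\ n(x)\in\mathbb{R},\ 4n(x)>t(x)^2\}$. Let $M$ be a real subspace with $\mathbb{R}\subsetneq M\subseteq Q_{\mathbb{A}}$ having a basis $(v_0,\dots,v_m)$, $m\ge1$, $v_0=1$, $v_s\in\mathbb{S}_{\mathbb{A}}$, $v_sv_t=-v_tv_s$ for distinct $s,t\ge1$; complete it to a basis of $\mathbb{A}$ with associated Euclidean norm. Identify $x=\sum x_sv_s\in M$ with $(x_0,\dots,x_m)\in\mathbb{R}^{m+1}$; differentiate componentwise; $C^\omega$ means componentwise real analytic. Fix $p\in\{0,\dots,m-1\}$, $q=m-p$; $\mathbf{x}=\mathbf{x}_p+\underline{\mathbf{x}}_q$ with $\mathbf{x}_p=\sum_{s=0}^px_sv_s\in\mathbb{R}^{p+1}$, $\underline{\mathbf{x}}_q=\sum_{s=p+1}^m x_sv_s\in\mathbb{R}^q$; $\mathbb{S}=\{\sum_{s=p+1}^m x_sv_s:\sum x_s^2=1\}$; $r=|\underline{\mathbf{x}}_q|$. Powers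 $\underline{\mathbf{x}}_q^k$ are taken in $\mathbb{A}$ ($\underline{\mathbf{x}}_q^2=-r^2$). $D_{\underline{\mathbf{x}}_q}f=\sum_{s=p+1}^m v_s\partial_{x_s}f$, $\Delta_{\mathbf{x}_p}=\sum_{s=0}^p\partial_{x_s}^2$, $\Delta_{\mathbf{x}}=\sum_{s=0}^m\partial_{x_s}^2$. $\sqrt{\Delta_{\mathbf{x}_p}}$ is a formal square root (only even powers occur in the resulting series); $J_n(x)=\sum_{k\ge0}\frac{(-1)^k(x/2)^{n+2k}}{k!\,\Gamma(n+k+1)}$. A domain $\Omega\subseteq M$ is a slice domain if $\Omega\cap\mathbb{R}^{p+1}\ne\emptyset$ and each $\Omega\cap(\mathbb{R}^{p+1}\oplus\underline{\omega}\mathbb{R})$, $\underline{\omega}\in\mathbb{S}$, is a domain in $\mathbb{R}^{p+2}$; it is p-symmetric if $\mathbf{x}_p+r\underline{\omega}\in\Omega$ with $r>0$ implies $\mathbf{x}_p+r\underline{\eta}\in\Omega$ for all $\underline{\eta}\in\mathbb{S}$. $\Omega_0^*=\{\mathbf{x}_p+\underline{\mathbf{x}}_q:\mathbf{x}_p\in\Omega_0,\ \underline{\mathbf{x}}_q\in\mathbb{R}^q\}$. *)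

theory Defs
  imports "HOL-Analysis.Analysis"
begin

definition associator :: "('a::real_vector \<Rightarrow> 'a \<Rightarrow> 'a) \<Rightarrow> 'a \<Rightarrow> 'a \<Rightarrow> 'a \<Rightarrow> 'a" where
  "associator mul a b c = mul (mul a b) c - mul a (mul b c)"

definition alt_algebra :: "('a::euclidean_space \<Rightarrow> 'a \<Rightarrow> 'a) \<Rightarrow> 'a \<Rightarrow> ('a \<Rightarrow> 'a) \<Rightarrow> bool" where
  "alt_algebra mul e cj \<longleftrightarrow>
     bilinear mul \<and>
     (\<forall>x. mul e x = x \<and> mul x e = x) \<and>
     (\<forall>a b. associator mul a a b = 0 \<and> associator mul a b a = 0 \<and> associator mul b a a = 0) \<and>
     linear cj \<and>
     (\<forall>r. cj (r *\<^sub>R e) = r *\<^sub>R e) \<and>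
     (\<forall>a. cj (cj a) = a) \<and>
     (\<forall>a b. cj (mul a b) = mul (cj b) (cj a))"

definition unit_imag :: "('a::real_vector \<Rightarrow> 'a \<Rightarrow> 'a) \<Rightarrow> 'a \<Rightarrow> ('a \<Rightarrow> 'a) \<Rightarrow> 'a set" where
  "unit_imag mul e cj = {x. x + cj x = 0 \<and> mul x (cj x) = e}"

definition quad_cone :: "('a::real_vector \<Rightarrow> 'a \<Rightarrow> 'a) \<Rightarrow> 'a \<Rightarrow> ('a \<Rightarrow> 'a) \<Rightarrow> 'a set" where
  "quad_cone mul e cj = range (\<lambda>r. r *\<^sub>R e) \<union>
     {x. \<exists>a b. x + cj x = a *\<^sub>R e \<and> mul x (cj x) = b *\<^sub>R e \<and> 4 * b > a\<^sup>2}"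

primrec apow :: "('a \<Rightarrow> 'a \<Rightarrow> 'a) \<Rightarrow> 'a \<Rightarrow> 'a \<Rightarrow> nat \<Rightarrow> 'a" where
  "apow mul e x 0 = e"
| "apow mul e x (Suc k) = mul x (apow mul e x k)"

definition qelem :: "('q::finite \<Rightarrow> 'a::real_vector) \<Rightarrow> real^'q \<Rightarrow> 'a" where
  "qelem vq xq = (\<Sum>j\<in>UNIV. (xq $ j) *\<^sub>R vq j)"

definition real_analytic_at :: "(real^'n \<Rightarrow> real) \<Rightarrow> real^'n \<Rightarrow> bool" where
  "real_analytic_at g x0 \<longleftrightarrow>
     (\<exists>\<epsilon>>0. \<exists>c :: ('n \<Rightarrow> nat) \<Rightarrow> real. \<forall>x\<in>ball x0 \<epsilon>.
        ((\<lambda>\<alpha>. c \<alpha> * (\<Prod>i\<in>UNIV. (x $ i - x0 $ i) ^ \<alpha> i)) has_sum g x) UNIV)"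

definition real_analytic_on :: "(real^'n) set \<Rightarrow> (real^'n \<Rightarrow> 'a::euclidean_space) \<Rightarrow> bool" where
  "real_analytic_on S f \<longleftrightarrow> (\<forall>b\<in>Basis. \<forall>x\<in>S. real_analytic_at (\<lambda>y. f y \<bullet> b) x)"

definition pd :: "('n::euclidean_space \<Rightarrow> 'a::real_normed_vector) \<Rightarrow> 'n \<Rightarrow> 'n \<Rightarrow> 'a" where
  "pd g u x = frechet_derivative g (at x) u"

definition laplacian :: "('n::euclidean_space \<Rightarrow> 'a::real_normed_vector) \<Rightarrow> 'n \<Rightarrow> 'a" where
  "laplacian g x = (\<Sum>b\<in>Basis. pd (pd g b) b x)"

definition harmonic_on :: "'n::euclidean_space set \<Rightarrow> ('n \<Rightarrow> 'a::real_normed_vector) \<Rightarrow> bool" where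
  "harmonic_on S g \<longleftrightarrow> open S \<and>
     (\<forall>x\<in>S. g differentiable (at x) \<and> (\<forall>b\<in>Basis. pd g b differentiable (at x)) \<and> laplacian g x = 0)"

section \<open>Domains in M = R^(p+1) x R^q\<close>

definition slice_domain :: "((real^'p) \<times> (real^'q)) set \<Rightarrow> bool" where
  "slice_domain \<Omega> \<longleftrightarrow> {xp. (xp, 0) \<in> \<Omega>} \<noteq> {} \<and>
     (\<forall>\<omega>::real^'q. norm \<omega> = 1 \<longrightarrow>
        (let S = {z :: (real^'p) \<times> real. (fst z, snd z *\<^sub>R \<omega>) \<in> \<Omega>} in open S \<and> connected S \<and> S \<noteq> {}))"

definition p_symmetric :: "((real^'p) \<times> (real^'q)) set \<Rightarrow> bool" where
  "p_symmetric \<Omega> \<longleftrightarrow> (\<forall>xp xq \<eta>. (xp, xq) \<in> \<Omega> \<and> xq \<noteq> 0 \<and> norm \<eta> = norm xq \<longrightarrow> (xp, \<eta>) \<in> \<Omega>)"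

definition ck_term :: "('a \<Rightarrow> 'a \<Rightarrow> 'a) \<Rightarrow> 'a \<Rightarrow> ('q::finite \<Rightarrow> 'a::real_vector)
    \<Rightarrow> (nat \<Rightarrow> real^'p \<Rightarrow> 'a) \<Rightarrow> nat \<Rightarrow> (real^'p) \<times> (real^'q) \<Rightarrow> 'a" where
  "ck_term mul e vq A k x = mul (apow mul e (qelem vq (snd x)) k) (A k (fst x))"

definition harmonic_ck_on :: "('a \<Rightarrow> 'a \<Rightarrow> 'a) \<Rightarrow> 'a \<Rightarrow> ('q::finite \<Rightarrow> 'a::real_normed_vector)
    \<Rightarrow> (real^'p) set \<Rightarrow> (nat \<Rightarrow> real^'p \<Rightarrow> 'a) \<Rightarrow> ((real^'p) \<times> (real^'q)) set \<Rightarrow> bool" where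
  "harmonic_ck_on mul e vq \<Omega>0 A \<Omega> \<longleftrightarrow>
     open \<Omega> \<and> connected \<Omega> \<and> slice_domain \<Omega> \<and> p_symmetric \<Omega> \<and>
     \<Omega> \<subseteq> {x. fst x \<in> \<Omega>0} \<and> (\<lambda>xp. (xp, 0)) ` \<Omega>0 \<subseteq> \<Omega> \<and>
     (\<forall>x\<in>\<Omega>. summable (\<lambda>k. ck_term mul e vq A k x)) \<and>
     harmonic_on \<Omega> (\<lambda>x. \<Sum>k. ck_term mul e vq A k x)"

end

theory Submission
  imports Defs
begin

text \<open>Write \<open>x = (xp, xq)\<close> and \<open>r = norm xq\<close>. Since \<open>xq\<^sup>2 = - r\<^sup>2\<close> in the algebra, a series \<open>\<Sum>k. xq ^ k * A k xp\<close> splits into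
  a power series in \<open>r\<^sup>2\<close> and coordinates of \<open>xq\<close> times such series. Differentiating termwise, its Laplacian is the series with
  coefficients \<open>laplacian (A k) - ck_weight k * A (k + 2)\<close>, so harmonicity amounts to a two-step recursion solved by
  normalised iterated Laplacians of \<open>A0\<close> and \<open>A1\<close>.

  Convergence: in the weighted \<open>l1\<close> norm of power series coefficients a derivative costs a factor \<open>1 / s\<close>
  when the polyradius shrinks by \<open>s\<close>; distributing the loss evenly over \<open>2 * k\<close> derivatives bounds the \<open>k\<close>-th iterated
  Laplacian by \<open>M * C ^ k * fact (2 * k)\<close>, and the denominators are at least \<open>fact (2 * k)\<close>.

  Uniqueness: the difference of two solutions converges only pointwise in \<open>xp\<close> and harmonicity only means pointwise
  second differentiability, so the series cannot be differentiated in \<open>xp\<close>. Baire's theorem makes the coefficient bounds uniform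
  on some ball, and on it the maximum principle shows that the first nonzero coefficient must vanish.\<close>

section \<open>Partial derivatives, Laplacians and series in even powers of the radius\<close>

text \<open>The algebra is not associative, but no rebracketing beyond a repeated left factor is
  needed: powers of \<open>qelem vq x\<close> stay in the span of \<open>e\<close> and
  \<open>qelem vq x\<close>, and left alternativity enters as \<open>mul v (mul v a) = - a\<close>
  for a unit \<open>v\<close>. So the calculus is scalar, and multiplication by a fixed element is
  just a linear map. The odd part carries a coordinate of \<open>xq\<close> as a factor; the cross
  term of the product rule makes it behave like the even part in dimension \<open>q + 2\<close>.
  Hence one family of constants with parameter \<open>q\<close> or \<open>q + 2\<close> serves both,
  and two neighbouring Bessel functions appear.

  All estimates are local: the admissible radius depends on the point of \<open>\<Omega>0\<close>,
  so the domain is a union of small tubes and not one tube of constant width. In the uniqueness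
  proof the \<open>xp\<close>-part of the Laplacian is reached indirectly: with the coefficients
  frozen at one point, the \<open>xq\<close>-part is a computation with a power series, and
  harmonicity then supplies the \<open>xp\<close>-part.\<close>

lemma has_derivative_suminf_dominated:
  fixes f :: "nat \<Rightarrow> 'x::real_normed_vector \<Rightarrow> 'y::banach"
  assumes "open S" "convex S"
    and der: "\<And>n x. x \<in> S \<Longrightarrow> (f n has_derivative f' n x) (at x)"
    and bound: "\<And>n x h. x \<in> S \<Longrightarrow> norm (f' n x h) \<le> b n * norm h"
    and b: "summable b" and sm: "\<And>x. x \<in> S \<Longrightarrow> summable (\<lambda>n. f n x)" and x: "x \<in> S"
  shows "((\<lambda>x. \<Sum>n. f n x) has_derivative (\<lambda>h. \<Sum>n. f' n x h)) (at x)"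
proof -
  have smd: "summable (\<lambda>n. f' n x h)" if "x \<in> S" for x h
    by (rule summable_comparison_test'[OF summable_mult2[OF b, of "norm h"], of 0])
       (use bound that in auto)
  have "\<exists>g. \<forall>x\<in>S. (\<lambda>n. f n x) sums g x \<and>
          (g has_derivative (\<lambda>x h. \<Sum>n. f' n x h) x) (at x within S)"
  proof (rule has_derivative_series)
    show "((f n) has_derivative f' n x) (at x within S)" if "x \<in> S" for n x
      using der[OF that] has_derivative_at_withinI by blast
    fix e :: real assume e: "e > 0"
    \<comment> \<open>The tail of \<open>b\<close> bounds the remainder of the derivative series for
      all points and directions at once, which is the uniform convergence that termwise
      differentiation requires.\<close>
    obtain N where N: "\<And>n. n \<ge> N \<Longrightarrow> norm (\<Sum>i. b (i + n)) < e"
      using suminf_exist_split[OF e b] by blast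
    show "\<forall>\<^sub>F n in sequentially. \<forall>x\<in>S. \<forall>h.
            norm ((\<Sum>i<n. f' i x h) - (\<Sum>n. f' n x h)) \<le> e * norm h"
      unfolding eventually_sequentially
    proof (intro exI[of _ N] allI impI ballI)
      fix n x and h :: 'x assume n: "n \<ge> N" and x: "x \<in> S"
      have sb: "summable (\<lambda>i. b (i + n) * norm h)"
        using b by (intro summable_mult2) simp
      have "norm ((\<Sum>i<n. f' i x h) - (\<Sum>n. f' n x h)) = norm (\<Sum>i. f' (i + n) x h)"
        using suminf_minus_initial_segment[OF smd[OF x, of h], of n]
        by (simp add: norm_minus_commute)
      also have "\<dots> \<le> (\<Sum>i. b (i + n) * norm h)"
        by (rule norm_suminf_le[OF bound[OF x] sb])
      also have "\<dots> = (\<Sum>i. b (i + n)) * norm h"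
        using b by (intro suminf_mult2[symmetric]) simp
      also have "\<dots> \<le> e * norm h"
        using N[OF n] by (intro mult_right_mono) auto
      finally show "norm ((\<Sum>i<n. f' i x h) - (\<Sum>n. f' n x h)) \<le> e * norm h" .
    qed
  qed (use assms sm[OF x] summable_sums in blast)+
  then obtain g where "\<forall>x\<in>S. (\<lambda>n. f n x) sums g x \<and>
      (g has_derivative (\<lambda>h. \<Sum>n. f' n x h)) (at x within S)" ..
  then have g: "\<And>x. x \<in> S \<Longrightarrow> (\<lambda>n. f n x) sums g x"
      "\<And>x. x \<in> S \<Longrightarrow> (g has_derivative (\<lambda>h. \<Sum>n. f' n x h)) (at x within S)"
    by simp_all
  have "(g has_derivative (\<lambda>h. \<Sum>n. f' n x h)) (at x)"
    using g(2)[OF x] unfolding at_within_open[OF x \<open>open S\<close>] .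
  then show ?thesis
    by (rule has_derivative_transform_within_open[OF _ \<open>open S\<close> x]) (rule sums_unique[OF g(1)])
qed

section \<open>Calculus of partial derivatives and of functions with a prescribed Laplacian\<close>

lemma pd_eqI: "(g has_derivative D) (at x) \<Longrightarrow> pd g u x = D u"
  unfolding pd_def using frechet_derivative_at by metis

text \<open>\<open>frechet_derivative\<close> is a choice among the derivatives at the point, and
  both functions have the same ones; so the equation holds even where no derivative exists.\<close>

lemma pd_cong_open:
  assumes "open S" "x \<in> S" "\<And>y. y \<in> S \<Longrightarrow> f y = g y"
  shows "pd f u x = pd g u x"
proof -
  have "(f has_derivative D) (at x) \<longleftrightarrow> (g has_derivative D) (at x)" for D
    using has_derivative_transform_within_open[OF _ assms(1,2)] assms(3) by metis
  then show ?thesis unfolding pd_def frechet_derivative_def by simp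
qed

lemma differentiable_cong_open:
  assumes "open S" "x \<in> S" "\<And>y. y \<in> S \<Longrightarrow> f y = g y" "f differentiable (at x)"
  shows "g differentiable (at x)"
  using assms has_derivative_transform_within_open unfolding differentiable_def by metis

lemma has_derivative_pd:
  "g differentiable (at x) \<Longrightarrow> (g has_derivative (\<lambda>u. pd g u x)) (at x)"
  unfolding pd_def using frechet_derivative_works by blast

lemma linear_pd: "g differentiable (at x) \<Longrightarrow> linear (\<lambda>u. pd g u x)"
  using has_derivative_pd has_derivative_linear by blast

lemma pd_expand:
  assumes "g differentiable (at x)"
  shows "pd g h x = (\<Sum>b\<in>Basis. (h \<bullet> b) *\<^sub>R pd g b x)"
proof -
  have "pd g h x = pd g (\<Sum>b\<in>Basis. (h \<bullet> b) *\<^sub>R b) x" by (simp add: euclidean_representation)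
  also have "\<dots> = (\<Sum>b\<in>Basis. (h \<bullet> b) *\<^sub>R pd g b x)"
    by (simp add: linear_sum[OF linear_pd[OF assms]] linear_cmul[OF linear_pd[OF assms]])
  finally show ?thesis .
qed

lemma pd_const [simp]: "pd (\<lambda>x. c) u = (\<lambda>x. 0)"
  by (rule ext, rule pd_eqI[where D="\<lambda>_. 0"]) simp

lemma pd_add:
  "f differentiable (at x) \<Longrightarrow> g differentiable (at x) \<Longrightarrow> pd (\<lambda>y. f y + g y) u x = pd f u x + pd g u x"
  by (rule pd_eqI) (intro has_derivative_add has_derivative_pd)

lemma pd_linear:
  assumes "bounded_linear h" "f differentiable (at x)"
  shows "pd (\<lambda>y. h (f y)) u x = h (pd f u x)"
  by (rule pd_eqI, rule bounded_linear.has_derivative[OF assms(1) has_derivative_pd[OF assms(2)]])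

lemma differentiable_linear:
  assumes "bounded_linear h" "f differentiable (at x)"
  shows "(\<lambda>y. h (f y)) differentiable (at x)"
  using assms(2) bounded_linear.has_derivative[OF assms(1)] unfolding differentiable_def by blast

text \<open>A form of \<open>harmonic_on\<close> with an arbitrary right-hand side. The pieces of a
  series are not harmonic one by one, but their Laplacians can be assembled through sums, linear
  maps and products with coordinates, and shown to vanish only at the end.\<close>

definition has_laplacian_on :: "'n::euclidean_space set \<Rightarrow> ('n \<Rightarrow> 'a::real_normed_vector) \<Rightarrow> ('n \<Rightarrow> 'a) \<Rightarrow> bool"
  where "has_laplacian_on S g L \<longleftrightarrow> open S \<and>
     (\<forall>x\<in>S. g differentiable (at x) \<and> (\<forall>b\<in>Basis. pd g b differentiable (at x)) \<and> laplacian g x = L x)"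

lemma harmonic_on_iff_has_laplacian: "harmonic_on S g \<longleftrightarrow> has_laplacian_on S g (\<lambda>x. 0)"
  by (simp add: harmonic_on_def has_laplacian_on_def)

lemma has_laplacian_onD:
  assumes "has_laplacian_on S g L"
  shows "open S" "x \<in> S \<Longrightarrow> g differentiable (at x)"
    "x \<in> S \<Longrightarrow> b \<in> Basis \<Longrightarrow> pd g b differentiable (at x)"
    "x \<in> S \<Longrightarrow> (\<Sum>b\<in>Basis. pd (pd g b) b x) = L x"
  using assms by (auto simp: has_laplacian_on_def laplacian_def)

lemma laplacian_cong_open:
  assumes "open S" "x \<in> S" "\<And>y. y \<in> S \<Longrightarrow> f y = g y"
  shows "laplacian f x = laplacian g x"
  unfolding laplacian_def
  by (rule sum.cong[OF refl], rule pd_cong_open[OF assms(1,2)], rule pd_cong_open[OF assms(1) _ assms(3)])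

lemma has_laplacian_on_cong:
  assumes "has_laplacian_on S g L" "\<And>x. x \<in> S \<Longrightarrow> g x = h x" "\<And>x. x \<in> S \<Longrightarrow> L x = K x"
  shows "has_laplacian_on S h K"
proof -
  have o: "open S" using assms(1) by (rule has_laplacian_onD)
  have "h differentiable (at x)" "laplacian h x = K x" if "x \<in> S" for x
    using differentiable_cong_open[OF o that assms(2)] laplacian_cong_open[OF o that assms(2)] assms that
    by (auto simp: has_laplacian_on_def)
  moreover have "pd h b differentiable (at x)" if "x \<in> S" "b \<in> Basis" for x b
    using differentiable_cong_open[OF o that(1) pd_cong_open[OF o _ assms(2)] has_laplacian_onD(3)[OF assms(1) that]]
    by blast
  ultimately show ?thesis using o by (auto simp: has_laplacian_on_def)
qed

lemma has_laplacian_on_subset: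
  "has_laplacian_on S g L \<Longrightarrow> open T \<Longrightarrow> T \<subseteq> S \<Longrightarrow> has_laplacian_on T g L"
  by (auto simp: has_laplacian_on_def)

text \<open>The gradient is handed over as \<open>g'\<close>, because \<open>pd g b\<close> is known
  by a formula on \<open>S\<close> only; openness of \<open>S\<close> lets the derivative of the
  formula count as the derivative of \<open>pd g b\<close>.\<close>

lemma has_laplacian_onI:
  assumes "open S" "\<And>x. x \<in> S \<Longrightarrow> g differentiable (at x)"
    "\<And>x b. x \<in> S \<Longrightarrow> b \<in> Basis \<Longrightarrow> pd g b x = g' b x"
    "\<And>x b. x \<in> S \<Longrightarrow> b \<in> Basis \<Longrightarrow> (g' b has_derivative g'' b x) (at x)"
    "\<And>x. x \<in> S \<Longrightarrow> (\<Sum>b\<in>Basis. g'' b x b) = L x"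
  shows "has_laplacian_on S g L"
proof -
  have "(pd g b has_derivative g'' b x) (at x)" if "x \<in> S" "b \<in> Basis" for x b
    by (rule has_derivative_transform_within_open[OF assms(4)[OF that] assms(1) that(1)])
       (use assms(3) that in auto)
  then have "pd (pd g b) b x = g'' b x b" "pd g b differentiable (at x)" if "x \<in> S" "b \<in> Basis" for x b
    using that pd_eqI differentiable_def by blast+
  then show ?thesis using assms(1,2,5) by (simp add: has_laplacian_on_def laplacian_def)
qed

lemma has_laplacian_on_add:
  assumes "has_laplacian_on S f L" "has_laplacian_on S g K"
  shows "has_laplacian_on S (\<lambda>x. f x + g x) (\<lambda>x. L x + K x)"
proof (rule has_laplacian_onI[where g'="\<lambda>b x. pd f b x + pd g b x"
      and g''="\<lambda>b x h. pd (pd f b) h x + pd (pd g b) h x"])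
  note D = has_laplacian_onD[OF assms(1)] has_laplacian_onD[OF assms(2)]
  show "open S" by (rule D)
  fix x assume x: "x \<in> S"
  show "(\<lambda>x. f x + g x) differentiable (at x)" using D x by (intro differentiable_add) auto
  show "(\<Sum>b\<in>Basis. pd (pd f b) b x + pd (pd g b) b x) = L x + K x"
    using D x by (simp add: sum.distrib)
  fix b :: 'a assume b: "b \<in> Basis"
  show "pd (\<lambda>x. f x + g x) b x = pd f b x + pd g b x" using D x by (intro pd_add) auto
  show "((\<lambda>x. pd f b x + pd g b x) has_derivative (\<lambda>h. pd (pd f b) h x + pd (pd g b) h x)) (at x)"
    using D x b by (intro has_derivative_add has_derivative_pd) auto
qed

lemma has_laplacian_on_linear:
  assumes "has_laplacian_on S f L" "bounded_linear h"
  shows "has_laplacian_on S (\<lambda>x. h (f x)) (\<lambda>x. h (L x))"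
proof (rule has_laplacian_onI[where g'="\<lambda>b x. h (pd f b x)" and g''="\<lambda>b x u. h (pd (pd f b) u x)"])
  note D = has_laplacian_onD[OF assms(1)]
  show "open S" by (rule D)
  fix x assume x: "x \<in> S"
  show "(\<lambda>x. h (f x)) differentiable (at x)" using D x differentiable_linear[OF assms(2)] by blast
  show "(\<Sum>b\<in>Basis. h (pd (pd f b) b x)) = h (L x)"
    using D x by (simp add: linear_sum[OF bounded_linear.linear[OF assms(2)], symmetric])
  fix b :: 'a assume b: "b \<in> Basis"
  show "pd (\<lambda>x. h (f x)) b x = h (pd f b x)" using D x by (intro pd_linear assms) auto
  show "((\<lambda>x. h (pd f b x)) has_derivative (\<lambda>u. h (pd (pd f b) u x))) (at x)"
    using D x b by (intro bounded_linear.has_derivative[OF assms(2)] has_derivative_pd) auto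
qed

lemma has_laplacian_on_sum:
  assumes "finite I" "open S" "\<And>i. i \<in> I \<Longrightarrow> has_laplacian_on S (f i) (L i)"
  shows "has_laplacian_on S (\<lambda>x. \<Sum>i\<in>I. f i x) (\<lambda>x. \<Sum>i\<in>I. L i x)"
  using assms(1,3)
proof (induction I)
  case empty
  show ?case by (rule has_laplacian_onI[where g'="\<lambda>_ _. 0" and g''="\<lambda>_ _ _. 0"]) (use assms(2) in auto)
next
  case (insert i I)
  then show ?case by (simp add: has_laplacian_on_add)
qed

text \<open>A coordinate is linear, so besides \<open>L\<close> the product rule leaves only the
  cross term with \<open>pd g u\<close>. This term later shifts the dimension parameter of the odd
  part from \<open>q\<close> to \<open>q + 2\<close>.\<close>

lemma has_laplacian_on_mult_coord:
  fixes u :: "'n::euclidean_space"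
  assumes "has_laplacian_on S g L"
  shows "has_laplacian_on S (\<lambda>x. (x \<bullet> u) *\<^sub>R g x) (\<lambda>x. 2 *\<^sub>R pd g u x + (x \<bullet> u) *\<^sub>R L x)"
proof (rule has_laplacian_onI[where g'="\<lambda>b x. (x \<bullet> u) *\<^sub>R pd g b x + (b \<bullet> u) *\<^sub>R g x"
      and g''="\<lambda>b x h. (x \<bullet> u) *\<^sub>R pd (pd g b) h x + (h \<bullet> u) *\<^sub>R pd g b x + (b \<bullet> u) *\<^sub>R pd g h x"])
  note D = has_laplacian_onD[OF assms]
  show "open S" by (rule D)
  fix x assume x: "x \<in> S"
  have d: "((\<lambda>x. (x \<bullet> u) *\<^sub>R g x) has_derivative (\<lambda>b. (x \<bullet> u) *\<^sub>R pd g b x + (b \<bullet> u) *\<^sub>R g x)) (at x)"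
    using D(2)[OF x, THEN has_derivative_pd] by (auto intro!: derivative_eq_intros)
  show "(\<lambda>x. (x \<bullet> u) *\<^sub>R g x) differentiable (at x)"
    using d differentiable_def by blast
  show "pd (\<lambda>x. (x \<bullet> u) *\<^sub>R g x) b x = (x \<bullet> u) *\<^sub>R pd g b x + (b \<bullet> u) *\<^sub>R g x" for b
    by (rule pd_eqI[OF d])
  have "(\<Sum>b\<in>Basis. (b \<bullet> u) *\<^sub>R pd g b x) = pd g u x"
    using pd_expand[OF D(2)[OF x], of u] by (simp add: inner_commute)
  then show "(\<Sum>b\<in>Basis. (x \<bullet> u) *\<^sub>R pd (pd g b) b x + (b \<bullet> u) *\<^sub>R pd g b x + (b \<bullet> u) *\<^sub>R pd g b x)
      = 2 *\<^sub>R pd g u x + (x \<bullet> u) *\<^sub>R L x"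
    using D(4)[OF x] by (simp add: sum.distrib scaleR_sum_right[symmetric] scaleR_2)
  fix b :: 'n assume b: "b \<in> Basis"
  show "((\<lambda>x. (x \<bullet> u) *\<^sub>R pd g b x + (b \<bullet> u) *\<^sub>R g x) has_derivative
      (\<lambda>h. (x \<bullet> u) *\<^sub>R pd (pd g b) h x + (h \<bullet> u) *\<^sub>R pd g b x + (b \<bullet> u) *\<^sub>R pd g h x)) (at x)"
    using D(2)[OF x, THEN has_derivative_pd] D(3)[OF x b, THEN has_derivative_pd]
    by (auto intro!: derivative_eq_intros)
qed

section \<open>Series in powers of the squared radius and their termwise derivatives\<close>

definition radial_series :: "(nat \<Rightarrow> 'b \<Rightarrow> 'a) \<Rightarrow> 'b \<times> 'c::euclidean_space \<Rightarrow> 'a::real_normed_vector" where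
  "radial_series W x = (\<Sum>k. (snd x \<bullet> snd x) ^ k *\<^sub>R W k (fst x))"

lemma norm_radial_term:
  fixes v :: "'c::real_inner" and w :: "'a::real_normed_vector"
  assumes "norm v < \<rho>" "norm w \<le> M * C ^ k" "C \<ge> 0" "M \<ge> 0"
  shows "norm ((v \<bullet> v) ^ k *\<^sub>R w) \<le> M * (C * \<rho>\<^sup>2) ^ k"
proof -
  have "v \<bullet> v \<le> \<rho>\<^sup>2"
    using assms(1) by (simp add: power2_norm_eq_inner[symmetric] power_mono)
  then have "(v \<bullet> v) ^ k * norm w \<le> (\<rho>\<^sup>2) ^ k * (M * C ^ k)"
    using assms by (intro mult_mono power_mono) auto
  then show ?thesis by (simp add: power_mult_distrib mult_ac)
qed

lemma radial_series_summable:
  fixes xq :: "'c::euclidean_space" and W :: "nat \<Rightarrow> 'b \<Rightarrow> 'a::banach"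
  assumes "norm xq < \<rho>" "\<And>k. norm (W k xp) \<le> M * C ^ k" "C \<ge> 0" "M \<ge> 0" "C * \<rho>\<^sup>2 < 1"
  shows "summable (\<lambda>k. (xq \<bullet> xq) ^ k *\<^sub>R W k xp)"
  by (rule summable_comparison_test'[OF summable_mult[OF summable_geometric[of "C * \<rho>\<^sup>2"], of M], of 0])
     (use assms norm_radial_term[OF assms(1,2,3,4)] in \<open>auto simp: abs_mult\<close>)

text \<open>The derivative has a part from the coefficients and a part from the squared radius; the
  latter is a coordinate times another radial series, so the result can be applied
  repeatedly.\<close>

lemma radial_series_has_derivative:
  fixes W :: "nat \<Rightarrow> 'b::real_normed_vector \<Rightarrow> 'a::banach" and xq :: "'c::euclidean_space"
  assumes U: "open U" "convex U" and C: "C \<ge> 0" "M \<ge> 0" "C * \<rho>\<^sup>2 < 1"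
    and der: "\<And>k y. y \<in> U \<Longrightarrow> (W k has_derivative W' k y) (at y)"
    and bd: "\<And>k y. y \<in> U \<Longrightarrow> norm (W k y) \<le> M * C ^ k"
    and bd': "\<And>k y h. y \<in> U \<Longrightarrow> norm (W' k y h) \<le> M * C ^ k * norm h"
    and xp: "xp \<in> U" and xq: "norm xq < \<rho>"
  shows "(radial_series W has_derivative
      (\<lambda>h. (\<Sum>k. (xq \<bullet> xq) ^ k *\<^sub>R W' k xp (fst h)) +
            (2 * (xq \<bullet> snd h)) *\<^sub>R radial_series (\<lambda>k y. real (Suc k) *\<^sub>R W (Suc k) y) (xp, xq)))
      (at (xp, xq))"
proof -
  define \<theta> where "\<theta> = C * \<rho>\<^sup>2"
  have \<rho>: "\<rho> > 0" using xq norm_ge_zero[of xq] by linarith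
  have \<theta>: "0 \<le> \<theta>" "\<theta> < 1" using C \<rho> by (auto simp: \<theta>_def)
  let ?f = "\<lambda>k (x::'b\<times>'c). (snd x \<bullet> snd x) ^ k *\<^sub>R W k (fst x)"
  let ?d1 = "\<lambda>k x h. (snd x \<bullet> snd x) ^ k *\<^sub>R W' k (fst x) (fst h)"
  let ?d2 = "\<lambda>k x h. (2 * real k * (snd x \<bullet> snd x) ^ (k-1) * (snd x \<bullet> snd h)) *\<^sub>R W k (fst x)"
  \<comment> \<open>\<open>M\<close> pays for \<open>?d1\<close> and \<open>2 * M / \<rho>\<close>
    for \<open>?d2\<close>; the factor \<open>real (Suc k)\<close> dominates both \<open>1\<close>
    and \<open>real k\<close>, and the series stays summable since
    \<open>\<theta> < 1\<close>.\<close>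
  define b where "b k = (M + 2 * M / \<rho>) * (real (Suc k) * \<theta> ^ k)" for k
  let ?S = "U \<times> ball (0::'c) \<rho>"
  have sb: "summable b" unfolding b_def
    using \<theta> geometric_deriv_sums[of \<theta>] by (intro summable_mult sums_summable) auto
  have b1: "norm (?d1 k x h) \<le> M * \<theta> ^ k * norm h" if "x \<in> ?S" for k x h
  proof -
    have "norm (?d1 k x h) \<le> (M * norm h) * (C * \<rho>\<^sup>2) ^ k"
    proof (rule norm_radial_term)
      have "norm (W' k (fst x) (fst h)) \<le> M * C ^ k * norm (fst h)" using bd' that by auto
      also have "\<dots> \<le> M * C ^ k * norm h" using C norm_fst_le[of "fst h" "snd h"] by (intro mult_left_mono) auto
      finally show "norm (W' k (fst x) (fst h)) \<le> M * norm h * C ^ k" by (simp add: mult_ac)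
    qed (use that C in auto)
    then show ?thesis by (simp add: \<theta>_def mult_ac)
  qed
  \<comment> \<open>The truncated exponent \<open>k - 1\<close> in \<open>?d2\<close> departs from
    the true one only at \<open>k = 0\<close>, where the factor \<open>real k\<close> is
    zero.\<close>
  have b2: "norm (?d2 k x h) \<le> 2 * M / \<rho> * (real k * \<theta> ^ k) * norm h" if "x \<in> ?S" for k x h
  proof (cases k)
    case (Suc j)
    have "\<bar>snd x \<bullet> snd h\<bar> \<le> norm (snd x) * norm (snd h)" by (rule Cauchy_Schwarz_ineq2)
    also have "\<dots> \<le> \<rho> * norm h" using that norm_snd_le[of "snd h" "fst h"] \<rho> by (intro mult_mono) auto
    finally have 1: "\<bar>snd x \<bullet> snd h\<bar> \<le> \<rho> * norm h" .
    have "norm ((snd x \<bullet> snd x) ^ j *\<^sub>R W k (fst x)) \<le> (M * C) * (C * \<rho>\<^sup>2) ^ j"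
      using that C bd[of "fst x" k] by (intro norm_radial_term) (auto simp: Suc mult_ac)
    then have "norm (?d2 k x h) \<le> (2 * real k * (\<rho> * norm h)) * ((M * C) * (C * \<rho>\<^sup>2) ^ j)"
      using mult_mono[OF 1, of "norm ((snd x \<bullet> snd x) ^ j *\<^sub>R W k (fst x))" "(M * C) * (C * \<rho>\<^sup>2) ^ j"] \<rho>
        mult_left_mono[of "\<bar>snd x \<bullet> snd h\<bar> * norm ((snd x \<bullet> snd x) ^ j *\<^sub>R W k (fst x))"
           "\<rho> * norm h * ((M * C) * (C * \<rho>\<^sup>2) ^ j)" "2 * real k"]
      by (simp add: Suc abs_mult mult_ac)
    also have "\<dots> = 2 * M / \<rho> * (real k * \<theta> ^ k) * norm h"
      using \<rho> by (simp add: Suc \<theta>_def power2_eq_square field_simps)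
    finally show ?thesis .
  qed simp
  have "((\<lambda>x. \<Sum>k. ?f k x) has_derivative (\<lambda>h. \<Sum>k. ?d1 k (xp, xq) h + ?d2 k (xp, xq) h)) (at (xp, xq))"
  proof (rule has_derivative_suminf_dominated[where S = ?S and b = b
        and f = ?f and f' = "\<lambda>k x h. ?d1 k x h + ?d2 k x h"])
    show "open ?S" "convex ?S" using U by (auto intro: open_Times convex_Times)
    show "summable b" by (rule sb)
    show "(xp, xq) \<in> ?S" using xp xq by simp
    fix x assume x: "x \<in> ?S"
    show "summable (\<lambda>k. ?f k x)"
      using x C bd by (intro radial_series_summable[where M=M and C=C and \<rho>=\<rho>]) auto
    fix k
    have Wd: "((\<lambda>x. W k (fst x)) has_derivative (\<lambda>h. W' k (fst x) (fst h))) (at x)"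
      by (rule has_derivative_compose[where f=fst and f'=fst]) (use der x in \<open>auto intro!: derivative_intros\<close>)
    show "(?f k has_derivative (\<lambda>h. ?d1 k x h + ?d2 k x h)) (at x)"
    proof -
      have "((\<lambda>x. snd x \<bullet> snd x) has_derivative (\<lambda>h. 2 * (snd x \<bullet> snd h))) (at x)"
        by (auto intro!: derivative_eq_intros simp: inner_commute)
      from has_derivative_scaleR[OF has_derivative_power[OF this] Wd] show ?thesis
        by (rule has_derivative_eq_rhs) (simp add: fun_eq_iff mult_ac)
    qed
    fix h
    have "norm (?d1 k x h + ?d2 k x h) \<le> M * \<theta> ^ k * norm h + 2 * M / \<rho> * (real k * \<theta> ^ k) * norm h"
      by (rule norm_triangle_le[OF add_mono[OF b1[OF x] b2[OF x]]])
    also have "\<dots> \<le> (M * (real (Suc k) * \<theta> ^ k)) * norm h + 2 * M / \<rho> * (real (Suc k) * \<theta> ^ k) * norm h"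
      using \<rho> \<theta> C by (intro add_mono mult_right_mono mult_left_mono) (auto simp: distrib_right)
    also have "\<dots> = b k * norm h" by (simp add: b_def algebra_simps)
    finally show "norm (?d1 k x h + ?d2 k x h) \<le> b k * norm h" .
  qed
  moreover have "(\<Sum>k. ?d1 k (xp, xq) h + ?d2 k (xp, xq) h) = (\<Sum>k. (xq \<bullet> xq) ^ k *\<^sub>R W' k xp (fst h)) +
            (2 * (xq \<bullet> snd h)) *\<^sub>R radial_series (\<lambda>k y. real (Suc k) *\<^sub>R W (Suc k) y) (xp, xq)" for h
  proof -
    have x: "(xp, xq) \<in> ?S" using xp xq by simp
    have s1: "summable (\<lambda>k. ?d1 k (xp, xq) h)"
    proof (rule summable_comparison_test'[of "\<lambda>k. M * \<theta> ^ k * norm h" 0])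
      show "summable (\<lambda>k. M * \<theta> ^ k * norm h)"
        using \<theta> by (intro summable_mult2 summable_mult summable_geometric) simp
    qed (rule b1[OF x])
    have s2: "summable (\<lambda>k. ?d2 k (xp, xq) h)"
    proof (rule summable_comparison_test'[of "\<lambda>k. b k * norm h" 0])
      show "summable (\<lambda>k. b k * norm h)" using sb by (rule summable_mult2)
      fix k
      have "2 * M / \<rho> * (real k * \<theta> ^ k) * norm h \<le> (M + 2 * M / \<rho>) * (real (Suc k) * \<theta> ^ k) * norm h"
        by (rule mult_right_mono[OF mult_mono]) (use \<rho> \<theta> C in \<open>auto intro: mult_right_mono\<close>)
      then show "norm (?d2 k (xp, xq) h) \<le> b k * norm h"
        using b2[OF x, of k h] unfolding b_def by linarith
    qed
    have "summable (\<lambda>k. (xq \<bullet> xq) ^ k *\<^sub>R (real (Suc k) *\<^sub>R W (Suc k) xp))"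
    proof (rule summable_comparison_test'[of "\<lambda>k. M * C * (real (Suc k) * \<theta> ^ k)" 0])
      show "summable (\<lambda>k. M * C * (real (Suc k) * \<theta> ^ k))"
        using \<theta> geometric_deriv_sums[of \<theta>] by (intro summable_mult sums_summable) auto
      fix k
      have "norm ((xq \<bullet> xq) ^ k *\<^sub>R (W (Suc k) xp)) \<le> M * C * (C * \<rho>\<^sup>2) ^ k"
        using C bd[OF xp, of "Suc k"] xq by (intro norm_radial_term) (auto simp: mult_ac)
      then have *: "real (Suc k) * norm ((xq \<bullet> xq) ^ k *\<^sub>R (W (Suc k) xp)) \<le> real (Suc k) * (M * C * (C * \<rho>\<^sup>2) ^ k)"
        by (intro mult_left_mono) auto
      show "norm ((xq \<bullet> xq) ^ k *\<^sub>R (real (Suc k) *\<^sub>R W (Suc k) xp)) \<le> M * C * (real (Suc k) * \<theta> ^ k)"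
        using * by (simp add: \<theta>_def mult.left_commute)
    qed
    then have "(2 * (xq \<bullet> snd h)) *\<^sub>R radial_series (\<lambda>k y. real (Suc k) *\<^sub>R W (Suc k) y) (xp, xq) =
        (\<Sum>k. (2 * (xq \<bullet> snd h)) *\<^sub>R (xq \<bullet> xq) ^ k *\<^sub>R (real (Suc k) *\<^sub>R W (Suc k) xp))"
      unfolding radial_series_def fst_conv snd_conv by (rule suminf_scaleR_right)
    also have "\<dots> = (\<Sum>k. ?d2 (Suc k) (xp, xq) h)"
      by (rule suminf_cong) (simp add: mult_ac del: of_nat_Suc)
    also have "\<dots> = (\<Sum>k. ?d2 k (xp, xq) h)"
      using suminf_split_head[OF s2] by simp
    finally show ?thesis using suminf_add[OF s1 s2] by simp
  qed
  ultimately show ?thesis unfolding radial_series_def[abs_def] by simp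
qed

section \<open>Coefficient families of geometric growth\<close>

definition geom_bounded :: "'b set \<Rightarrow> real \<Rightarrow> (nat \<Rightarrow> 'b \<Rightarrow> 'a::real_normed_vector) \<Rightarrow> bool" where
  "geom_bounded U C W \<longleftrightarrow> (\<exists>M\<ge>0. \<forall>k. \<forall>y\<in>U. norm (W k y) \<le> M * C ^ k)"

text \<open>Only the ratio \<open>C\<close> decides where a radial series converges. So
  \<open>geom_bounded\<close> hides the factor \<open>M\<close> behind a quantifier, and
  \<open>M\<close> may differ for each derivative while \<open>C\<close> is shared by all of
  them.\<close>

definition geom_bounded_C1 ::
    "'b::euclidean_space set \<Rightarrow> real \<Rightarrow> (nat \<Rightarrow> 'b \<Rightarrow> 'a::real_normed_vector) \<Rightarrow> bool" where
  "geom_bounded_C1 U C W \<longleftrightarrow> geom_bounded U C W \<and> (\<forall>k. \<forall>y\<in>U. W k differentiable (at y)) \<and>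
     (\<forall>b\<in>Basis. geom_bounded U C (\<lambda>k. pd (W k) b))"

definition geom_bounded_C2 ::
    "'b::euclidean_space set \<Rightarrow> real \<Rightarrow> (nat \<Rightarrow> 'b \<Rightarrow> 'a::real_normed_vector) \<Rightarrow> bool" where
  "geom_bounded_C2 U C W \<longleftrightarrow> geom_bounded_C1 U C W \<and> (\<forall>b\<in>Basis. geom_bounded_C1 U C (\<lambda>k. pd (W k) b))"

text \<open>The coefficients of the derivative of a power series in the squared radius.\<close>

definition weighted_shift :: "(nat \<Rightarrow> 'b \<Rightarrow> 'a) \<Rightarrow> nat \<Rightarrow> 'b \<Rightarrow> 'a::real_vector" where
  "weighted_shift W k y = real (Suc k) *\<^sub>R W (Suc k) y"

lemma geom_boundedI: "0 \<le> M \<Longrightarrow> (\<And>k y. y \<in> U \<Longrightarrow> norm (W k y) \<le> M * C ^ k) \<Longrightarrow> geom_bounded U C W"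
  unfolding geom_bounded_def by blast

lemma geom_bounded_cong:
  "geom_bounded U C W \<Longrightarrow> (\<And>k y. y \<in> U \<Longrightarrow> W k y = V k y) \<Longrightarrow> geom_bounded U C V"
  unfolding geom_bounded_def by simp

lemma geom_bounded_mono:
  assumes "geom_bounded U C W" "0 \<le> C" "C \<le> D"
  shows "geom_bounded U D W"
proof -
  obtain M where M: "M \<ge> 0" "\<And>k y. y \<in> U \<Longrightarrow> norm (W k y) \<le> M * C ^ k"
    using assms(1) unfolding geom_bounded_def by blast
  have "norm (W k y) \<le> M * D ^ k" if "y \<in> U" for k y
    using M(2)[OF that, of k] mult_left_mono[OF power_mono[OF assms(3,2), of k] M(1)] by linarith
  then show ?thesis by (rule geom_boundedI[OF M(1)])
qed

lemma geom_bounded_linear: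
  assumes "geom_bounded U C W" "bounded_linear h"
  shows "geom_bounded U C (\<lambda>k y. h (W k y))"
proof -
  obtain M where M: "M \<ge> 0" "\<And>k y. y \<in> U \<Longrightarrow> norm (W k y) \<le> M * C ^ k"
    using assms(1) unfolding geom_bounded_def by blast
  obtain K where K: "K > 0" "\<And>a. norm (h a) \<le> norm a * K"
    using bounded_linear.pos_bounded[OF assms(2)] by blast
  have "norm (h (W k y)) \<le> (M * K) * C ^ k" if "y \<in> U" for k y
    using order_trans[OF K(2) mult_right_mono[OF M(2)[OF that, of k]]] K(1) by (simp add: mult_ac)
  then show ?thesis by (intro geom_boundedI[of "M * K"]) (use M K in auto)
qed

lemma geom_bounded_add:
  assumes "geom_bounded U C W" "geom_bounded U C V"
  shows "geom_bounded U C (\<lambda>k y. W k y + V k y)"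
proof -
  obtain M N where "M \<ge> 0" "\<And>k y. y \<in> U \<Longrightarrow> norm (W k y) \<le> M * C ^ k"
      "N \<ge> 0" "\<And>k y. y \<in> U \<Longrightarrow> norm (V k y) \<le> N * C ^ k"
    using assms unfolding geom_bounded_def by blast
  then show ?thesis
    by (intro geom_boundedI[of "M + N"]) (auto simp: distrib_right intro!: norm_triangle_le add_mono)
qed

lemma geom_bounded_sum:
  assumes "finite I" "\<And>i. i \<in> I \<Longrightarrow> geom_bounded U C (W i)"
  shows "geom_bounded U C (\<lambda>k y. \<Sum>i\<in>I. W i k y)"
  using assms
proof (induction I)
  case empty
  show ?case by (rule geom_boundedI[of 0]) auto
qed (simp add: geom_bounded_add)

text \<open>The crude bound \<open>real (Suc k) \<le> 2 ^ k\<close> turns the polynomial factor into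
  a doubled ratio; two shifts, as in a second derivative, therefore cost the factor \<open>4\<close>
  seen in later hypotheses.\<close>

lemma geom_bounded_shift:
  assumes "geom_bounded U C W" "0 \<le> C"
  shows "geom_bounded U (2 * C) (weighted_shift W)"
proof -
  obtain M where M: "M \<ge> 0" "\<And>k y. y \<in> U \<Longrightarrow> norm (W k y) \<le> M * C ^ k"
    using assms(1) unfolding geom_bounded_def by blast
  have "norm (weighted_shift W k y) \<le> (M * C) * (2 * C) ^ k" if "y \<in> U" for k y
  proof -
    have "real (Suc k) \<le> 2 ^ k" using less_exp[of k] by (metis Suc_leI of_nat_le_iff of_nat_numeral of_nat_power)
    then have "real (Suc k) * norm (W (Suc k) y) \<le> 2 ^ k * (M * C ^ Suc k)"
      using M(2)[OF that, of "Suc k"] by (intro mult_mono) (auto simp del: power_Suc)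
    then show ?thesis by (simp add: weighted_shift_def power_mult_distrib mult_ac del: of_nat_Suc)
  qed
  then show ?thesis by (rule geom_boundedI[rotated]) (use M assms in auto)
qed

lemma geom_bounded_C1_cong:
  assumes "open U" "geom_bounded_C1 U C W" "\<And>k y. y \<in> U \<Longrightarrow> W k y = V k y"
  shows "geom_bounded_C1 U C V"
  unfolding geom_bounded_C1_def
proof (intro conjI allI ballI)
  show "geom_bounded U C V"
    using assms(2) geom_bounded_cong[OF _ assms(3)] unfolding geom_bounded_C1_def by auto
  show "V k differentiable (at y)" if "y \<in> U" for k y
    using assms(2) that unfolding geom_bounded_C1_def
    by (intro differentiable_cong_open[OF assms(1) that assms(3)]) auto
  show "geom_bounded U C (\<lambda>k. pd (V k) b)" if "b \<in> Basis" for b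
  proof (rule geom_bounded_cong[of U C "\<lambda>k. pd (W k) b"])
    show "geom_bounded U C (\<lambda>k. pd (W k) b)"
      using assms(2) that unfolding geom_bounded_C1_def by blast
    show "pd (W k) b y = pd (V k) b y" if "y \<in> U" for k y
      by (rule pd_cong_open[OF assms(1) that assms(3)])
  qed
qed

lemma geom_bounded_C1_shift:
  assumes "geom_bounded_C1 U C W" "0 \<le> C" "open U"
  shows "geom_bounded_C1 U (2 * C) (weighted_shift W)"
proof -
  have "weighted_shift W k differentiable (at y)" 
       "pd (weighted_shift W k) b y = weighted_shift (\<lambda>k. pd (W k) b) k y" if "y \<in> U" for k y b
    using differentiable_linear[OF bounded_linear_scaleR_right, of "W (Suc k)" y "real (Suc k)"]
      pd_linear[OF bounded_linear_scaleR_right, of "W (Suc k)" y "real (Suc k)"]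
      assms(1) that unfolding geom_bounded_C1_def weighted_shift_def[abs_def] by (auto simp del: of_nat_Suc)
  moreover have "geom_bounded U (2 * C) (weighted_shift W)"
    using assms geom_bounded_shift unfolding geom_bounded_C1_def by blast+
  moreover have "geom_bounded U (2 * C) (\<lambda>k. pd (weighted_shift W k) b)" if "b \<in> Basis" for b
    by (rule geom_bounded_cong[of U "2 * C" "weighted_shift (\<lambda>k. pd (W k) b)"])
      (use assms that calculation(2) in \<open>auto simp: geom_bounded_C1_def intro!: geom_bounded_shift\<close>)
  ultimately show ?thesis unfolding geom_bounded_C1_def
    by blast
qed

lemma radial_series_sums:
  fixes W :: "nat \<Rightarrow> 'b \<Rightarrow> 'a::banach" and x :: "'b \<times> 'c::euclidean_space"
  assumes "geom_bounded U C W" "0 \<le> C" "C * \<rho>\<^sup>2 < 1" "x \<in> U \<times> ball 0 \<rho>"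
  shows "(\<lambda>k. (snd x \<bullet> snd x) ^ k *\<^sub>R W k (fst x)) sums radial_series W x"
proof -
  obtain M where "M \<ge> 0" "\<And>k y. y \<in> U \<Longrightarrow> norm (W k y) \<le> M * C ^ k"
    using assms(1) unfolding geom_bounded_def by blast
  then have "summable (\<lambda>k. (snd x \<bullet> snd x) ^ k *\<^sub>R W k (fst x))"
    using assms by (intro radial_series_summable[of _ \<rho> W _ M C]) auto
  then show ?thesis unfolding radial_series_def by (rule summable_sums)
qed

lemma radial_series_cong:
  "fst x \<in> U \<Longrightarrow> (\<And>k y. y \<in> U \<Longrightarrow> W k y = V k y) \<Longrightarrow> radial_series W x = radial_series V x"
  unfolding radial_series_def by simp

lemma radial_series_C1:
  fixes W :: "nat \<Rightarrow> 'b::euclidean_space \<Rightarrow> 'a::banach" and x :: "'b \<times> 'c::euclidean_space"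
  assumes U: "open U" "convex U" and W: "geom_bounded_C1 U C W"
    and C: "0 \<le> C" "C * \<rho>\<^sup>2 < 1" and x: "x \<in> U \<times> ball 0 \<rho>"
  shows "radial_series W differentiable (at x)"
    and "pd (radial_series W) h x = radial_series (\<lambda>k. pd (W k) (fst h)) x +
           (2 * (snd x \<bullet> snd h)) *\<^sub>R radial_series (weighted_shift W) x"
proof -
  obtain M where M: "M \<ge> 0" "\<And>k y. y \<in> U \<Longrightarrow> norm (W k y) \<le> M * C ^ k"
    using W unfolding geom_bounded_C1_def geom_bounded_def by blast
  have "\<forall>b\<in>Basis. \<exists>N\<ge>0. \<forall>k. \<forall>y\<in>U. norm (pd (W k) b y) \<le> N * C ^ k"
    using W unfolding geom_bounded_C1_def geom_bounded_def by blast
  then obtain N where N: "\<And>b. b \<in> Basis \<Longrightarrow> N b \<ge> 0"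
      "\<And>b k y. b \<in> Basis \<Longrightarrow> y \<in> U \<Longrightarrow> norm (pd (W k) b y) \<le> N b * C ^ k"
    by metis
  \<comment> \<open>Summing the bounds of all partial derivatives gives one constant for the full
    derivative in every direction.\<close>
  define K where "K = M + (\<Sum>b\<in>Basis. N b)"
  have K: "K \<ge> 0" unfolding K_def using M N by (simp add: sum_nonneg)
  have df: "W k differentiable (at y)" if "y \<in> U" for k y
    using W that unfolding geom_bounded_C1_def by blast
  obtain xp xq where x_eq: "x = (xp, xq)" by (cases x)
  have "(radial_series W has_derivative
      (\<lambda>h. (\<Sum>k. (xq \<bullet> xq) ^ k *\<^sub>R pd (W k) (fst h) xp) +
            (2 * (xq \<bullet> snd h)) *\<^sub>R radial_series (\<lambda>k y. real (Suc k) *\<^sub>R W (Suc k) y) (xp, xq)))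
      (at (xp, xq))"
  proof (rule radial_series_has_derivative[OF U C(1) K C(2)])
    show "xp \<in> U" "norm xq < \<rho>" using x x_eq by auto
    fix k y assume y: "y \<in> U"
    show "(W k has_derivative (\<lambda>h. pd (W k) h y)) (at y)" by (rule has_derivative_pd[OF df[OF y]])
    have "M * C ^ k \<le> K * C ^ k"
      using N C by (intro mult_right_mono) (auto simp: K_def sum_nonneg)
    then show "norm (W k y) \<le> K * C ^ k" using M(2)[OF y, of k] by linarith
    fix h
    have "norm (pd (W k) h y) \<le> (\<Sum>b\<in>Basis. norm h * (N b * C ^ k))"
      unfolding pd_expand[OF df[OF y], of k h]
      by (rule sum_norm_le) (use N y C in \<open>auto intro!: mult_mono Basis_le_norm\<close>)
    also have "\<dots> = (\<Sum>b\<in>Basis. N b) * (C ^ k * norm h)"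
      by (simp add: sum_distrib_left sum_distrib_right mult_ac)
    also have "\<dots> \<le> K * (C ^ k * norm h)"
      using M C by (intro mult_right_mono) (auto simp: K_def)
    finally show "norm (pd (W k) h y) \<le> K * C ^ k * norm h" by (simp add: mult_ac)
  qed
  then have d: "(radial_series W has_derivative
      (\<lambda>h. radial_series (\<lambda>k. pd (W k) (fst h)) x +
            (2 * (snd x \<bullet> snd h)) *\<^sub>R radial_series (weighted_shift W) x)) (at x)"
    unfolding x_eq radial_series_def weighted_shift_def by simp
  show "radial_series W differentiable (at x)" using d differentiable_def by blast
  show "pd (radial_series W) h x = radial_series (\<lambda>k. pd (W k) (fst h)) x +
           (2 * (snd x \<bullet> snd h)) *\<^sub>R radial_series (weighted_shift W) x"
    by (rule pd_eqI[OF d])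
qed

lemma sum_Basis_prod:
  "(\<Sum>h\<in>(Basis :: ('b::euclidean_space \<times> 'c::euclidean_space) set). g h) =
     (\<Sum>b\<in>Basis. g (b, 0)) + (\<Sum>d\<in>Basis. g (0, d))"
  unfolding Basis_prod_def
  by (subst sum.union_disjoint) (auto simp: sum.reindex inj_on_def nonzero_Basis)

text \<open>With \<open>s\<close> for the squared radius and \<open>d\<close> for the dimension of
  the second factor, the Laplacian of \<open>F s\<close> there is
  \<open>4 * s * F'' + 2 * d * F'\<close>; on coefficients this is
  \<open>4 * k * (k + 1) + 2 * d * (k + 1)\<close>, which factors as shown. The hypothesis on
  \<open>4 * C\<close> leaves room for two shifts.\<close>

lemma laplacian_radial_series:
  fixes W :: "nat \<Rightarrow> 'b::euclidean_space \<Rightarrow> 'a::banach"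
  assumes U: "open U" "convex U" and W: "geom_bounded_C2 U C W"
    and C: "0 \<le> C" "4 * C * \<rho>\<^sup>2 < 1"
  shows "has_laplacian_on (U \<times> ball (0::'c::euclidean_space) \<rho>) (radial_series W)
     (radial_series (\<lambda>k y. laplacian (W k) y +
        ((2 * real k + 2) * (2 * real k + DIM('c))) *\<^sub>R W (Suc k) y))"
proof -
  let ?S = "U \<times> ball (0::'c) \<rho>"
  let ?R = "radial_series :: (nat \<Rightarrow> 'b \<Rightarrow> 'a) \<Rightarrow> 'b \<times> 'c \<Rightarrow> 'a"
  have C': "C * \<rho>\<^sup>2 < 1" "2 * C * \<rho>\<^sup>2 < 1" "2 * (2 * C) * \<rho>\<^sup>2 < 1" "0 \<le> 2 * C" "0 \<le> 2 * (2 * C)"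
    using C mult_nonneg_nonneg[OF C(1) zero_le_power2[of \<rho>]] by (auto simp: mult_ac)
  have W1: "geom_bounded_C1 U C W" "b \<in> Basis \<Longrightarrow> geom_bounded_C1 U C (\<lambda>k. pd (W k) b)" for b
    using W unfolding geom_bounded_C2_def by auto
  have W2: "geom_bounded_C1 U (2 * C) (weighted_shift W)"
    using W1 C U geom_bounded_C1_shift by blast
  have W3: "geom_bounded_C1 U (2 * (2 * C)) (weighted_shift (weighted_shift W))"
    using W2 C' U geom_bounded_C1_shift by blast
  \<comment> \<open>A basis vector of the product lies in one of the two factors, so only one part
    of \<open>radial_series_C1(2)\<close> survives; \<open>snd h = 0\<close> tells the cases
    apart.\<close>
  let ?g = "\<lambda>h::'b\<times>'c. if snd h = 0 then ?R (\<lambda>k. pd (W k) (fst h))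
      else (\<lambda>x. (2 * (snd x \<bullet> snd h)) *\<^sub>R ?R (weighted_shift W) x)"
  have zero: "?R (\<lambda>k. pd (V k) 0) x = 0" if "geom_bounded_C1 U D V" "x \<in> ?S" for V D x
  proof -
    have "?R (\<lambda>k. pd (V k) 0) x = ?R (\<lambda>k y. 0) x"
      using that linear_0[OF linear_pd] unfolding geom_bounded_C1_def
      by (intro radial_series_cong[where U=U]) auto
    then show ?thesis by (simp add: radial_series_def)
  qed
  note R1 = radial_series_C1[OF U, where \<rho>=\<rho>]
  have dr: "((\<lambda>x. (2 * (snd x \<bullet> d)) *\<^sub>R ?R (weighted_shift W) x) has_derivative
     (\<lambda>h. (2 * (snd x \<bullet> d)) *\<^sub>R pd (?R (weighted_shift W)) h x +
        (2 * (snd h \<bullet> d)) *\<^sub>R ?R (weighted_shift W) x)) (at x)" if x: "x \<in> ?S" for x d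
    using has_derivative_pd[OF R1(1)[OF W2 C'(4,2) x]] by (auto intro!: derivative_eq_intros)
  show ?thesis
  proof (rule has_laplacian_onI[where g' = ?g and g'' = "\<lambda>h x u. pd (?g h) u x"])
    show "open ?S" using U by (intro open_Times) auto
    fix x assume x: "x \<in> ?S"
    show "radial_series W differentiable (at x)" by (rule R1(1)[OF W1(1) C(1) C'(1) x])
    show "(\<Sum>h\<in>Basis. pd (?g h) h x) = radial_series (\<lambda>k y. laplacian (W k) y +
        ((2 * real k + 2) * (2 * real k + DIM('c))) *\<^sub>R W (Suc k) y) x"
    proof -
      let ?r = "snd x \<bullet> snd x"
      let ?V = "weighted_shift (weighted_shift W)"
      have p: "(\<Sum>b\<in>Basis. pd (?g (b, 0)) (b, 0) x) = ?R (\<lambda>k. laplacian (W k)) x"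
      proof -
        have "(\<Sum>b\<in>Basis. pd (?g (b, 0)) (b, 0) x) = (\<Sum>b\<in>Basis. ?R (\<lambda>k. pd (pd (W k) b) b) x)"
          by (rule sum.cong) (simp_all add: R1(2)[OF W1(2) C(1) C'(1) x])
        moreover have "(\<lambda>k. \<Sum>b\<in>Basis. ?r ^ k *\<^sub>R pd (pd (W k) b) b (fst x)) sums
            (\<Sum>b\<in>Basis. ?R (\<lambda>k. pd (pd (W k) b) b) x)"
          using W1(2) unfolding geom_bounded_C1_def
          by (intro sums_sum radial_series_sums[OF _ C(1) C'(1) x]) auto
        ultimately show ?thesis
          by (simp add: radial_series_def laplacian_def sums_iff scaleR_sum_right)
      qed
      have "(\<Sum>d\<in>Basis. pd (?g (0, d)) (0, d) x) =
          (\<Sum>d\<in>Basis. (4 * (snd x \<bullet> d)\<^sup>2) *\<^sub>R ?R ?V x + 2 *\<^sub>R ?R (weighted_shift W) x)"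
      proof (rule sum.cong[OF refl])
        fix d :: 'c assume d: "d \<in> Basis"
        then have "pd (?g (0, d)) (0, d) x = (2 * (snd x \<bullet> d)) *\<^sub>R pd (?R (weighted_shift W)) (0, d) x +
            (2 * (d \<bullet> d)) *\<^sub>R ?R (weighted_shift W) x"
          using pd_eqI[OF dr[OF x, of d], of "(0,d)"] by (simp add: nonzero_Basis)
        also have "pd (?R (weighted_shift W)) (0, d) x = (2 * (snd x \<bullet> d)) *\<^sub>R ?R ?V x"
          using R1(2)[OF W2 C'(4,2) x, of "(0,d)"] zero[OF W2 x] by simp
        finally show "pd (?g (0, d)) (0, d) x =
            (4 * (snd x \<bullet> d)\<^sup>2) *\<^sub>R ?R ?V x + 2 *\<^sub>R ?R (weighted_shift W) x"
          using d by (simp add: power2_eq_square mult_ac)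
      qed
      also have "\<dots> = (4 * ?r) *\<^sub>R ?R ?V x + (2 * real DIM('c)) *\<^sub>R ?R (weighted_shift W) x"
      proof -
        have "(\<Sum>d\<in>Basis. 4 * (snd x \<bullet> d)\<^sup>2) = 4 * ?r"
          unfolding euclidean_inner[of "snd x" "snd x"] sum_distrib_left by (simp add: power2_eq_square)
        then show ?thesis
          by (simp add: sum.distrib scaleR_sum_left[symmetric] sum_constant_scaleR mult.commute)
      qed
      finally have q: "(\<Sum>d\<in>Basis. pd (?g (0, d)) (0, d) x) =
          (4 * ?r) *\<^sub>R ?R ?V x + (2 * real DIM('c)) *\<^sub>R ?R (weighted_shift W) x" .
      have sV: "(\<lambda>k. ?r ^ k *\<^sub>R ?V k (fst x)) sums ?R ?V x"
        using W3 unfolding geom_bounded_C1_def by (intro radial_series_sums[OF _ C'(5,3) x]) auto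
      have sW: "(\<lambda>k. ?r ^ k *\<^sub>R weighted_shift W k (fst x)) sums ?R (weighted_shift W) x"
        using W2 unfolding geom_bounded_C1_def by (intro radial_series_sums[OF _ C'(4,2) x]) auto
      have sL: "(\<lambda>k. ?r ^ k *\<^sub>R laplacian (W k) (fst x)) sums ?R (\<lambda>k. laplacian (W k)) x"
      proof (rule radial_series_sums[OF _ C(1) C'(1) x])
        show "geom_bounded U C (\<lambda>k. laplacian (W k))"
          unfolding laplacian_def[abs_def] using W1(2) unfolding geom_bounded_C1_def
          by (intro geom_bounded_sum) auto
      qed
      have "(\<lambda>k. (4 * ?r) *\<^sub>R ?r ^ k *\<^sub>R ?V k (fst x)) sums ((4 * ?r) *\<^sub>R ?R ?V x)"
        by (rule sums_scaleR_right[OF sV])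
      then have "(\<lambda>k. ?r ^ Suc k *\<^sub>R (4 * real (Suc k) * real (Suc (Suc k))) *\<^sub>R W (Suc (Suc k)) (fst x)) sums ((4 * ?r) *\<^sub>R ?R ?V x)"
        by (simp add: weighted_shift_def mult_ac del: of_nat_Suc)
      \<comment> \<open>The extra factor \<open>?r\<close> raises the power by one; the index can be
        shifted back because the new term at \<open>k = 0\<close> contains the factor
        \<open>real k\<close>.\<close>
      then have "(\<lambda>k. ?r ^ k *\<^sub>R (4 * real k * real (Suc k)) *\<^sub>R W (Suc k) (fst x)) sums ((4 * ?r) *\<^sub>R ?R ?V x)"
        by (subst (asm) sums_Suc_iff) simp
      from sums_add[OF sL sums_add[OF this sums_scaleR_right[OF sW, of "2 * real DIM('c)"]]]
      have "(\<lambda>k. ?r ^ k *\<^sub>R (laplacian (W k) (fst x) +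
        ((2 * real k + 2) * (2 * real k + DIM('c))) *\<^sub>R W (Suc k) (fst x)))
          sums (?R (\<lambda>k. laplacian (W k)) x + ((4 * ?r) *\<^sub>R ?R ?V x + (2 * real DIM('c)) *\<^sub>R ?R (weighted_shift W) x))"
        by (rule sums_cong[THEN iffD1, rotated]) (simp add: weighted_shift_def algebra_simps)
      then show ?thesis
        unfolding sum_Basis_prod p q by (simp add: radial_series_def sums_iff)
    qed
    fix h :: "'b \<times> 'c" assume "h \<in> Basis"
    then consider b where "h = (b, 0)" "b \<in> Basis" | d where "h = (0, d)" "d \<in> Basis" "d \<noteq> 0"
      unfolding Basis_prod_def using nonzero_Basis by fastforce
    note cs = this
    show "pd (radial_series W) h x = ?g h x"
      using cs by cases (simp_all add: R1(2)[OF W1(1) C(1) C'(1) x] zero[OF W1(1) x])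
    show "(?g h has_derivative (\<lambda>u. pd (?g h) u x)) (at x)"
    proof (rule has_derivative_pd)
      show "?g h differentiable (at x)"
        using cs
      proof cases
        case 1
        then show ?thesis using R1(1)[OF W1(2) C(1) C'(1) x] by simp
      next
        case 2
        then show ?thesis using dr[OF x] differentiable_def by auto
      qed
    qed
  qed
qed

section \<open>Multivariate power series\<close>

definition mdeg :: "('n::finite \<Rightarrow> nat) \<Rightarrow> nat" where
  "mdeg \<alpha> = (\<Sum>i\<in>UNIV. \<alpha> i)"

definition mpow :: "real^'n \<Rightarrow> ('n::finite \<Rightarrow> nat) \<Rightarrow> real" where
  "mpow y \<alpha> = (\<Prod>i\<in>UNIV. (y $ i) ^ \<alpha> i)"

definition ps_eval :: "(('n::finite \<Rightarrow> nat) \<Rightarrow> 'a::real_normed_vector) \<Rightarrow> real^'n \<Rightarrow> 'a" where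
  "ps_eval c y = (\<Sum>\<^sub>\<infinity>\<alpha>. mpow y \<alpha> *\<^sub>R c \<alpha>)"

text \<open>Absolute convergence at the corner of the cube of half-width \<open>\<delta>\<close>,
  which controls the series on the whole closed cube. With \<open>ps_norm\<close> in place of a
  supremum norm, derivatives can be estimated monomial by monomial.\<close>

definition ps_conv :: "(('n::finite \<Rightarrow> nat) \<Rightarrow> 'a::real_normed_vector) \<Rightarrow> real \<Rightarrow> bool" where
  "ps_conv c \<delta> \<longleftrightarrow> (\<lambda>\<alpha>. norm (c \<alpha>) * \<delta> ^ mdeg \<alpha>) summable_on UNIV"

definition ps_norm :: "(('n::finite \<Rightarrow> nat) \<Rightarrow> 'a::real_normed_vector) \<Rightarrow> real \<Rightarrow> real" where
  "ps_norm c \<delta> = (\<Sum>\<^sub>\<infinity>\<alpha>. norm (c \<alpha>) * \<delta> ^ mdeg \<alpha>)"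

definition ps_deriv :: "'n::finite \<Rightarrow> (('n \<Rightarrow> nat) \<Rightarrow> 'a::real_vector) \<Rightarrow> ('n \<Rightarrow> nat) \<Rightarrow> 'a" where
  "ps_deriv i c \<beta> = real (Suc (\<beta> i)) *\<^sub>R c (\<beta>(i := Suc (\<beta> i)))"

lemma ps_norm_nonneg: "0 \<le> \<delta> \<Longrightarrow> 0 \<le> ps_norm c \<delta>"
  unfolding ps_norm_def by (intro infsum_nonneg) auto

lemma ps_conv_mono:
  assumes "ps_conv c \<delta>" "0 \<le> \<delta>'" "\<delta>' \<le> \<delta>"
  shows "ps_conv c \<delta>'" "ps_norm c \<delta>' \<le> ps_norm c \<delta>"
proof -
  have le: "norm (c \<alpha>) * \<delta>' ^ mdeg \<alpha> \<le> norm (c \<alpha>) * \<delta> ^ mdeg \<alpha>" for \<alpha>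
    using assms by (intro mult_left_mono power_mono) auto
  show *: "ps_conv c \<delta>'"
    using assms(1) unfolding ps_conv_def
    by (rule summable_on_comparison_test) (use le assms in auto)
  show "ps_norm c \<delta>' \<le> ps_norm c \<delta>"
    unfolding ps_norm_def using assms(1) * le unfolding ps_conv_def by (intro infsum_mono) auto
qed

lemma has_sum_finite_sum:
  fixes f :: "'i \<Rightarrow> 'b \<Rightarrow> 'a::topological_comm_monoid_add"
  assumes "finite I" "\<And>i. i \<in> I \<Longrightarrow> (f i has_sum s i) A"
  shows "((\<lambda>x. \<Sum>i\<in>I. f i x) has_sum (\<Sum>i\<in>I. s i)) A"
  using assms by (induction I) (auto intro: has_sum_add)

lemma ps_conv_sum:
  assumes "finite I" "\<And>i. i \<in> I \<Longrightarrow> ps_conv (c i) \<delta>" "0 \<le> \<delta>"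
  shows "ps_conv (\<lambda>\<alpha>. \<Sum>i\<in>I. c i \<alpha>) \<delta>" "ps_norm (\<lambda>\<alpha>. \<Sum>i\<in>I. c i \<alpha>) \<delta> \<le> (\<Sum>i\<in>I. ps_norm (c i) \<delta>)"
proof -
  have s: "((\<lambda>\<alpha>. \<Sum>i\<in>I. norm (c i \<alpha>) * \<delta> ^ mdeg \<alpha>) has_sum (\<Sum>i\<in>I. ps_norm (c i) \<delta>)) UNIV"
    unfolding ps_norm_def
    using assms(2) by (intro has_sum_finite_sum[OF assms(1)] has_sum_infsum) (simp add: ps_conv_def)
  have le: "norm (\<Sum>i\<in>I. c i \<alpha>) * \<delta> ^ mdeg \<alpha> \<le> (\<Sum>i\<in>I. norm (c i \<alpha>) * \<delta> ^ mdeg \<alpha>)" for \<alpha>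
    unfolding sum_distrib_right[symmetric] by (intro mult_right_mono norm_sum) (use assms in auto)
  show *: "ps_conv (\<lambda>\<alpha>. \<Sum>i\<in>I. c i \<alpha>) \<delta>"
    unfolding ps_conv_def
    by (rule summable_on_comparison_test[OF has_sum_imp_summable[OF s]]) (use le assms in auto)
  have "ps_norm (\<lambda>\<alpha>. \<Sum>i\<in>I. c i \<alpha>) \<delta> \<le> (\<Sum>\<^sub>\<infinity>\<alpha>. \<Sum>i\<in>I. norm (c i \<alpha>) * \<delta> ^ mdeg \<alpha>)"
    unfolding ps_norm_def using * has_sum_imp_summable[OF s] le unfolding ps_conv_def
    by (intro infsum_mono) auto
  then show "ps_norm (\<lambda>\<alpha>. \<Sum>i\<in>I. c i \<alpha>) \<delta> \<le> (\<Sum>i\<in>I. ps_norm (c i) \<delta>)"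
    using infsumI[OF s] by simp
qed

text \<open>The difference \<open>\<delta> ^ Suc m - \<delta>' ^ Suc m\<close> is
  \<open>\<delta> - \<delta>'\<close> times a sum of \<open>Suc m\<close> products, each at least
  \<open>\<delta>' ^ m\<close>; induction proves this lower bound, and the subtracted power is then
  dropped.\<close>

lemma power_deriv_le:
  fixes \<delta> \<delta>' :: real
  assumes "0 \<le> \<delta>'" "\<delta>' < \<delta>"
  shows "real (Suc m) * \<delta>' ^ m \<le> \<delta> ^ Suc m / (\<delta> - \<delta>')"
proof -
  have "real (Suc m) * \<delta>' ^ m * (\<delta> - \<delta>') \<le> \<delta> ^ Suc m - \<delta>' ^ Suc m"
  proof (induction m)
    case (Suc m)
    have "0 \<le> \<delta> ^ Suc m - \<delta>' ^ Suc m" using assms by (simp add: power_mono del: power_Suc)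
    have "real (Suc (Suc m)) * \<delta>' ^ Suc m * (\<delta> - \<delta>') =
        \<delta>' * (real (Suc m) * \<delta>' ^ m * (\<delta> - \<delta>')) + \<delta>' ^ Suc m * (\<delta> - \<delta>')"
      by (simp add: algebra_simps)
    also have "\<dots> \<le> \<delta>' * (\<delta> ^ Suc m - \<delta>' ^ Suc m) + \<delta>' ^ Suc m * (\<delta> - \<delta>')"
      using Suc assms by (intro add_mono mult_left_mono) auto
    also have "\<dots> \<le> \<delta> * (\<delta> ^ Suc m - \<delta>' ^ Suc m) + \<delta>' ^ Suc m * (\<delta> - \<delta>')"
      using assms \<open>0 \<le> \<delta> ^ Suc m - \<delta>' ^ Suc m\<close> by (intro add_mono mult_right_mono) auto
    also have "\<dots> = \<delta> ^ Suc (Suc m) - \<delta>' ^ Suc (Suc m)" by (simp add: algebra_simps)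
    finally show ?case .
  qed simp
  also have "\<dots> \<le> \<delta> ^ Suc m" using assms by simp
  finally show ?thesis using assms by (simp add: field_simps)
qed

lemma mdeg_inc: "mdeg (\<beta>(i := Suc (\<beta> i))) = Suc (mdeg \<beta>)"
  unfolding mdeg_def by (simp add: sum.remove[of UNIV i] sum.remove[of UNIV i "\<beta>"])

lemma inj_inc: "inj (\<lambda>\<beta>. \<beta>(i := Suc (\<beta> i)))"
proof (rule injI)
  fix \<beta> \<gamma> :: "'a \<Rightarrow> nat" assume *: "\<beta>(i := Suc (\<beta> i)) = \<gamma>(i := Suc (\<gamma> i))"
  show "\<beta> = \<gamma>"
  proof
    fix j show "\<beta> j = \<gamma> j" using fun_cong[OF *, of j] by (cases "j = i") auto
  qed
qed

text \<open>A Cauchy estimate for coefficient norms: incrementing the \<open>i\<close>-th exponent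
  is injective, so the derivative involves distinct coefficients of \<open>c\<close>, and
  \<open>power_deriv_le\<close> bounds the weight of each one separately.\<close>

lemma ps_deriv_bound:
  assumes "ps_conv c \<delta>" "0 \<le> \<delta>'" "\<delta>' < \<delta>"
  shows "ps_conv (ps_deriv i c) \<delta>'" "ps_norm (ps_deriv i c) \<delta>' \<le> ps_norm c \<delta> / (\<delta> - \<delta>')"
proof -
  let ?inc = "\<lambda>\<beta>. \<beta>(i := Suc (\<beta> i))"
  let ?g = "\<lambda>\<alpha>. norm (c \<alpha>) * \<delta> ^ mdeg \<alpha> / (\<delta> - \<delta>')"
  have gs: "?g summable_on UNIV"
    using assms(1) unfolding ps_conv_def divide_inverse by (rule summable_on_cmult_left)
  then have gs': "?g summable_on range ?inc" by (rule summable_on_subset_banach) simp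
  then have s: "(?g \<circ> ?inc) summable_on UNIV" unfolding summable_on_reindex[OF inj_inc] .
  have le: "norm (ps_deriv i c \<beta>) * \<delta>' ^ mdeg \<beta> \<le> (?g \<circ> ?inc) \<beta>" for \<beta>
  proof -
    have "real (Suc (\<beta> i)) * \<delta>' ^ mdeg \<beta> \<le> real (Suc (mdeg \<beta>)) * \<delta>' ^ mdeg \<beta>"
      using member_le_sum[of i UNIV \<beta>] assms(2) by (intro mult_right_mono) (auto simp: mdeg_def simp del: of_nat_sum)
    also have "\<dots> \<le> \<delta> ^ Suc (mdeg \<beta>) / (\<delta> - \<delta>')" by (rule power_deriv_le[OF assms(2,3)])
    finally have "norm (c (?inc \<beta>)) * (real (Suc (\<beta> i)) * \<delta>' ^ mdeg \<beta>) \<le>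
        norm (c (?inc \<beta>)) * (\<delta> ^ Suc (mdeg \<beta>) / (\<delta> - \<delta>'))"
      by (rule mult_left_mono) simp
    then show ?thesis by (simp add: ps_deriv_def mdeg_inc mult_ac del: of_nat_Suc power_Suc)
  qed
  show *: "ps_conv (ps_deriv i c) \<delta>'"
    unfolding ps_conv_def by (rule summable_on_comparison_test[OF s]) (use le assms in auto)
  have "ps_norm (ps_deriv i c) \<delta>' \<le> infsum (?g \<circ> ?inc) UNIV"
    unfolding ps_norm_def using * s le unfolding ps_conv_def by (intro infsum_mono) auto
  also have "\<dots> = infsum ?g (range ?inc)" by (rule infsum_reindex[OF inj_inc, symmetric])
  also have "\<dots> \<le> infsum ?g UNIV"
    using gs gs' assms by (intro infsum_mono_neutral) auto
  also have "\<dots> = ps_norm c \<delta> / (\<delta> - \<delta>')"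
    unfolding ps_norm_def divide_inverse by (rule infsum_cmult_left')
  finally show "ps_norm (ps_deriv i c) \<delta>' \<le> ps_norm c \<delta> / (\<delta> - \<delta>')" .
qed

lemma abs_mpow_le:
  assumes "\<And>i. \<bar>y $ i\<bar> \<le> \<delta>"
  shows "\<bar>mpow y \<alpha>\<bar> \<le> \<delta> ^ mdeg \<alpha>"
proof -
  have "\<bar>mpow y \<alpha>\<bar> \<le> (\<Prod>i\<in>UNIV. \<delta> ^ \<alpha> i)"
    unfolding mpow_def abs_prod power_abs using assms by (intro prod_mono) (auto intro: power_mono)
  then show ?thesis by (simp add: mdeg_def power_sum)
qed

lemma ps_eval_has_sum:
  fixes c :: "('n::finite \<Rightarrow> nat) \<Rightarrow> 'a::banach"
  assumes "ps_conv c \<delta>" "\<And>i. \<bar>y $ i\<bar> \<le> \<delta>"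
  shows "((\<lambda>\<alpha>. mpow y \<alpha> *\<^sub>R c \<alpha>) has_sum ps_eval c y) UNIV" "norm (ps_eval c y) \<le> ps_norm c \<delta>"
proof -
  have le: "norm (mpow y \<alpha> *\<^sub>R c \<alpha>) \<le> norm (c \<alpha>) * \<delta> ^ mdeg \<alpha>" for \<alpha>
    using mult_right_mono[OF abs_mpow_le[OF assms(2)], of "norm (c \<alpha>)"] by (simp add: mult_ac)
  have a: "(\<lambda>\<alpha>. norm (mpow y \<alpha> *\<^sub>R c \<alpha>)) summable_on UNIV"
    by (rule summable_on_comparison_test[OF assms(1)[unfolded ps_conv_def] le]) simp
  show "((\<lambda>\<alpha>. mpow y \<alpha> *\<^sub>R c \<alpha>) has_sum ps_eval c y) UNIV"
    unfolding ps_eval_def by (rule has_sum_infsum[OF abs_summable_summable[OF a]])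
  have "norm (ps_eval c y) \<le> (\<Sum>\<^sub>\<infinity>\<alpha>. norm (mpow y \<alpha> *\<^sub>R c \<alpha>))"
    unfolding ps_eval_def by (rule norm_infsum_bound[OF a])
  also have "\<dots> \<le> ps_norm c \<delta>"
    unfolding ps_norm_def using assms(1) a le unfolding ps_conv_def by (intro infsum_mono) auto
  finally show "norm (ps_eval c y) \<le> ps_norm c \<delta>" .
qed

lemma ps_eval_has_derivative:
  fixes c :: "('n::finite \<Rightarrow> nat) \<Rightarrow> 'a::banach"
  assumes conv: "ps_conv c \<delta>" and y: "\<And>i. \<bar>y $ i\<bar> < \<delta>"
  shows "(ps_eval c has_derivative (\<lambda>h. \<Sum>i\<in>UNIV. h $ i *\<^sub>R ps_eval (ps_deriv i c) y)) (at y)"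
proof -
  \<comment> \<open>Derivatives of monomials are estimated on the cube of half-width
    \<open>\<delta>'\<close> against convergence at \<open>\<delta>\<close>, which needs a gap
    between the two.\<close>
  obtain \<delta>' where \<delta>': "0 < \<delta>'" "\<delta>' < \<delta>" "\<And>i. \<bar>y $ i\<bar> < \<delta>'"
  proof -
    define m where "m = Max (insert 0 (range (\<lambda>i. \<bar>y $ i\<bar>)))"
    have m: "0 \<le> m" "\<bar>y $ i\<bar> \<le> m" for i
      unfolding m_def by (rule Max_ge; simp)+
    have "0 < \<delta>" using y[of undefined] abs_ge_zero[of "y $ undefined"] by linarith
    then have "m < \<delta>" unfolding m_def using y by (subst Max_less_iff) auto
    then have "\<bar>y $ i\<bar> < (m + \<delta>) / 2" for i using m(2)[of i] by simp
    then show ?thesis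
      using m(1) \<open>m < \<delta>\<close> by (intro that[of "(m + \<delta>) / 2"]) auto
  qed
  \<comment> \<open>Multi-indices are enumerated, since the termwise differentiation above is for
    sequences; absolute convergence makes the order irrelevant.\<close>
  obtain e :: "nat \<Rightarrow> ('n \<Rightarrow> nat)" where e: "bij_betw e UNIV UNIV"
  proof -
    have "inj (\<lambda>m::nat. (\<lambda>_::'n. m))" by (auto simp: inj_on_def fun_eq_iff)
    then have "infinite (UNIV :: ('n \<Rightarrow> nat) set)"
      using finite_subset[OF subset_UNIV] finite_imageD by blast
    then show ?thesis using bij_betw_from_nat_into[OF countableI_type] that by blast
  qed
  let ?f = "\<lambda>n z. mpow z (e n) *\<^sub>R c (e n)"
  \<comment> \<open>This is the \<open>i\<close>-th partial derivative of the monomial; for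
    \<open>\<alpha> i = 0\<close> the truncated subtraction is harmless because of the factor
    \<open>real (\<alpha> i)\<close>.\<close>
  let ?m = "\<lambda>i \<alpha> z. real (\<alpha> i) * mpow z (\<alpha>(i := \<alpha> i - 1))"
  let ?d = "\<lambda>n z h. (\<Sum>i\<in>UNIV. h $ i * ?m i (e n) z) *\<^sub>R c (e n)"
  let ?S = "{z :: real^'n. \<forall>i. \<bar>z $ i\<bar> < \<delta>'}"
  define b where "b n = real CARD('n) * (norm (c (e n)) * \<delta> ^ mdeg (e n)) / (\<delta> - \<delta>')" for n
  have S: "?S = box (\<chi> i. - \<delta>') (\<chi> i. \<delta>')"
    by (auto simp: mem_box_cart abs_less_iff) (metis minus_less_iff)+
  have yS: "y \<in> ?S" using \<delta>' by simp
  have sums: "(\<lambda>n. ?f n z) sums ps_eval c z" if "z \<in> ?S" for z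
  proof (rule has_sum_imp_sums)
    have "\<bar>z $ i\<bar> \<le> \<delta>" for i
    proof -
      have "\<bar>z $ i\<bar> < \<delta>'" using that by simp
      then show ?thesis using \<delta>'(2) by linarith
    qed
    then show "((\<lambda>n. ?f n z) has_sum ps_eval c z) UNIV"
      unfolding has_sum_reindex_bij_betw[OF e, of "\<lambda>\<alpha>. mpow z \<alpha> *\<^sub>R c \<alpha>"]
      by (rule ps_eval_has_sum(1)[OF conv])
  qed
  have sb: "summable b"
  proof -
    have "(\<lambda>\<alpha>. norm (c \<alpha>) * \<delta> ^ mdeg \<alpha>) summable_on UNIV"
      using conv unfolding ps_conv_def by simp
    then have "(\<lambda>n. norm (c (e n)) * \<delta> ^ mdeg (e n)) summable_on UNIV"
      using summable_on_reindex_bij_betw[OF e, of "\<lambda>\<alpha>. norm (c \<alpha>) * \<delta> ^ mdeg \<alpha>"] by simp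
    then show ?thesis unfolding b_def
      by (intro summable_divide summable_mult summable_on_imp_summable)
  qed
  have mb: "\<bar>?m i \<alpha> z\<bar> \<le> \<delta> ^ mdeg \<alpha> / (\<delta> - \<delta>')" if "z \<in> ?S" for i \<alpha> z
  proof (cases "\<alpha> i")
    case 0
    then show ?thesis using \<delta>' by simp
  next
    case (Suc k)
    define \<beta> where "\<beta> = \<alpha>(i := k)"
    have \<alpha>: "\<alpha> = \<beta>(i := Suc (\<beta> i))" "\<beta> i = k" using Suc by (auto simp: \<beta>_def)
    have "\<bar>mpow z \<beta>\<bar> \<le> \<delta>' ^ mdeg \<beta>" using that by (intro abs_mpow_le) (auto intro: less_imp_le)
    moreover have "k \<le> mdeg \<beta>" using member_le_sum[of i UNIV \<beta>] \<alpha> by (auto simp: mdeg_def)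
    ultimately have "real (Suc k) * \<bar>mpow z \<beta>\<bar> \<le> real (Suc (mdeg \<beta>)) * \<delta>' ^ mdeg \<beta>"
      by (intro mult_mono) auto
    also have "\<dots> \<le> \<delta> ^ Suc (mdeg \<beta>) / (\<delta> - \<delta>')" using \<delta>' by (intro power_deriv_le) auto
    also have "\<dots> = \<delta> ^ mdeg \<alpha> / (\<delta> - \<delta>')" by (simp add: \<alpha>(1) mdeg_inc)
    finally show ?thesis by (simp add: Suc \<beta>_def abs_mult)
  qed
  have der: "(?f n has_derivative ?d n z) (at z)" for n z
  proof -
    have "((\<lambda>z. mpow z (e n)) has_derivative
        (\<lambda>h. \<Sum>i\<in>UNIV. (real (e n i) * h $ i * (z $ i) ^ (e n i - 1)) * (\<Prod>j\<in>UNIV - {i}. (z $ j) ^ e n j))) (at z)"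
      unfolding mpow_def
      by (intro has_derivative_prod has_derivative_eq_rhs[OF has_derivative_power[OF
            bounded_linear_imp_has_derivative[OF bounded_linear_vec_nth]]]) (simp add: fun_eq_iff mult_ac)
    moreover have "(z $ i) ^ (e n i - 1) * (\<Prod>j\<in>UNIV - {i}. (z $ j) ^ e n j) = mpow z ((e n)(i := e n i - 1))" for i
      unfolding mpow_def by (subst prod.remove[of UNIV i]) (auto intro!: prod.cong)
    ultimately have "((\<lambda>z. mpow z (e n)) has_derivative (\<lambda>h. \<Sum>i\<in>UNIV. h $ i * ?m i (e n) z)) (at z)"
      by (simp add: mult_ac)
    then show ?thesis by (auto intro!: derivative_eq_intros)
  qed
  have bound: "norm (?d n z h) \<le> b n * norm h" if "z \<in> ?S" for n z h
  proof -
    have "\<bar>\<Sum>i\<in>UNIV. h $ i * ?m i (e n) z\<bar> \<le> (\<Sum>i\<in>(UNIV::'n set). norm h * (\<delta> ^ mdeg (e n) / (\<delta> - \<delta>')))"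
      by (rule order_trans[OF sum_abs], rule sum_mono, subst abs_mult,
          intro mult_mono component_le_norm_cart mb[OF that]) auto
    then have "\<bar>\<Sum>i\<in>UNIV. h $ i * ?m i (e n) z\<bar> * norm (c (e n)) \<le>
        (\<Sum>i\<in>(UNIV::'n set). norm h * (\<delta> ^ mdeg (e n) / (\<delta> - \<delta>'))) * norm (c (e n))"
      by (rule mult_right_mono) simp
    then show ?thesis unfolding b_def by (simp add: mult_ac)
  qed
  have D: "((\<lambda>z. \<Sum>n. ?f n z) has_derivative (\<lambda>h. \<Sum>n. ?d n y h)) (at y)"
  proof (rule has_derivative_suminf_dominated[where S = ?S and b = b and f = ?f and f' = ?d])
    show "open ?S" "convex ?S" unfolding S by auto
  qed (use der bound sb sums yS in \<open>auto simp: sums_iff\<close>)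
  have "(ps_eval c has_derivative (\<lambda>h. \<Sum>n. ?d n y h)) (at y)"
    by (rule has_derivative_transform_within_open[OF D, where s = ?S])
      (use yS sums in \<open>auto simp: S sums_iff\<close>)
  moreover have "(\<Sum>n. ?d n y h) = (\<Sum>i\<in>UNIV. h $ i *\<^sub>R ps_eval (ps_deriv i c) y)" for h
  proof -
    have "(\<lambda>n. ?m i (e n) y *\<^sub>R c (e n)) sums ps_eval (ps_deriv i c) y" for i
    proof -
      let ?inc = "\<lambda>\<beta>. \<beta>(i := Suc (\<beta> i))"
      let ?g = "\<lambda>\<alpha>. ?m i \<alpha> y *\<^sub>R c \<alpha>"
      have "((\<lambda>\<alpha>. mpow y \<alpha> *\<^sub>R ps_deriv i c \<alpha>) has_sum ps_eval (ps_deriv i c) y) UNIV"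
        using ps_eval_has_sum(1)[OF ps_deriv_bound(1)[OF conv less_imp_le[OF \<delta>'(1)] \<delta>'(2)]] \<delta>'(3)
        by (simp add: less_imp_le)
      then have "((?g \<circ> ?inc) has_sum ps_eval (ps_deriv i c) y) UNIV"
        by (simp add: ps_deriv_def o_def mult.commute del: of_nat_Suc)
      then have "(?g has_sum ps_eval (ps_deriv i c) y) (range ?inc)"
        unfolding has_sum_reindex[OF inj_inc] .
      \<comment> \<open>The multi-indices missed by \<open>?inc\<close> are those with
        \<open>\<alpha> i = 0\<close>, and their terms vanish.\<close>
      moreover have "?g \<alpha> = 0" if "\<alpha> \<notin> range ?inc" for \<alpha>
      proof (cases "\<alpha> i")
        case (Suc k)
        have "\<alpha> = ?inc (\<alpha>(i := k))" using Suc by auto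
        then show ?thesis using that by blast
      qed simp
      ultimately have "(?g has_sum ps_eval (ps_deriv i c) y) UNIV"
        by (subst has_sum_cong_neutral[where T = "range ?inc" and g = ?g]) auto
      then show ?thesis
        unfolding has_sum_reindex_bij_betw[OF e, of ?g, symmetric] by (rule has_sum_imp_sums)
    qed
    then have "(\<lambda>n. \<Sum>i\<in>UNIV. h $ i *\<^sub>R ?m i (e n) y *\<^sub>R c (e n)) sums (\<Sum>i\<in>UNIV. h $ i *\<^sub>R ps_eval (ps_deriv i c) y)"
      by (intro sums_sum sums_scaleR_right)
    then show ?thesis by (simp add: sums_iff scaleR_sum_left)
  qed
  ultimately show ?thesis by simp
qed

section \<open>Analytic functions and iterated Laplacians\<close>

definition ps_lap :: "(('n::finite \<Rightarrow> nat) \<Rightarrow> 'a::real_vector) \<Rightarrow> ('n \<Rightarrow> nat) \<Rightarrow> 'a" where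
  "ps_lap c \<alpha> = (\<Sum>i\<in>UNIV. ps_deriv i (ps_deriv i c) \<alpha>)"

lemma ps_lap_bound:
  fixes c :: "('n::finite \<Rightarrow> nat) \<Rightarrow> 'a::real_normed_vector"
  assumes c: "ps_conv c (\<delta> + 2 * s)" and \<delta>: "0 \<le> \<delta>" and s: "0 < s"
  shows "ps_conv (ps_lap c) \<delta>" "ps_norm (ps_lap c) \<delta> \<le> real CARD('n) / s\<^sup>2 * ps_norm c (\<delta> + 2 * s)"
proof -
  have 1: "ps_conv (ps_deriv i c) (\<delta> + s)" "ps_norm (ps_deriv i c) (\<delta> + s) \<le> ps_norm c (\<delta> + 2 * s) / s" for i
    using ps_deriv_bound[OF c, of "\<delta> + s" i] \<delta> s by simp_all
  have 2: "ps_conv (ps_deriv i (ps_deriv i c)) \<delta>"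
     "ps_norm (ps_deriv i (ps_deriv i c)) \<delta> \<le> ps_norm (ps_deriv i c) (\<delta> + s) / s" for i
    using ps_deriv_bound[OF 1(1)[of i] \<delta>, of i] s by simp_all
  have 3: "ps_norm (ps_deriv i (ps_deriv i c)) \<delta> \<le> ps_norm c (\<delta> + 2 * s) / s\<^sup>2" for i
    using order_trans[OF 2(2)[of i] divide_right_mono[OF 1(2)[of i] less_imp_le[OF s]]]
    by (simp add: power2_eq_square)
  note S = ps_conv_sum[of UNIV "\<lambda>i. ps_deriv i (ps_deriv i c)", OF _ 2(1) \<delta>]
  show "ps_conv (ps_lap c) \<delta>" using S(1) unfolding ps_lap_def[abs_def] by simp
  have "ps_norm (ps_lap c) \<delta> \<le> (\<Sum>i\<in>UNIV. ps_norm (ps_deriv i (ps_deriv i c)) \<delta>)"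
    using S(2) unfolding ps_lap_def[abs_def] by simp
  also have "\<dots> \<le> (\<Sum>i\<in>(UNIV::'n set). ps_norm c (\<delta> + 2 * s) / s\<^sup>2)"
    by (rule sum_mono[OF 3])
  finally show "ps_norm (ps_lap c) \<delta> \<le> real CARD('n) / s\<^sup>2 * ps_norm c (\<delta> + 2 * s)" by simp
qed

lemma ps_lap_iterate:
  fixes c :: "('n::finite \<Rightarrow> nat) \<Rightarrow> 'a::real_normed_vector"
  assumes s: "0 < s"
  shows "0 \<le> \<delta> \<Longrightarrow> ps_conv c (\<delta> + 2 * real k * s) \<Longrightarrow> ps_conv ((ps_lap ^^ k) c) \<delta> \<and>
     ps_norm ((ps_lap ^^ k) c) \<delta> \<le> (real CARD('n) / s\<^sup>2) ^ k * ps_norm c (\<delta> + 2 * real k * s)"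
proof (induction k arbitrary: \<delta>)
  case (Suc k)
  have eq: "\<delta> + 2 * real (Suc k) * s = (\<delta> + 2 * s) + 2 * real k * s" by (simp add: algebra_simps)
  have IH: "ps_conv ((ps_lap ^^ k) c) (\<delta> + 2 * s)"
     "ps_norm ((ps_lap ^^ k) c) (\<delta> + 2 * s) \<le> (real CARD('n) / s\<^sup>2) ^ k * ps_norm c ((\<delta> + 2 * s) + 2 * real k * s)"
    using Suc.IH[of "\<delta> + 2 * s"] Suc.prems s unfolding eq by auto
  have "ps_norm ((ps_lap ^^ Suc k) c) \<delta> \<le> real CARD('n) / s\<^sup>2 * ps_norm ((ps_lap ^^ k) c) (\<delta> + 2 * s)"
    using ps_lap_bound(2)[OF IH(1) Suc.prems(1) s] by simp
  also have "\<dots> \<le> real CARD('n) / s\<^sup>2 * ((real CARD('n) / s\<^sup>2) ^ k * ps_norm c ((\<delta> + 2 * s) + 2 * real k * s))"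
    by (rule mult_left_mono[OF IH(2)]) simp
  finally show ?case
    using ps_lap_bound(1)[OF IH(1) Suc.prems(1) s] unfolding eq by (simp add: mult.assoc)
qed simp

text \<open>One term of the exponential series against its sum. At \<open>x = m\<close> it is the
  part of Stirling's formula that turns \<open>m ^ m\<close> into a factorial.\<close>

lemma power_le_exp_fact:
  fixes x :: real
  assumes "0 \<le> x"
  shows "x ^ m \<le> exp x * fact m"
proof -
  have "(\<Sum>n\<in>{m}. x ^ n /\<^sub>R fact n) \<le> exp x"
    using assms sums_unique[OF exp_converges[of x]] sums_summable[OF exp_converges[of x]]
    by (subst sums_unique[OF exp_converges[of x]], intro sum_le_suminf) auto
  then show ?thesis by (simp add: field_simps)
qed

lemma ps_lap_iterate_fact:
  fixes c :: "('n::finite \<Rightarrow> nat) \<Rightarrow> 'a::real_normed_vector"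
  assumes \<delta>: "0 \<le> \<delta>1" "\<delta>1 < \<delta>2" and c: "ps_conv c \<delta>2"
  shows "ps_norm ((ps_lap ^^ k) c) \<delta>1 \<le>
    (real CARD('n) * (exp 1)\<^sup>2 / (\<delta>2 - \<delta>1)\<^sup>2) ^ k * fact (2 * k) * ps_norm c \<delta>2"
proof (cases "k = 0")
  case True
  then show ?thesis using ps_conv_mono(2)[OF c, of \<delta>1] \<delta> by simp
next
  case False
  \<comment> \<open>With this \<open>s\<close> the loss is \<open>(2 * real k) ^ (2 * k)\<close>
    over the gap to the power \<open>2 * k\<close>; \<open>power_le_exp_fact\<close> trades the
    numerator for \<open>fact (2 * k)\<close> and the geometric factor
    \<open>((exp 1)\<^sup>2) ^ k\<close>.\<close>
  define s where "s = (\<delta>2 - \<delta>1) / (2 * real k)"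
  have s: "s > 0" "\<delta>1 + 2 * real k * s = \<delta>2" using False \<delta> by (auto simp: s_def)
  have "(1 / s\<^sup>2) ^ k = (2 * real k) ^ (2 * k) * (1 / (\<delta>2 - \<delta>1)\<^sup>2) ^ k"
    by (simp add: s_def power_divide power_mult)
  also have "\<dots> \<le> exp (2 * real k) * fact (2 * k) * (1 / (\<delta>2 - \<delta>1)\<^sup>2) ^ k"
    by (intro mult_right_mono power_le_exp_fact) auto
  also have "exp (2 * real k) = ((exp (1::real))\<^sup>2) ^ k"
    by (simp add: power_mult[symmetric] exp_of_nat_mult[symmetric])
  finally have 1: "(1 / s\<^sup>2) ^ k \<le> ((exp (1::real))\<^sup>2) ^ k * fact (2 * k) * (1 / (\<delta>2 - \<delta>1)\<^sup>2) ^ k" .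
  have "(real CARD('n) / s\<^sup>2) ^ k * ps_norm c \<delta>2 = real CARD('n) ^ k * (1 / s\<^sup>2) ^ k * ps_norm c \<delta>2"
    by (simp add: power_divide)
  also have "\<dots> \<le> real CARD('n) ^ k * (((exp (1::real))\<^sup>2) ^ k * fact (2 * k) * (1 / (\<delta>2 - \<delta>1)\<^sup>2) ^ k) * ps_norm c \<delta>2"
    using 1 \<delta> by (intro mult_right_mono mult_left_mono ps_norm_nonneg) auto
  also have "\<dots> = (real CARD('n) * (exp 1)\<^sup>2 / (\<delta>2 - \<delta>1)\<^sup>2) ^ k * fact (2 * k) * ps_norm c \<delta>2"
    by (simp add: power_divide power_mult_distrib)
  finally show ?thesis using ps_lap_iterate[OF s(1) \<delta>(1), of c k] c unfolding s(2) by linarith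
qed

section \<open>Local power series expansions on cubes\<close>

definition open_cube :: "real^'n \<Rightarrow> real \<Rightarrow> (real^'n) set" where
  "open_cube x0 \<delta> = {y. \<forall>i. \<bar>y $ i - x0 $ i\<bar> < \<delta>}"

lemma open_open_cube: "open (open_cube x0 \<delta>)"
proof -
  have "open_cube x0 \<delta> = box (x0 - (\<chi> i. \<delta>)) (x0 + (\<chi> i. \<delta>))"
    unfolding open_cube_def by (auto simp: mem_box_cart abs_less_iff algebra_simps)
  then show ?thesis using open_box by metis
qed

lemma ball_subset_open_cube: "ball x0 \<delta> \<subseteq> open_cube x0 \<delta>"
proof
  fix y assume "y \<in> ball x0 \<delta>"
  then have "norm (y - x0) < \<delta>" by (simp add: dist_norm norm_minus_commute)
  then show "y \<in> open_cube x0 \<delta>"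
    unfolding open_cube_def using component_le_norm_cart[of "y - x0"] by (auto intro: le_less_trans)
qed

lemma open_cube_subset_ball:
  fixes x0 :: "real^'n"
  assumes "real CARD('n) * \<delta> \<le> \<epsilon>"
  shows "open_cube x0 \<delta> \<subseteq> ball x0 \<epsilon>"
proof
  fix y assume y: "y \<in> open_cube x0 \<delta>"
  have "norm (y - x0) \<le> (\<Sum>i\<in>UNIV. \<bar>(y - x0) $ i\<bar>)" by (rule norm_le_l1_cart)
  also have "\<dots> < (\<Sum>i\<in>(UNIV::'n set). \<delta>)"
    using y unfolding open_cube_def by (intro sum_strict_mono) auto
  finally show "y \<in> ball x0 \<epsilon>" using assms by (simp add: dist_norm norm_minus_commute)
qed

text \<open>Convergence is asked for every radius below \<open>\<delta>\<close> and not at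
  \<open>\<delta>\<close> itself: this form survives differentiation, so all iterated Laplacians
  keep the same cube.\<close>

definition ps_at :: "(real^'n \<Rightarrow> 'a::real_normed_vector) \<Rightarrow> real^'n \<Rightarrow> real \<Rightarrow> (('n::finite \<Rightarrow> nat) \<Rightarrow> 'a) \<Rightarrow> bool" where
  "ps_at u x0 \<delta> c \<longleftrightarrow> 0 < \<delta> \<and> (\<forall>\<delta>'. 0 \<le> \<delta>' \<and> \<delta>' < \<delta> \<longrightarrow> ps_conv c \<delta>') \<and>
     (\<forall>y\<in>open_cube x0 \<delta>. u y = ps_eval c (y - x0))"

text \<open>Finitely many coordinates leave a positive margin, which makes the convergence in
  \<open>ps_at\<close> available at every point of the open cube.\<close>

lemma open_cube_smaller:
  assumes "y \<in> open_cube x0 \<delta>" "0 < \<delta>"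
  obtains \<delta>' where "0 < \<delta>'" "\<delta>' < \<delta>" "y \<in> open_cube x0 \<delta>'"
proof -
  define m where "m = Max (insert 0 (range (\<lambda>i. \<bar>y $ i - x0 $ i\<bar>)))"
  have m: "0 \<le> m" "\<bar>y $ i - x0 $ i\<bar> \<le> m" for i
    unfolding m_def by (rule Max_ge; simp)+
  have md: "m < \<delta>" unfolding m_def using assms by (subst Max_less_iff) (auto simp: open_cube_def)
  then have "\<bar>y $ i - x0 $ i\<bar> < (m + \<delta>) / 2" for i using m(2)[of i] by simp
  then show thesis
    using m(1) md by (intro that[of "(m + \<delta>) / 2"]) (auto simp: open_cube_def)
qed

lemma ps_at_pd:
  fixes u :: "real^'n::finite \<Rightarrow> 'a::banach"
  assumes u: "ps_at u x0 \<delta> c"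
  shows "y \<in> open_cube x0 \<delta> \<Longrightarrow> u differentiable (at y)"
    "ps_at (pd u (axis i 1)) x0 \<delta> (ps_deriv i c)"
proof -
  have \<delta>: "0 < \<delta>" using u by (simp add: ps_at_def)
  have d: "(u has_derivative (\<lambda>h. \<Sum>i\<in>UNIV. h $ i *\<^sub>R ps_eval (ps_deriv i c) (y - x0))) (at y)"
    if y: "y \<in> open_cube x0 \<delta>" for y
  proof -
    obtain \<delta>' where \<delta>': "0 < \<delta>'" "\<delta>' < \<delta>" "y \<in> open_cube x0 \<delta>'"
      using open_cube_smaller[OF y \<delta>] .
    have c: "ps_conv c \<delta>'" using u \<delta>' by (simp add: ps_at_def)
    have "(ps_eval c has_derivative (\<lambda>h. \<Sum>i\<in>UNIV. h $ i *\<^sub>R ps_eval (ps_deriv i c) (y - x0))) (at (y - x0))"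
      using \<delta>'(3) by (intro ps_eval_has_derivative[OF c]) (simp add: open_cube_def)
    then have "((\<lambda>y. ps_eval c (y - x0)) has_derivative (\<lambda>h. \<Sum>i\<in>UNIV. h $ i *\<^sub>R ps_eval (ps_deriv i c) (y - x0))) (at y)"
      by (rule has_derivative_compose[of "\<lambda>y. y - x0" "\<lambda>h. h" y UNIV "ps_eval c", rotated])
        (auto intro!: derivative_eq_intros)
    then show ?thesis
      by (rule has_derivative_transform_within_open[OF _ open_open_cube y]) (use u in \<open>simp add: ps_at_def\<close>)
  qed
  show "y \<in> open_cube x0 \<delta> \<Longrightarrow> u differentiable (at y)"
    using d differentiable_def by blast
  have "pd u (axis i 1) y = ps_eval (ps_deriv i c) (y - x0)" if "y \<in> open_cube x0 \<delta>" for y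
  proof -
    have "pd u (axis i 1) y = (\<Sum>j\<in>UNIV. axis i (1::real) $ j *\<^sub>R ps_eval (ps_deriv j c) (y - x0))"
      by (rule pd_eqI[OF d[OF that]])
    also have "\<dots> = (\<Sum>j\<in>UNIV. if j = i then ps_eval (ps_deriv j c) (y - x0) else 0)"
      by (rule sum.cong) (auto simp: axis_def)
    finally show ?thesis by simp
  qed
  moreover have "ps_conv (ps_deriv i c) \<delta>'" if "0 \<le> \<delta>'" "\<delta>' < \<delta>" for \<delta>'
    using u that by (intro ps_deriv_bound(1)[of c "(\<delta>' + \<delta>) / 2"]) (auto simp: ps_at_def)
  ultimately show "ps_at (pd u (axis i 1)) x0 \<delta> (ps_deriv i c)"
    using \<delta> by (simp add: ps_at_def)
qed

lemma sum_Basis_cart: "(\<Sum>b\<in>(Basis :: (real^'n) set). g b) = (\<Sum>i\<in>UNIV. g (axis i 1))"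
proof -
  have B: "(Basis :: (real^'n) set) = range (\<lambda>i. axis i 1)" by (auto simp: Basis_vec_def)
  have "inj (\<lambda>i::'n. axis i (1::real))" by (auto simp: inj_on_def axis_eq_axis)
  from sum.reindex[OF this, of g] show ?thesis unfolding B o_def .
qed

lemma ps_at_sum:
  fixes u :: "'i \<Rightarrow> real^'n::finite \<Rightarrow> 'a::banach"
  assumes "finite I" "I \<noteq> {}" "\<And>i. i \<in> I \<Longrightarrow> ps_at (u i) x0 \<delta> (c i)"
  shows "ps_at (\<lambda>y. \<Sum>i\<in>I. u i y) x0 \<delta> (\<lambda>\<alpha>. \<Sum>i\<in>I. c i \<alpha>)"
proof -
  have \<delta>: "0 < \<delta>" using assms by (auto simp: ps_at_def)
  have conv: "ps_conv (c i) \<delta>'" if "i \<in> I" "0 \<le> \<delta>'" "\<delta>' < \<delta>" for i \<delta>'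
    using assms(3) that by (auto simp: ps_at_def)
  have "(\<Sum>i\<in>I. u i y) = ps_eval (\<lambda>\<alpha>. \<Sum>i\<in>I. c i \<alpha>) (y - x0)" if y: "y \<in> open_cube x0 \<delta>" for y
  proof -
    obtain \<delta>' where \<delta>': "0 < \<delta>'" "\<delta>' < \<delta>" "y \<in> open_cube x0 \<delta>'"
      using open_cube_smaller[OF y \<delta>] .
    have "((\<lambda>\<alpha>. mpow (y - x0) \<alpha> *\<^sub>R c i \<alpha>) has_sum u i y) UNIV" if "i \<in> I" for i
      using ps_eval_has_sum(1)[OF conv[OF that less_imp_le[OF \<delta>'(1)] \<delta>'(2)], of "y - x0"] \<delta>'(3) assms(3)[OF that] y
      by (simp add: ps_at_def open_cube_def less_imp_le)
    then have "((\<lambda>\<alpha>. \<Sum>i\<in>I. mpow (y - x0) \<alpha> *\<^sub>R c i \<alpha>) has_sum (\<Sum>i\<in>I. u i y)) UNIV"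
      by (rule has_sum_finite_sum[OF assms(1)])
    then show ?thesis unfolding ps_eval_def by (simp add: scaleR_sum_right infsumI)
  qed
  then show ?thesis
    using \<delta> ps_conv_sum(1)[OF assms(1) conv] by (simp add: ps_at_def)
qed

lemma ps_at_linear:
  fixes u :: "real^'n::finite \<Rightarrow> 'a::banach" and h :: "'a \<Rightarrow> 'b::banach"
  assumes "ps_at u x0 \<delta> c" "bounded_linear h"
  shows "ps_at (\<lambda>y. h (u y)) x0 \<delta> (\<lambda>\<alpha>. h (c \<alpha>))"
proof -
  have \<delta>: "0 < \<delta>" using assms by (auto simp: ps_at_def)
  interpret h: bounded_linear h by fact
  obtain K where K: "K > 0" "\<And>a. norm (h a) \<le> norm a * K" using h.pos_bounded by blast
  have conv: "ps_conv (\<lambda>\<alpha>. h (c \<alpha>)) \<delta>'" if "0 \<le> \<delta>'" "\<delta>' < \<delta>" for \<delta>'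
    unfolding ps_conv_def
  proof (rule summable_on_comparison_test)
    show "(\<lambda>\<alpha>. K * (norm (c \<alpha>) * \<delta>' ^ mdeg \<alpha>)) summable_on UNIV"
      using assms(1) that unfolding ps_at_def ps_conv_def by (intro summable_on_cmult_right) auto
    show "norm (h (c \<alpha>)) * \<delta>' ^ mdeg \<alpha> \<le> K * (norm (c \<alpha>) * \<delta>' ^ mdeg \<alpha>)" for \<alpha>
      using mult_right_mono[OF K(2), of "\<delta>' ^ mdeg \<alpha>" "c \<alpha>"] that by (simp add: mult_ac)
  qed (use that in auto)
  have "h (u y) = ps_eval (\<lambda>\<alpha>. h (c \<alpha>)) (y - x0)" if y: "y \<in> open_cube x0 \<delta>" for y
  proof -
    obtain \<delta>' where \<delta>': "0 < \<delta>'" "\<delta>' < \<delta>" "y \<in> open_cube x0 \<delta>'"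
      using open_cube_smaller[OF y \<delta>] .
    have "((\<lambda>\<alpha>. mpow (y - x0) \<alpha> *\<^sub>R c \<alpha>) has_sum u y) UNIV"
      using ps_eval_has_sum(1)[of c \<delta>' "y - x0"] \<delta>' assms(1) y
      by (simp add: ps_at_def open_cube_def less_imp_le)
    from has_sum_bounded_linear[OF assms(2) this] show ?thesis
      unfolding ps_eval_def by (simp add: h.scaleR infsumI)
  qed
  then show ?thesis using \<delta> conv by (simp add: ps_at_def)
qed

lemma ps_at_laplacian:
  fixes u :: "real^'n::finite \<Rightarrow> 'a::banach"
  assumes "ps_at u x0 \<delta> c"
  shows "ps_at (laplacian u) x0 \<delta> (ps_lap c)"
  unfolding laplacian_def[abs_def] sum_Basis_cart ps_lap_def[abs_def]
  by (intro ps_at_sum ps_at_pd(2) assms) auto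

lemma ps_at_laplacian_iterate:
  fixes u :: "real^'n::finite \<Rightarrow> 'a::banach"
  assumes "ps_at u x0 \<delta> c"
  shows "ps_at ((laplacian ^^ k) u) x0 \<delta> ((ps_lap ^^ k) c)"
  by (induction k) (use assms ps_at_laplacian in auto)

lemma ps_at_imp_real_analytic_at:
  fixes u :: "real^'n::finite \<Rightarrow> 'a::euclidean_space"
  assumes "ps_at u x0 \<delta> c"
  shows "real_analytic_at (\<lambda>y. u y \<bullet> b) x0"
proof -
  have p: "ps_at (\<lambda>y. u y \<bullet> b) x0 \<delta> (\<lambda>\<alpha>. c \<alpha> \<bullet> b)"
    by (rule ps_at_linear[OF assms bounded_linear_inner_left])
  have \<delta>: "0 < \<delta>" using p by (simp add: ps_at_def)
  have "((\<lambda>\<alpha>. (c \<alpha> \<bullet> b) * (\<Prod>i\<in>UNIV. (x $ i - x0 $ i) ^ \<alpha> i)) has_sum (u x \<bullet> b)) UNIV"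
    if "x \<in> ball x0 \<delta>" for x
  proof -
    have x: "x \<in> open_cube x0 \<delta>" using that ball_subset_open_cube by blast
    obtain \<delta>' where \<delta>': "0 < \<delta>'" "\<delta>' < \<delta>" "x \<in> open_cube x0 \<delta>'"
      using open_cube_smaller[OF x \<delta>] .
    have "((\<lambda>\<alpha>. mpow (x - x0) \<alpha> *\<^sub>R (c \<alpha> \<bullet> b)) has_sum (u x \<bullet> b)) UNIV"
      using ps_eval_has_sum(1)[of "\<lambda>\<alpha>. c \<alpha> \<bullet> b" \<delta>' "x - x0"] \<delta>' p x
      by (simp add: ps_at_def open_cube_def less_imp_le)
    then show ?thesis by (simp add: mpow_def mult.commute)
  qed
  then show ?thesis unfolding real_analytic_at_def using \<delta>
    by (intro exI[of _ \<delta>] conjI exI[of _ "\<lambda>\<alpha>. c \<alpha> \<bullet> b"]) simp_all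
qed

text \<open>An unordered sum of reals converges only absolutely, so evaluation at a corner of a cube
  gives \<open>ps_conv\<close>. All radii up to \<open>\<delta>0\<close> are allowed with the same
  \<open>c\<close>, so that finitely many components can later agree on one radius.\<close>

lemma real_analytic_at_imp_ps_at:
  fixes g :: "real^'n \<Rightarrow> real"
  assumes "real_analytic_at g x0"
  obtains \<delta>0 c where "0 < \<delta>0" "\<And>\<delta>. 0 < \<delta> \<Longrightarrow> \<delta> \<le> \<delta>0 \<Longrightarrow> ps_at g x0 \<delta> c"
proof -
  obtain \<epsilon> c where \<epsilon>: "\<epsilon> > 0" and c: "\<And>x. x \<in> ball x0 \<epsilon> \<Longrightarrow>
      ((\<lambda>\<alpha>. c \<alpha> * (\<Prod>i\<in>UNIV. (x $ i - x0 $ i) ^ \<alpha> i)) has_sum g x) UNIV"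
    using assms unfolding real_analytic_at_def by blast
  \<comment> \<open>The cube has to fit into the ball of radius \<open>\<epsilon>\<close>; since the
    norm is at most the sum of the absolute coordinates, dividing by the dimension is
    enough.\<close>
  define \<delta>0 where "\<delta>0 = \<epsilon> / real CARD('n)"
  have \<delta>0: "0 < \<delta>0" "real CARD('n) * \<delta>0 \<le> \<epsilon>" using \<epsilon> by (auto simp: \<delta>0_def)
  note sub = open_cube_subset_ball[OF \<delta>0(2), of x0]
  have conv: "ps_conv c \<delta>'" if \<delta>': "0 \<le> \<delta>'" "\<delta>' < \<delta>0" for \<delta>'
  proof -
    let ?x = "x0 + (\<chi> i. \<delta>')"
    have "?x \<in> open_cube x0 \<delta>0" using \<delta>' by (simp add: open_cube_def)
    then have "(\<lambda>\<alpha>. c \<alpha> * \<delta>' ^ mdeg \<alpha>) summable_on UNIV"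
      using has_sum_imp_summable[OF c[of ?x]] sub by (auto simp: mdeg_def power_sum)
    then have "(\<lambda>\<alpha>. norm (c \<alpha> * \<delta>' ^ mdeg \<alpha>)) summable_on UNIV"
      by (rule summable_on_iff_abs_summable_on_real[THEN iffD1])
    then show ?thesis using \<delta>' by (simp add: ps_conv_def abs_mult)
  qed
  have eq: "g y = ps_eval c (y - x0)" if "y \<in> open_cube x0 \<delta>0" for y
    using infsumI[OF c[of y]] that sub unfolding ps_eval_def mpow_def by (auto simp: mult.commute)
  have "ps_at g x0 \<delta> c" if "0 < \<delta>" "\<delta> \<le> \<delta>0" for \<delta>
    using conv eq that unfolding ps_at_def open_cube_def by (auto intro: less_le_trans)
  then show thesis using \<delta>0(1) that by blast
qed

lemma real_analytic_on_imp_ps_at: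
  fixes u :: "real^'n \<Rightarrow> 'a::euclidean_space"
  assumes "real_analytic_on S u" "open S" "x0 \<in> S"
  obtains \<delta> c where "ps_at u x0 \<delta> c" "open_cube x0 \<delta> \<subseteq> S"
proof -
  have "\<forall>b\<in>Basis. \<exists>\<delta> c. 0 < \<delta> \<and> (\<forall>\<delta>'. 0 < \<delta>' \<and> \<delta>' \<le> \<delta> \<longrightarrow> ps_at (\<lambda>y. u y \<bullet> b) x0 \<delta>' c)"
  proof
    fix b :: 'a assume "b \<in> Basis"
    then have "real_analytic_at (\<lambda>y. u y \<bullet> b) x0"
      using assms(1,3) unfolding real_analytic_on_def by simp
    from real_analytic_at_imp_ps_at[OF this]
    show "\<exists>\<delta> c. 0 < \<delta> \<and> (\<forall>\<delta>'. 0 < \<delta>' \<and> \<delta>' \<le> \<delta> \<longrightarrow> ps_at (\<lambda>y. u y \<bullet> b) x0 \<delta>' c)"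
      by metis
  qed
  then obtain d c where d: "\<And>b. b \<in> Basis \<Longrightarrow> 0 < d b"
    and p: "\<And>b \<delta>. b \<in> Basis \<Longrightarrow> 0 < \<delta> \<Longrightarrow> \<delta> \<le> d b \<Longrightarrow> ps_at (\<lambda>y. u y \<bullet> b) x0 \<delta> (c b)"
    by metis
  obtain \<epsilon> where \<epsilon>: "\<epsilon> > 0" "ball x0 \<epsilon> \<subseteq> S" using assms(2,3) open_contains_ball by blast
  \<comment> \<open>Analyticity is given component by component; the least radius serves all of
    them, and the extra entry keeps the cube inside \<open>S\<close>.\<close>
  define \<delta> where "\<delta> = Min (insert (\<epsilon> / real CARD('n)) (d ` Basis))"
  have "0 < \<delta>" unfolding \<delta>_def using \<epsilon> d by (subst Min_gr_iff) auto
  have \<delta>: "\<delta> \<le> \<epsilon> / real CARD('n)" "\<And>b. b \<in> Basis \<Longrightarrow> \<delta> \<le> d b"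
    unfolding \<delta>_def by (rule Min_le; simp)+
  have "ps_at (\<lambda>y. (u y \<bullet> b) *\<^sub>R b) x0 \<delta> (\<lambda>\<alpha>. c b \<alpha> *\<^sub>R b)" if "b \<in> Basis" for b
    by (rule ps_at_linear[OF p[OF that \<open>0 < \<delta>\<close> \<delta>(2)[OF that]] bounded_linear_scaleR_left])
  then have "ps_at (\<lambda>y. \<Sum>b\<in>Basis. (u y \<bullet> b) *\<^sub>R b) x0 \<delta> (\<lambda>\<alpha>. \<Sum>b\<in>Basis. c b \<alpha> *\<^sub>R b)"
    by (intro ps_at_sum) auto
  then have "ps_at u x0 \<delta> (\<lambda>\<alpha>. \<Sum>b\<in>Basis. c b \<alpha> *\<^sub>R b)" by (simp add: euclidean_representation)
  moreover have "open_cube x0 \<delta> \<subseteq> S"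
    using open_cube_subset_ball[of \<delta> \<epsilon> x0] \<delta>(1) \<epsilon>(2) by (auto simp: field_simps)
  ultimately show thesis by (rule that)
qed

lemma real_analytic_on_laplacian_iterate:
  fixes u :: "real^'n \<Rightarrow> 'a::euclidean_space"
  assumes "real_analytic_on S u" "open S"
  shows "real_analytic_on S ((laplacian ^^ k) u)"
  unfolding real_analytic_on_def
proof (intro ballI)
  fix b x assume "x \<in> S"
  then obtain \<delta> c where "ps_at u x \<delta> c" using real_analytic_on_imp_ps_at[OF assms] by metis
  then show "real_analytic_at (\<lambda>y. (laplacian ^^ k) u y \<bullet> b) x"
    by (intro ps_at_imp_real_analytic_at[OF ps_at_laplacian_iterate])
qed

lemma real_analytic_on_linear:
  fixes u :: "real^'n \<Rightarrow> 'a::euclidean_space" and h :: "'a \<Rightarrow> 'b::euclidean_space"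
  assumes "real_analytic_on S u" "open S" "bounded_linear h"
  shows "real_analytic_on S (\<lambda>y. h (u y))"
  unfolding real_analytic_on_def
proof (intro ballI)
  fix b x assume "x \<in> S"
  then obtain \<delta> c where "ps_at u x \<delta> c" using real_analytic_on_imp_ps_at[OF assms(1,2)] by metis
  then show "real_analytic_at (\<lambda>y. h (u y) \<bullet> b) x"
    by (intro ps_at_imp_real_analytic_at[OF ps_at_linear] assms(3))
qed

lemma real_analytic_on_imp_has_laplacian:
  fixes u :: "real^'n \<Rightarrow> 'a::euclidean_space"
  assumes "real_analytic_on S u" "open S"
  shows "has_laplacian_on S u (laplacian u)"
  unfolding has_laplacian_on_def
proof (intro conjI ballI assms(2) refl)
  fix x assume x: "x \<in> S"
  obtain \<delta> c where p: "ps_at u x \<delta> c" using real_analytic_on_imp_ps_at[OF assms x] by metis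
  then have x': "x \<in> open_cube x \<delta>" by (simp add: open_cube_def ps_at_def)
  show "u differentiable (at x)" by (rule ps_at_pd(1)[OF p x'])
  fix b :: "real^'n" assume "b \<in> Basis"
  then obtain i where b: "b = axis i 1" by (auto simp: Basis_vec_def)
  show "pd u b differentiable (at x)" unfolding b by (rule ps_at_pd(1)[OF ps_at_pd(2)[OF p] x'])
qed

section \<open>Geometric bounds for analytic families\<close>

lemma ps_at_geom_bounded:
  fixes V :: "nat \<Rightarrow> real^'n::finite \<Rightarrow> 'a::banach"
  assumes V: "\<And>k. ps_at (V k) x0 \<delta> (d k)" and M: "0 \<le> M" "\<And>k. ps_norm (d k) r \<le> M * C ^ k"
    and r: "0 < r" "r < \<delta>"
  shows "geom_bounded (ball x0 r) C V"
proof (rule geom_boundedI[OF M(1)])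
  fix k y assume y: "y \<in> ball x0 r"
  have "\<bar>(y - x0) $ i\<bar> \<le> r" for i
    using component_le_norm_cart[of "y - x0" i] y by (simp add: dist_norm norm_minus_commute)
  then have "norm (ps_eval (d k) (y - x0)) \<le> ps_norm (d k) r"
    using V[of k] r by (intro ps_eval_has_sum(2)) (auto simp: ps_at_def)
  moreover have "V k y = ps_eval (d k) (y - x0)"
    using V[of k] subsetD[OF ball_subset_open_cube, of y x0 \<delta>] y r by (auto simp: ps_at_def)
  ultimately show "norm (V k y) \<le> M * C ^ k" using M(2)[of k] by simp
qed

lemma ps_at_geom_bounded_C1:
  fixes V :: "nat \<Rightarrow> real^'n::finite \<Rightarrow> 'a::banach"
  assumes V: "\<And>k. ps_at (V k) x0 \<delta> (d k)" and M: "0 \<le> M" "\<And>k. ps_norm (d k) r' \<le> M * C ^ k"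
    and r: "0 < r" "r < r'" "r' < \<delta>"
  shows "geom_bounded_C1 (ball x0 r) C V"
proof -
  have c: "ps_conv (d k) r'" for k using V[of k] r by (simp add: ps_at_def)
  have b: "geom_bounded (ball x0 r) C V"
    using r by (intro ps_at_geom_bounded[OF V M(1)] order_trans[OF ps_conv_mono(2)[OF c] M(2)]) auto
  have "geom_bounded (ball x0 r) C (\<lambda>k. pd (V k) b)" if "b \<in> Basis" for b
  proof -
    obtain i where i: "b = axis i 1" using \<open>b \<in> Basis\<close> by (auto simp: Basis_vec_def)
    have "ps_norm (ps_deriv i (d k)) r \<le> M / (r' - r) * C ^ k" for k
      using ps_deriv_bound(2)[OF c, of r i k] divide_right_mono[OF M(2)[of k], of "r' - r"] r by simp
    then show ?thesis unfolding i
      using M(1) r by (intro ps_at_geom_bounded[OF ps_at_pd(2)[OF V], of "M / (r' - r)"]) auto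
  qed
  moreover have "V k differentiable (at y)" if "y \<in> ball x0 r" for k y
    using ps_at_pd(1)[OF V] subsetD[OF ball_subset_open_cube, of y x0 \<delta>] that r by auto
  ultimately show ?thesis using b unfolding geom_bounded_C1_def by blast
qed

text \<open>Each derivative is paid for by a slightly smaller radius. The price does not depend on
  \<open>k\<close>, so it goes into \<open>M\<close> and leaves the ratio \<open>C\<close>
  unchanged; the midpoint \<open>s\<close> separates the two derivatives.\<close>

lemma ps_at_geom_bounded_C2:
  fixes V :: "nat \<Rightarrow> real^'n::finite \<Rightarrow> 'a::banach"
  assumes V: "\<And>k. ps_at (V k) x0 \<delta> (d k)" and M: "0 \<le> M" "\<And>k. ps_norm (d k) r' \<le> M * C ^ k"
    and r: "0 < r" "r < r'" "r' < \<delta>"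
  shows "geom_bounded_C2 (ball x0 r) C V"
proof -
  have c: "ps_conv (d k) r'" for k using V[of k] r by (simp add: ps_at_def)
  have "geom_bounded_C1 (ball x0 r) C (\<lambda>k. pd (V k) b)" if "b \<in> Basis" for b
  proof -
    define s where "s = (r + r') / 2"
    have s: "r < s" "s < r'" using r by (auto simp: s_def)
    obtain i where i: "b = axis i 1" using \<open>b \<in> Basis\<close> by (auto simp: Basis_vec_def)
    have "ps_norm (ps_deriv i (d k)) s \<le> M / (r' - s) * C ^ k" for k
      using ps_deriv_bound(2)[OF c, of s i k] divide_right_mono[OF M(2)[of k], of "r' - s"] r s by simp
    then show ?thesis unfolding i
      using M(1) r s by (intro ps_at_geom_bounded_C1[OF ps_at_pd(2)[OF V], where M = "M / (r' - s)" and r' = s]) auto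
  qed
  moreover have "geom_bounded_C1 (ball x0 r) C V" by (rule ps_at_geom_bounded_C1[OF V M r])
  ultimately show ?thesis unfolding geom_bounded_C2_def by blast
qed

text \<open>One \<open>C\<close> must serve all small \<open>r\<close>: the ball is later shrunk to
  be common to \<open>A0\<close> and \<open>A1\<close>, and then until its radius times
  \<open>C\<close> is small, and neither step may change \<open>C\<close>.\<close>

lemma laplacian_iterate_geom_bounded:
  fixes u :: "real^'n \<Rightarrow> 'a::euclidean_space"
  assumes "real_analytic_on S u" "open S" "x0 \<in> S"
  obtains r0 C where "r0 > 0" "C \<ge> 0" "ball x0 r0 \<subseteq> S"
    "\<forall>r. 0 < r \<and> r \<le> r0 \<longrightarrow> geom_bounded_C2 (ball x0 r) C (\<lambda>k y. (laplacian ^^ k) u y /\<^sub>R fact (2 * k))"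
proof -
  obtain \<delta> c where u: "ps_at u x0 \<delta> c" "open_cube x0 \<delta> \<subseteq> S"
    using real_analytic_on_imp_ps_at[OF assms] by metis
  have \<delta>: "0 < \<delta>" using u by (simp add: ps_at_def)
  \<comment> \<open>The iterates are bounded at \<open>\<delta> / 2\<close> using convergence at
    \<open>3 * \<delta> / 4\<close>, which lies strictly below \<open>\<delta>\<close>; balls of
    radius at most \<open>\<delta> / 4\<close> then leave room for two partial derivatives.\<close>
  define C where "C = real CARD('n) * (exp 1)\<^sup>2 / (3 * \<delta> / 4 - \<delta> / 2)\<^sup>2"
  define d where "d k = (\<lambda>\<alpha>. (ps_lap ^^ k) c \<alpha> /\<^sub>R fact (2 * k))" for k :: nat
  have p: "ps_at (\<lambda>y. (laplacian ^^ k) u y /\<^sub>R fact (2 * k)) x0 \<delta> (d k)" for k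
    unfolding d_def by (intro ps_at_linear[OF ps_at_laplacian_iterate[OF u(1)]] bounded_linear_scaleR_right)
  have M: "ps_norm (d k) (\<delta> / 2) \<le> ps_norm c (3 * \<delta> / 4) * C ^ k" for k
  proof -
    have "ps_norm (d k) (\<delta> / 2) = ps_norm ((ps_lap ^^ k) c) (\<delta> / 2) / fact (2 * k)"
    proof -
      have "ps_norm (d k) (\<delta> / 2) =
          (\<Sum>\<^sub>\<infinity>\<alpha>. inverse (fact (2 * k)) * (norm ((ps_lap ^^ k) c \<alpha>) * (\<delta> / 2) ^ mdeg \<alpha>))"
        unfolding ps_norm_def d_def by (simp add: mult.assoc)
      also have "\<dots> = inverse (fact (2 * k)) * ps_norm ((ps_lap ^^ k) c) (\<delta> / 2)"
        unfolding ps_norm_def by (rule infsum_cmult_right')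
      finally show ?thesis by (simp only: divide_inverse mult.commute)
    qed
    also have "\<dots> \<le> (C ^ k * fact (2 * k) * ps_norm c (3 * \<delta> / 4)) / fact (2 * k)"
      unfolding C_def using u(1) \<delta> by (intro divide_right_mono ps_lap_iterate_fact) (auto simp: ps_at_def)
    finally show ?thesis by (simp add: mult_ac)
  qed
  show thesis
  proof (rule that[of "\<delta> / 4" C])
    show "ball x0 (\<delta> / 4) \<subseteq> S"
      using u(2) ball_subset_open_cube[of x0 \<delta>] \<delta> by (auto simp: subset_iff)
    have "geom_bounded_C2 (ball x0 r) C (\<lambda>k y. (laplacian ^^ k) u y /\<^sub>R fact (2 * k))"
      if "0 < r" "r \<le> \<delta> / 4" for r
      by (rule ps_at_geom_bounded_C2[OF p _ M]) (use that \<delta> ps_norm_nonneg[of "3 * \<delta> / 4" c] in auto)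
    then show "\<forall>r. 0 < r \<and> r \<le> \<delta> / 4 \<longrightarrow>
        geom_bounded_C2 (ball x0 r) C (\<lambda>k y. (laplacian ^^ k) u y /\<^sub>R fact (2 * k))" by blast
  qed (use \<delta> in \<open>auto simp: C_def\<close>)
qed

section \<open>Series in powers of the radial variable\<close>

text \<open>The sign is that of an even power of \<open>qelem vq x\<close>, whose square is a
  nonpositive multiple of \<open>e\<close>. The even part uses \<open>h = id\<close> with
  \<open>i = 0\<close>, the odd part one map \<open>mul (vq j)\<close> for each coordinate, with
  \<open>i = 1\<close>.\<close>

definition alt_subseq :: "('a \<Rightarrow> 'b) \<Rightarrow> nat \<Rightarrow> (nat \<Rightarrow> 'c \<Rightarrow> 'a) \<Rightarrow> nat \<Rightarrow> 'c \<Rightarrow> 'b::real_vector" where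
  "alt_subseq h i A k y = (-1) ^ k *\<^sub>R h (A (2 * k + i) y)"

text \<open>Taking every second index squares the ratio, in step with the squared radius in
  \<open>radial_series\<close>: for nonnegative numbers
  \<open>C\<^sup>2 * \<rho>\<^sup>2 < 1\<close> amounts to \<open>C * \<rho> < 1\<close>.\<close>

lemma geom_bounded_alt_subseq:
  assumes "geom_bounded U C A" "0 \<le> C" "bounded_linear h"
  shows "geom_bounded U (C\<^sup>2) (alt_subseq h i A)"
proof -
  obtain M where M: "M \<ge> 0" "\<And>k y. y \<in> U \<Longrightarrow> norm (h (A k y)) \<le> M * C ^ k"
    using geom_bounded_linear[OF assms(1,3)] unfolding geom_bounded_def by blast
  show ?thesis
  proof (rule geom_boundedI)
    show "0 \<le> M * C ^ i" using M assms by simp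
    show "norm (alt_subseq h i A k y) \<le> M * C ^ i * C\<^sup>2 ^ k" if "y \<in> U" for k y
    proof -
      have "C ^ (2 * k + i) = C ^ i * C\<^sup>2 ^ k" by (simp add: power_add power_mult)
      then show ?thesis using M(2)[OF that, of "2 * k + i"] by (simp add: alt_subseq_def mult.assoc)
    qed
  qed
qed

lemma pd_alt_subseq:
  assumes "bounded_linear h" "A (2 * k + i) differentiable (at y)"
  shows "alt_subseq h i A k differentiable (at y)"
    "pd (alt_subseq h i A k) b y = alt_subseq h i (\<lambda>k. pd (A k) b) k y"
  unfolding alt_subseq_def[abs_def]
  using differentiable_linear[OF bounded_linear_scaleR_right differentiable_linear[OF assms]]
    pd_linear[OF bounded_linear_scaleR_right differentiable_linear[OF assms]] pd_linear[OF assms]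
  by simp_all

lemma geom_bounded_C1_alt_subseq:
  assumes "geom_bounded_C1 U C A" "0 \<le> C" "bounded_linear h"
  shows "geom_bounded_C1 U (C\<^sup>2) (alt_subseq h i A)"
  unfolding geom_bounded_C1_def
proof (intro conjI allI ballI)
  show "geom_bounded U (C\<^sup>2) (alt_subseq h i A)"
    using assms unfolding geom_bounded_C1_def by (intro geom_bounded_alt_subseq) auto
  show "alt_subseq h i A k differentiable (at y)" if "y \<in> U" for k y
    using assms that unfolding geom_bounded_C1_def by (intro pd_alt_subseq(1)) auto
  fix b :: 'a assume b: "b \<in> Basis"
  show "geom_bounded U (C\<^sup>2) (\<lambda>k. pd (alt_subseq h i A k) b)"
  proof (rule geom_bounded_cong)
    show "geom_bounded U (C\<^sup>2) (alt_subseq h i (\<lambda>k. pd (A k) b))"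
      using assms b unfolding geom_bounded_C1_def by (intro geom_bounded_alt_subseq) auto
    show "alt_subseq h i (\<lambda>k. pd (A k) b) k y = pd (alt_subseq h i A k) b y" if "y \<in> U" for k y
      using assms that unfolding geom_bounded_C1_def by (intro pd_alt_subseq(2)[symmetric]) auto
  qed
qed

lemma geom_bounded_C2_alt_subseq:
  assumes "geom_bounded_C2 U C A" "0 \<le> C" "bounded_linear h" "open U"
  shows "geom_bounded_C2 U (C\<^sup>2) (alt_subseq h i A)"
  unfolding geom_bounded_C2_def
proof (intro conjI ballI)
  show "geom_bounded_C1 U (C\<^sup>2) (alt_subseq h i A)"
    using assms unfolding geom_bounded_C2_def by (intro geom_bounded_C1_alt_subseq) auto
  fix b :: 'a assume b: "b \<in> Basis"
  show "geom_bounded_C1 U (C\<^sup>2) (\<lambda>k. pd (alt_subseq h i A k) b)"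
  proof (rule geom_bounded_C1_cong[OF assms(4)])
    show "geom_bounded_C1 U (C\<^sup>2) (alt_subseq h i (\<lambda>k. pd (A k) b))"
      using assms b unfolding geom_bounded_C2_def by (intro geom_bounded_C1_alt_subseq) auto
    show "alt_subseq h i (\<lambda>k. pd (A k) b) k y = pd (alt_subseq h i A k) b y" if "y \<in> U" for k y
      using assms that unfolding geom_bounded_C2_def geom_bounded_C1_def
      by (intro pd_alt_subseq(2)[symmetric]) auto
  qed
qed

lemma geom_bounded_C2_has_laplacian:
  assumes "geom_bounded_C2 U C A" "open U"
  shows "has_laplacian_on U (A k) (laplacian (A k))"
  using assms unfolding geom_bounded_C2_def geom_bounded_C1_def has_laplacian_on_def by blast

lemma laplacian_alt_subseq:
  assumes "geom_bounded_C2 U C A" "open U" "bounded_linear h" "y \<in> U"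
  shows "laplacian (alt_subseq h i A k) y = alt_subseq h i (\<lambda>k. laplacian (A k)) k y"
  using has_laplacian_on_linear[OF has_laplacian_on_linear[OF geom_bounded_C2_has_laplacian[OF assms(1,2)] assms(3)]
      bounded_linear_scaleR_right] assms(4)
  unfolding alt_subseq_def[abs_def] has_laplacian_on_def by blast

lemma sums_even_odd:
  fixes f :: "nat \<Rightarrow> 'a::real_normed_vector"
  assumes "(\<lambda>k. f (2 * k)) sums a" "(\<lambda>k. f (2 * k + 1)) sums b"
  shows "f sums (a + b)"
proof -
  have "(\<lambda>n. if even n then f n else 0) sums a"
    by (rule sums_mono_reindex[of "\<lambda>k. 2 * k", THEN iffD1])
      (use assms(1) in \<open>auto simp: strict_mono_def elim!: evenE\<close>)
  moreover have "(\<lambda>n. if odd n then f n else 0) sums b"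
    by (rule sums_mono_reindex[of "\<lambda>k. 2 * k + 1", THEN iffD1])
      (use assms(2) in \<open>auto simp: strict_mono_def elim!: oddE\<close>)
  ultimately have "(\<lambda>n. (if even n then f n else 0) + (if odd n then f n else 0)) sums (a + b)"
    by (rule sums_add)
  then show ?thesis by (rule sums_cong[THEN iffD1, rotated]) simp
qed

text \<open>The Laplacian in the \<open>q\<close> variables sends the power \<open>k + 2\<close> of
  the vector variable to \<open>- ck_weight q k\<close> times the power \<open>k\<close>. For odd
  \<open>k\<close> this is the even expression at \<open>k - 1\<close> with \<open>q + 2\<close> in
  place of \<open>q\<close>.\<close>

definition ck_weight :: "nat \<Rightarrow> nat \<Rightarrow> real" where
  "ck_weight q k = real (if even k then (k + 2) * (k + q) else (k + 1) * (k + 1 + q))"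

text \<open>The coefficients of the Laplacian of the series with coefficients \<open>A\<close>;
  their vanishing is the two-step recursion.\<close>

definition ck_defect :: "nat \<Rightarrow> (nat \<Rightarrow> 'n::euclidean_space \<Rightarrow> 'a) \<Rightarrow> nat \<Rightarrow> 'n \<Rightarrow> 'a::real_normed_vector" where
  "ck_defect q A k y = laplacian (A k) y - ck_weight q k *\<^sub>R A (k + 2) y"

lemma ck_weight_bounds:
  assumes "q \<ge> 1"
  shows "0 < ck_weight q k" "ck_weight q k \<le> real q * (real (Suc k) * real (Suc (Suc k)))"
proof -
  obtain p where q: "q = Suc p" using assms by (cases q) auto
  show "0 < ck_weight q k" by (simp add: ck_weight_def q)
  have "(if even k then (k + 2) * (k + q) else (k + 1) * (k + 1 + q)) \<le> q * (Suc k * Suc (Suc k))"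
    by (simp add: q algebra_simps)
  then show "ck_weight q k \<le> real q * (real (Suc k) * real (Suc (Suc k)))"
    unfolding ck_weight_def of_nat_mult[symmetric] of_nat_le_iff .
qed

text \<open>By \<open>ck_weight_bounds\<close> the weight is at most \<open>q\<close> times that of
  a double \<open>weighted_shift\<close>, whence the ratio \<open>4 * C\<close>.\<close>

lemma geom_bounded_ck_weight:
  assumes "geom_bounded U C A" "0 \<le> C" "q \<ge> 1"
  shows "geom_bounded U (4 * C) (\<lambda>k y. ck_weight q k *\<^sub>R A (k + 2) y)"
proof -
  have "geom_bounded U (2 * (2 * C)) (weighted_shift (weighted_shift A))"
    using assms(1,2) by (intro geom_bounded_shift) auto
  then obtain M where M: "M \<ge> 0" "\<And>k y. y \<in> U \<Longrightarrow> norm (weighted_shift (weighted_shift A) k y) \<le> M * (4 * C) ^ k"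
    unfolding geom_bounded_def by auto
  show ?thesis
  proof (rule geom_boundedI)
    show "0 \<le> real q * M" using M by simp
    fix k y assume y: "y \<in> U"
    have "norm (ck_weight q k *\<^sub>R A (k + 2) y) \<le> (real q * (real (Suc k) * real (Suc (Suc k)))) * norm (A (k + 2) y)"
      using mult_right_mono[OF ck_weight_bounds(2)[OF assms(3), of k] norm_ge_zero[of "A (k + 2) y"]]
        ck_weight_bounds(1)[OF assms(3), of k]
      by (simp del: of_nat_Suc)
    also have "\<dots> = real q * norm (weighted_shift (weighted_shift A) k y)"
      by (simp add: weighted_shift_def del: of_nat_Suc)
    also have "\<dots> \<le> real q * (M * (4 * C) ^ k)" using M(2)[OF y] by (intro mult_left_mono) auto
    finally show "norm (ck_weight q k *\<^sub>R A (k + 2) y) \<le> real q * M * (4 * C) ^ k" by simp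
  qed
qed

lemma geom_bounded_ck_defect:
  assumes "geom_bounded_C2 U C A" "0 \<le> C" "q \<ge> 1"
  shows "geom_bounded U (4 * C) (ck_defect q A)"
proof -
  have b: "geom_bounded U C A" "b \<in> Basis \<Longrightarrow> b' \<in> Basis \<Longrightarrow> geom_bounded U C (\<lambda>k. pd (pd (A k) b) b')" for b b'
    using assms(1) unfolding geom_bounded_C2_def geom_bounded_C1_def by auto
  have "geom_bounded U C (\<lambda>k. laplacian (A k))"
    unfolding laplacian_def[abs_def] using b(2) by (intro geom_bounded_sum) auto
  then have 1: "geom_bounded U (4 * C) (\<lambda>k. laplacian (A k))"
    by (rule geom_bounded_mono) (use assms in auto)
  have 2: "geom_bounded U (4 * C) (\<lambda>k y. - (ck_weight q k *\<^sub>R A (k + 2) y))"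
    by (intro geom_bounded_linear[OF geom_bounded_ck_weight[OF b(1) assms(2,3)]] bounded_linear_minus bounded_linear_ident)
  show ?thesis using geom_bounded_add[OF 1 2] unfolding ck_defect_def[abs_def] by simp
qed

text \<open>The part of the alternative algebra that the series sees. \<open>left_square\<close>
  stands in for associativity: a repeated left factor acts as a sign.\<close>

locale anticommuting_units =
  fixes mul :: "'a::euclidean_space \<Rightarrow> 'a \<Rightarrow> 'a" and e :: 'a and vq :: "'q::finite \<Rightarrow> 'a"
  assumes bilin: "bilinear mul" and unit: "mul e x = x" "mul x e = x"
    and unit_square: "mul (vq j) (vq j) = - e"
    and left_square: "mul (vq j) (mul (vq j) a) = - a"
    and anticomm: "j \<noteq> j' \<Longrightarrow> mul (vq j) (vq j') = - mul (vq j') (vq j)"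
begin

lemma bounded_linear_mul: "bounded_linear (mul a)" "bounded_linear (\<lambda>x. mul x a)"
  using bilin unfolding bilinear_def by (auto simp: linear_conv_bounded_linear)

lemmas mul_simps =
  linear_add[OF bounded_linear.linear[OF bounded_linear_mul(1)]]
  linear_add[OF bounded_linear.linear[OF bounded_linear_mul(2)]]
  linear_cmul[OF bounded_linear.linear[OF bounded_linear_mul(1)]]
  linear_cmul[OF bounded_linear.linear[OF bounded_linear_mul(2)]]
  linear_0[OF bounded_linear.linear[OF bounded_linear_mul(1)]]
  linear_0[OF bounded_linear.linear[OF bounded_linear_mul(2)]]
  linear_neg[OF bounded_linear.linear[OF bounded_linear_mul(1)]]
  linear_neg[OF bounded_linear.linear[OF bounded_linear_mul(2)]]
  linear_diff[OF bounded_linear.linear[OF bounded_linear_mul(1)]]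
  linear_diff[OF bounded_linear.linear[OF bounded_linear_mul(2)]]

lemma mul_sum: "mul a (sum f I) = (\<Sum>i\<in>I. mul a (f i))" "mul (sum f I) a = (\<Sum>i\<in>I. mul (f i) a)"
  using linear_sum[OF bounded_linear.linear[OF bounded_linear_mul(1)]]
    linear_sum[OF bounded_linear.linear[OF bounded_linear_mul(2)]] by auto

lemma qelem_square: "mul (qelem vq x) (qelem vq x) = - (x \<bullet> x) *\<^sub>R e"
proof -
  let ?m = "\<lambda>j l. (x $ j * x $ l) *\<^sub>R mul (vq j) (vq l)"
  have S: "mul (qelem vq x) (qelem vq x) = (\<Sum>j\<in>UNIV. \<Sum>l\<in>UNIV. ?m j l)"
    unfolding qelem_def by (subst sum.swap) (simp add: mul_sum mul_simps scaleR_sum_right mult.commute)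
  \<comment> \<open>Adding the double sum to its transpose pairs each product with its reverse:
    anticommutation cancels them off the diagonal, and \<open>unit_square\<close> evaluates the
    diagonal.\<close>
  have "?m j l + ?m l j = (if l = j then - (2 * (x $ j * x $ j)) *\<^sub>R e else 0)" for j l
    using anticomm[of l j] by (auto simp: unit_square mult.commute scaleR_2[symmetric])
  then have "(\<Sum>j\<in>UNIV. \<Sum>l\<in>UNIV. ?m j l) + (\<Sum>j\<in>UNIV. \<Sum>l\<in>UNIV. ?m l j) = (\<Sum>j\<in>UNIV. - (2 * (x $ j * x $ j)) *\<^sub>R e)"
    unfolding sum.distrib[symmetric] by simp
  also have "\<dots> = 2 *\<^sub>R (- (x \<bullet> x) *\<^sub>R e)"
    by (simp add: inner_vec_def sum_negf scaleR_sum_left scaleR_sum_right)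
  moreover have "(\<Sum>j\<in>UNIV. \<Sum>l\<in>UNIV. ?m l j) = (\<Sum>j\<in>UNIV. \<Sum>l\<in>UNIV. ?m j l)"
    by (rule sum.swap)
  ultimately have "2 *\<^sub>R mul (qelem vq x) (qelem vq x) = 2 *\<^sub>R (- (x \<bullet> x) *\<^sub>R e)"
    by (simp only: S scaleR_2)
  then show ?thesis unfolding real_vector.scale_cancel_left by simp
qed

text \<open>Two more factors contribute the scalar \<open>- (x \<bullet> x)\<close>, so the powers
  never leave the span of \<open>e\<close> and \<open>qelem vq x\<close>, and their nesting causes
  no difficulty.\<close>

lemma apow_qelem:
  "apow mul e (qelem vq x) (2 * k) = ((-1) ^ k * (x \<bullet> x) ^ k) *\<^sub>R e"
  "apow mul e (qelem vq x) (2 * k + 1) = ((-1) ^ k * (x \<bullet> x) ^ k) *\<^sub>R qelem vq x"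
  by (induction k) (auto simp: mul_simps unit qelem_square)

lemma ck_term_even: "ck_term mul e vq A (2 * k) x = (snd x \<bullet> snd x) ^ k *\<^sub>R alt_subseq id 0 A k (fst x)"
  unfolding ck_term_def alt_subseq_def apow_qelem by (simp add: mul_simps unit mult.commute)

text \<open>The vector variable is expanded in coordinates, so that each summand is a real
  coordinate times a radial term with the fixed left factor \<open>vq j\<close>;
  \<open>has_laplacian_on_mult_coord\<close> then applies.\<close>

lemma ck_term_odd: "ck_term mul e vq A (2 * k + 1) x =
    (\<Sum>j\<in>UNIV. (snd x $ j) *\<^sub>R (snd x \<bullet> snd x) ^ k *\<^sub>R alt_subseq (mul (vq j)) 1 A k (fst x))"
  unfolding ck_term_def alt_subseq_def apow_qelem unfolding qelem_def
  by (simp add: mul_simps mul_sum scaleR_sum_right mult_ac)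

lemma ck_term_sums:
  assumes "geom_bounded U C A" "0 \<le> C" "C * \<rho> < 1" "x \<in> U \<times> ball 0 \<rho>"
  shows "(\<lambda>k. ck_term mul e vq A k x) sums
    (radial_series (alt_subseq id 0 A) x +
      (\<Sum>j\<in>UNIV. (snd x $ j) *\<^sub>R radial_series (alt_subseq (mul (vq j)) 1 A) x))"
proof (rule sums_even_odd)
  have "0 < \<rho>" using assms(4) by (auto intro: le_less_trans[OF norm_ge_zero])
  then have C: "C\<^sup>2 * \<rho>\<^sup>2 < 1"
    unfolding power_mult_distrib[symmetric] using assms(2,3) by (intro abs_square_less_1[THEN iffD2]) (auto simp: abs_mult)
  note R = radial_series_sums[OF geom_bounded_alt_subseq[OF assms(1,2)] zero_le_power2 C assms(4)]
  show "(\<lambda>k. ck_term mul e vq A (2 * k) x) sums radial_series (alt_subseq id 0 A) x"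
    unfolding ck_term_even by (intro R) (simp add: id_def)
  show "(\<lambda>k. ck_term mul e vq A (2 * k + 1) x) sums
      (\<Sum>j\<in>UNIV. (snd x $ j) *\<^sub>R radial_series (alt_subseq (mul (vq j)) 1 A) x)"
    unfolding ck_term_odd by (intro sums_sum sums_scaleR_right R bounded_linear_mul)
qed

lemma laplacian_ck_series:
  fixes A :: "nat \<Rightarrow> real^'p \<Rightarrow> 'a"
  assumes U: "open U" "convex U" and A: "geom_bounded_C2 U C A" and C: "0 \<le> C" "4 * C * \<rho> < 1"
  shows "has_laplacian_on (U \<times> ball (0::real^'q) \<rho>) (\<lambda>x. \<Sum>k. ck_term mul e vq A k x)
     (\<lambda>x. \<Sum>k. ck_term mul e vq (ck_defect CARD('q) A) k x)"
proof (cases "0 < \<rho>")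
  case False
  then have "U \<times> ball (0::real^'q) \<rho> = {}" by simp
  then show ?thesis unfolding has_laplacian_on_def by (simp only:) simp
next
  case True
  let ?S = "U \<times> ball (0::real^'q) \<rho>"
  let ?O = "\<lambda>j. alt_subseq (mul (vq j)) 1 A"
  let ?D = "ck_defect CARD('q) A"
  let ?c = "\<lambda>k. (2 * real k + 2) * (2 * real k + CARD('q))"
  have "(4 * C * \<rho>)\<^sup>2 < 1" using C True by (intro abs_square_less_1[THEN iffD2]) (auto simp: abs_mult)
  \<comment> \<open>In order: the bounds needed for the radial Laplacian, for plain radial series,
    for one \<open>weighted_shift\<close>, and for the series of defects, whose coefficients have
    ratio \<open>4 * C\<close>.\<close>
  then have C': "4 * C\<^sup>2 * \<rho>\<^sup>2 < 1" "C\<^sup>2 * \<rho>\<^sup>2 < 1" "2 * C\<^sup>2 * \<rho>\<^sup>2 < 1" "(4 * C)\<^sup>2 * \<rho>\<^sup>2 < 1"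
    using mult_nonneg_nonneg[OF zero_le_power2[of C] zero_le_power2[of \<rho>]]
    by (auto simp: power_mult_distrib)
  have Cr: "C * \<rho> < 1" using C True mult_nonneg_nonneg[of C \<rho>] by linarith
  have bA: "geom_bounded U C A" using A unfolding geom_bounded_C2_def geom_bounded_C1_def by blast
  have E2: "geom_bounded_C2 U (C\<^sup>2) (alt_subseq id 0 A)"
    by (intro geom_bounded_C2_alt_subseq A C U) (simp add: id_def)
  have O2: "geom_bounded_C2 U (C\<^sup>2) (?O j)" for j
    by (intro geom_bounded_C2_alt_subseq A C U bounded_linear_mul)
  have LE: "has_laplacian_on ?S (radial_series (alt_subseq id 0 A)) (radial_series (alt_subseq id 0 ?D))"
  proof (rule has_laplacian_on_cong[OF laplacian_radial_series[OF U E2 zero_le_power2 C'(1)] refl])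
    fix x assume "x \<in> ?S"
    then have "fst x \<in> U" by auto
    then show "radial_series (\<lambda>k y. laplacian (alt_subseq id 0 A k) y +
        ((2 * real k + 2) * (2 * real k + DIM(real^'q))) *\<^sub>R alt_subseq id 0 A (Suc k) y) x =
        radial_series (alt_subseq id 0 ?D) x"
    proof (rule radial_series_cong)
      fix k y assume y: "y \<in> U"
      show "laplacian (alt_subseq id 0 A k) y +
        ((2 * real k + 2) * (2 * real k + DIM(real^'q))) *\<^sub>R alt_subseq id 0 A (Suc k) y = alt_subseq id 0 ?D k y"
      proof -
        have "laplacian (alt_subseq id 0 A k) y = alt_subseq id 0 (\<lambda>k. laplacian (A k)) k y"
          by (rule laplacian_alt_subseq[OF A U(1) _ y]) (simp add: id_def)
        moreover have "ck_weight CARD('q) (2 * k) = ?c k"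
          by (simp add: ck_weight_def algebra_simps)
        ultimately show ?thesis
          by (simp add: alt_subseq_def ck_defect_def scaleR_diff_right mult.commute)
      qed
    qed
  qed
  have LO: "has_laplacian_on ?S (\<lambda>x. (snd x $ j) *\<^sub>R radial_series (?O j) x)
      (\<lambda>x. (snd x $ j) *\<^sub>R radial_series (alt_subseq (mul (vq j)) 1 ?D) x)" for j
  proof -
    let ?u = "(0, axis j 1) :: (real^'p) \<times> (real^'q)"
    have coord: "x \<bullet> ?u = snd x $ j" for x :: "(real^'p) \<times> (real^'q)"
      by (simp add: inner_axis inner_prod_def)
    have O1: "geom_bounded_C1 U (C\<^sup>2) (?O j)" using O2 unfolding geom_bounded_C2_def by blast
    have sO: "geom_bounded U (2 * C\<^sup>2) (weighted_shift (?O j))"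
      using O1 unfolding geom_bounded_C1_def by (intro geom_bounded_shift) auto
    let ?L = "\<lambda>k y. laplacian (?O j k) y + ?c k *\<^sub>R ?O j (Suc k) y"
    have gD: "geom_bounded U ((4 * C)\<^sup>2) (alt_subseq (mul (vq j)) 1 ?D)"
      using C(1) by (intro geom_bounded_alt_subseq geom_bounded_ck_defect A bounded_linear_mul) (auto simp: Suc_leI)
    show ?thesis
    proof (rule has_laplacian_on_cong[OF has_laplacian_on_mult_coord[of _ _ _ ?u, OF laplacian_radial_series[OF U O2 zero_le_power2 C'(1)]]])
      fix x assume x: "x \<in> ?S"
      show "(x \<bullet> ?u) *\<^sub>R radial_series (?O j) x = (snd x $ j) *\<^sub>R radial_series (?O j) x"
        by (simp add: coord)
      have "radial_series (\<lambda>k. pd (?O j k) 0) x = radial_series (\<lambda>k y. 0) x"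
        using O1 x linear_0[OF linear_pd] unfolding geom_bounded_C1_def
        by (intro radial_series_cong[where U = U]) auto
      then have p: "pd (radial_series (?O j)) ?u x = (2 * (snd x $ j)) *\<^sub>R radial_series (weighted_shift (?O j)) x"
        unfolding radial_series_C1(2)[OF U O1 zero_le_power2 C'(2) x]
        by (simp add: inner_axis radial_series_def)
      have "(\<lambda>k. (snd x \<bullet> snd x) ^ k *\<^sub>R alt_subseq (mul (vq j)) 1 ?D k (fst x) -
             4 *\<^sub>R (snd x \<bullet> snd x) ^ k *\<^sub>R weighted_shift (?O j) k (fst x))
           sums (radial_series (alt_subseq (mul (vq j)) 1 ?D) x - 4 *\<^sub>R radial_series (weighted_shift (?O j)) x)"
        by (intro sums_diff sums_scaleR_right radial_series_sums[OF sO _ C'(3) x] radial_series_sums[OF gD _ C'(4) x]) auto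
      moreover have "(snd x \<bullet> snd x) ^ k *\<^sub>R alt_subseq (mul (vq j)) 1 ?D k (fst x) -
             4 *\<^sub>R (snd x \<bullet> snd x) ^ k *\<^sub>R weighted_shift (?O j) k (fst x)
          = (snd x \<bullet> snd x) ^ k *\<^sub>R ?L k (fst x)" for k
      proof -
        have "fst x \<in> U" using x by auto
        then have "laplacian (?O j k) (fst x) = alt_subseq (mul (vq j)) 1 (\<lambda>k. laplacian (A k)) k (fst x)"
          by (rule laplacian_alt_subseq[OF A U(1) bounded_linear_mul(1)])
        \<comment> \<open>The surplus \<open>4 * real (Suc k)\<close> over \<open>?c k\<close> is
          produced by the cross term \<open>2 *\<^sub>R pd (radial_series (?O j)) ?u x\<close> of
          the coordinate product.\<close>
        moreover have "ck_weight CARD('q) (2 * k + 1) = ?c k + 4 * real (Suc k)"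
          by (simp add: ck_weight_def algebra_simps)
        ultimately have "alt_subseq (mul (vq j)) 1 ?D k (fst x) - 4 *\<^sub>R weighted_shift (?O j) k (fst x) = ?L k (fst x)"
          by (simp add: alt_subseq_def ck_defect_def weighted_shift_def mul_simps
              scaleR_diff_right scaleR_left_distrib scaleR_right_distrib mult_ac del: of_nat_Suc)
        then show ?thesis by (simp only: scaleR_diff_right[symmetric] scaleR_left_commute[of 4])
      qed
      ultimately have "radial_series ?L x =
          radial_series (alt_subseq (mul (vq j)) 1 ?D) x - 4 *\<^sub>R radial_series (weighted_shift (?O j)) x"
        unfolding radial_series_def by (simp add: sums_iff)
      then show "2 *\<^sub>R pd (radial_series (?O j)) ?u x + (x \<bullet> ?u) *\<^sub>R
          radial_series (\<lambda>k y. laplacian (?O j k) y + ((2 * real k + 2) * (2 * real k + DIM(real^'q))) *\<^sub>R ?O j (Suc k) y) x =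
          (snd x $ j) *\<^sub>R radial_series (alt_subseq (mul (vq j)) 1 ?D) x"
        unfolding coord p by (simp add: scaleR_diff_right mult_ac)
    qed
  qed
  have "has_laplacian_on ?S (\<lambda>x. radial_series (alt_subseq id 0 A) x + (\<Sum>j\<in>UNIV. (snd x $ j) *\<^sub>R radial_series (?O j) x))
     (\<lambda>x. radial_series (alt_subseq id 0 ?D) x + (\<Sum>j\<in>UNIV. (snd x $ j) *\<^sub>R radial_series (alt_subseq (mul (vq j)) 1 ?D) x))"
    by (intro has_laplacian_on_add has_laplacian_on_sum LE LO finite has_laplacian_onD(1)[OF LE])
  then show ?thesis
  proof (rule has_laplacian_on_cong)
    fix x assume x: "x \<in> ?S"
    show "radial_series (alt_subseq id 0 A) x + (\<Sum>j\<in>UNIV. (snd x $ j) *\<^sub>R radial_series (?O j) x) =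
        (\<Sum>k. ck_term mul e vq A k x)"
      using ck_term_sums[OF bA C(1) Cr x] by (simp add: sums_iff)
    show "radial_series (alt_subseq id 0 ?D) x + (\<Sum>j\<in>UNIV. (snd x $ j) *\<^sub>R radial_series (alt_subseq (mul (vq j)) 1 ?D) x) =
        (\<Sum>k. ck_term mul e vq ?D k x)"
      using ck_term_sums[OF geom_bounded_ck_defect[OF A C(1), of "CARD('q)"] _ C(2) x] C(1) by (simp add: sums_iff Suc_leI)
  qed
qed

end

section \<open>Maximum principle and Baire category\<close>

text \<open>If \<open>c\<close> were positive, \<open>\<phi>'\<close> would be positive just to the
  right of its zero at \<open>0\<close>, and the mean value theorem would make \<open>\<phi>\<close>
  grow. Of \<open>\<phi>'\<close> this asks only differentiability at \<open>0\<close>, which is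
  what pointwise second derivatives provide.\<close>

lemma second_derivative_nonpos_at_max:
  fixes \<phi> \<phi>' :: "real \<Rightarrow> real"
  assumes \<epsilon>: "\<epsilon> > 0" and der: "\<And>t. \<bar>t\<bar> < \<epsilon> \<Longrightarrow> (\<phi> has_real_derivative \<phi>' t) (at t)"
    and der2: "(\<phi>' has_real_derivative c) (at 0)" and max: "\<And>t. \<bar>t\<bar> < \<epsilon> \<Longrightarrow> \<phi> t \<le> \<phi> 0"
  shows "c \<le> 0"
proof (rule ccontr)
  assume "\<not> c \<le> 0"
  then obtain d where d: "d > 0" "\<And>h. 0 < h \<Longrightarrow> h < d \<Longrightarrow> \<phi>' 0 < \<phi>' h"
    using DERIV_pos_inc_right[OF der2] by auto
  have 0: "\<phi>' 0 = 0"
    using der[of 0] \<epsilon> max by (intro DERIV_local_max[of \<phi> "\<phi>' 0" 0 \<epsilon>]) auto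
  define h where "h = min d \<epsilon> / 2"
  have h: "0 < h" "h < d" "h < \<epsilon>" using d \<epsilon> by (auto simp: h_def)
  obtain z where z: "0 < z" "z < h" "\<phi> h - \<phi> 0 = (h - 0) * \<phi>' z"
    using MVT2[of 0 h \<phi> \<phi>'] h der by auto
  have "\<phi> h - \<phi> 0 > 0" unfolding z(3) using h z d(2)[of z] 0 by simp
  then show False using max[of h] h by simp
qed

text \<open>On every line parallel to an axis the comparison function has second derivative
  \<open>2 * c\<close>, so the one-dimensional test bounds each second partial derivative of
  \<open>g\<close> by \<open>2 * c\<close>.\<close>

lemma laplacian_interior_max:
  fixes g L :: "'b::euclidean_space \<Rightarrow> real" and c :: real
  assumes g: "has_laplacian_on S g L" and y: "y \<in> S"
    and max: "\<And>z. z \<in> S \<Longrightarrow> g z - c * (norm (z - x))\<^sup>2 \<le> g y - c * (norm (y - x))\<^sup>2"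
  shows "L y \<le> 2 * c * DIM('b)"
proof -
  note D = has_laplacian_onD[OF g]
  have "pd (pd g b) b y - 2 * c \<le> 0" if b: "b \<in> Basis" for b
  proof -
    obtain \<epsilon> where \<epsilon>: "\<epsilon> > 0" "ball y \<epsilon> \<subseteq> S" using D(1) y open_contains_ball by blast
    have S: "y + t *\<^sub>R b \<in> S" if "\<bar>t\<bar> < \<epsilon>" for t
      using \<epsilon>(2) that b by (auto simp: subset_iff dist_norm)
    have line: "((\<lambda>t. u (y + t *\<^sub>R b)) has_real_derivative pd u b (y + t *\<^sub>R b)) (at t)"
      if "u differentiable (at (y + t *\<^sub>R b))" for u :: "'b \<Rightarrow> real" and t
    proof -
      have "((\<lambda>t. u (y + t *\<^sub>R b)) has_derivative (\<lambda>h. pd u (h *\<^sub>R b) (y + t *\<^sub>R b))) (at t)"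
        by (rule has_derivative_compose[where f = "\<lambda>t. y + t *\<^sub>R b" and f' = "\<lambda>h. h *\<^sub>R b" and g = u, OF _ has_derivative_pd[OF that]])
          (auto intro!: derivative_eq_intros)
      then show ?thesis
        unfolding has_field_derivative_def
        by (simp add: linear_cmul[OF linear_pd[OF that]] mult.commute[of _ "pd u b _"])
    qed
    let ?q = "\<lambda>t. (norm (y + t *\<^sub>R b - x))\<^sup>2"
    have q_eq: "?q t = (norm (y - x))\<^sup>2 + 2 * t * ((y - x) \<bullet> b) + t\<^sup>2" for t
      using b unfolding power2_norm_eq_inner by (simp add: inner_simps power2_eq_square algebra_simps inner_commute)
    have q: "(?q has_real_derivative (2 * ((y - x) \<bullet> b) + 2 * t)) (at t)" for t
      unfolding q_eq by (auto intro!: derivative_eq_intros)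
    show ?thesis
    proof (rule second_derivative_nonpos_at_max[OF \<epsilon>(1)])
      show "((\<lambda>t. g (y + t *\<^sub>R b) - c * ?q t) has_real_derivative
          (pd g b (y + t *\<^sub>R b) - c * (2 * ((y - x) \<bullet> b) + 2 * t))) (at t)" if "\<bar>t\<bar> < \<epsilon>" for t
        by (intro DERIV_diff DERIV_cmult line D(2) S that q)
      show "((\<lambda>t. pd g b (y + t *\<^sub>R b) - c * (2 * ((y - x) \<bullet> b) + 2 * t)) has_real_derivative
          (pd (pd g b) b y - 2 * c)) (at 0)"
        using line[of "pd g b" 0] D(3)[OF y b] by (auto intro!: derivative_eq_intros)
      show "g (y + t *\<^sub>R b) - c * ?q t \<le> g (y + 0 *\<^sub>R b) - c * ?q 0" if "\<bar>t\<bar> < \<epsilon>" for t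
        using max[OF S[OF that]] by simp
    qed
  qed
  then have "(\<Sum>b\<in>Basis. pd (pd g b) b y) \<le> (\<Sum>b\<in>(Basis::'b set). 2 * c)"
    by (intro sum_mono) simp
  then show ?thesis using D(4)[OF y] by (simp add: mult.commute)
qed

text \<open>The paraboloid with coefficient \<open>c\<close> has Laplacian
  \<open>2 * c * DIM('b)\<close>, less than \<open>L\<close>; once it is subtracted, no maximum over
  the closed ball is interior, and comparing the boundary maximum with the centre gives the
  growth.\<close>

lemma strictly_subharmonic_growth:
  fixes g L :: "'b::euclidean_space \<Rightarrow> real" and c :: real
  assumes g: "has_laplacian_on S g L" and S: "cball x r \<subseteq> S" and r: "r > 0"
    and L: "\<And>y. y \<in> ball x r \<Longrightarrow> 2 * c * DIM('b) < L y"
  obtains y where "dist x y = r" "g x + c * r\<^sup>2 \<le> g y"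
proof -
  let ?h = "\<lambda>y. g y - c * (norm (y - x))\<^sup>2"
  have "continuous_on (cball x r) g"
    using has_laplacian_onD(2)[OF g] S
    by (intro continuous_at_imp_continuous_on ballI differentiable_imp_continuous_within) auto
  then have "continuous_on (cball x r) ?h" by (intro continuous_intros)
  then obtain y where y: "y \<in> cball x r" "\<And>z. z \<in> cball x r \<Longrightarrow> ?h z \<le> ?h y"
    using continuous_attains_sup[of "cball x r" ?h] r by auto
  have "y \<notin> ball x r"
  proof
    assume y': "y \<in> ball x r"
    have "has_laplacian_on (ball x r) g L"
      using S by (intro has_laplacian_on_subset[OF g]) auto
    then have "L y \<le> 2 * c * DIM('b)"
      using y(2) by (intro laplacian_interior_max[OF _ y', where x = x and g = g]) auto
    then show False using L[OF y'] by simp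
  qed
  then have "dist x y = r" using y(1) by simp
  moreover have "g x + c * r\<^sup>2 \<le> g y"
    using y(2)[of x] r \<open>dist x y = r\<close> by (simp add: dist_norm norm_minus_commute)
  ultimately show thesis by (rule that)
qed

text \<open>The closed sets where all \<open>\<phi> k\<close> are at most \<open>n\<close> cover the
  closed ball, so by Baire's theorem their relative complements cannot all be dense in it.\<close>

lemma Baire_uniform_bound:
  fixes \<phi> :: "nat \<Rightarrow> 'b::euclidean_space \<Rightarrow> real"
  assumes R: "R > 0" and cont: "\<And>k. continuous_on (cball x R) (\<phi> k)"
    and bd: "\<And>y. y \<in> cball x R \<Longrightarrow> \<exists>N. \<forall>k. \<phi> k y \<le> N"
  obtains y r N where "r > 0" "ball y r \<subseteq> cball x R" "\<And>k z. z \<in> ball y r \<Longrightarrow> \<phi> k z \<le> N"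
proof -
  let ?S = "cball x R"
  define E where "E n = {y \<in> ?S. \<forall>k. \<phi> k y \<le> real n}" for n :: nat
  have closed: "closed (E n)" for n
  proof -
    have "E n = ?S \<inter> (\<Inter>k. {y \<in> ?S. \<phi> k y \<le> real n})" by (auto simp: E_def)
    moreover have "closed {y \<in> ?S. \<phi> k y \<le> real n}" for k
      by (intro continuous_on_closed_Collect_le cont continuous_on_const closed_cball)
    ultimately show ?thesis by (simp only:) (intro closed_Int closed_INT ballI closed_cball)
  qed
  have "\<exists>n. \<not> ?S \<subseteq> closure (?S - E n)"
  proof (rule ccontr)
    assume *: "\<not> (\<exists>n. \<not> ?S \<subseteq> closure (?S - E n))"
    have "?S \<subseteq> closure (\<Inter>(range (\<lambda>n. ?S - E n)))"
    proof (rule Baire)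
      fix T assume "T \<in> range (\<lambda>n. ?S - E n)"
      then obtain n where T: "T = ?S - E n" by auto
      have "openin (top_of_set ?S) T"
        unfolding T by (metis Diff_Int2 Diff_eq closed inf_commute open_Compl openin_open_Int)
      then show "openin (top_of_set ?S) T \<and> ?S \<subseteq> closure T" using * T by blast
    qed auto
    moreover have "\<Inter>(range (\<lambda>n. ?S - E n)) = {}"
    proof -
      have "\<exists>n. y \<in> E n" if "y \<in> ?S" for y
      proof -
        obtain N where N: "\<And>k. \<phi> k y \<le> N" using bd[OF \<open>y \<in> ?S\<close>] by blast
        obtain n :: nat where "N \<le> real n" using real_arch_simple by blast
        then have "\<phi> k y \<le> real n" for k using N[of k] by linarith
        then show ?thesis using that by (auto simp: E_def)
      qed
      then show ?thesis by auto
    qed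
    ultimately have "?S \<subseteq> {}" by (simp only: closure_empty)
    then show False using R by auto
  qed
  then obtain n y where y: "y \<in> ?S" "y \<notin> closure (?S - E n)" by blast
  then obtain \<epsilon> where \<epsilon>: "\<epsilon> > 0" "\<And>w. w \<in> ?S - E n \<Longrightarrow> \<not> dist w y < \<epsilon>"
    unfolding closure_approachable by blast
  \<comment> \<open>The point \<open>y\<close> may lie on the boundary sphere, so it is replaced by
    a nearby \<open>z\<close> in the open ball.\<close>
  have "y \<in> closure (ball x R)" using y(1) R by (simp add: closure_ball)
  then obtain z where z: "z \<in> ball x R" "dist z y < \<epsilon>" using \<epsilon>(1) unfolding closure_approachable by blast
  then have "z \<in> ball x R \<inter> ball y \<epsilon>" by (simp add: dist_commute)
  then obtain r where r: "r > 0" "ball z r \<subseteq> ball x R \<inter> ball y \<epsilon>"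
    using openE[OF open_Int[OF open_ball open_ball]] by metis
  show thesis
  proof (rule that[OF r(1)])
    show "ball z r \<subseteq> cball x R" using r(2) by auto
    show "\<phi> k w \<le> real n" if "w \<in> ball z r" for k w
    proof -
      have "w \<in> ?S" "w \<in> ball y \<epsilon>" using that r(2) by auto
      then have "w \<in> E n" using \<epsilon>(2)[of w] by (auto simp: dist_commute)
      then show ?thesis by (simp add: E_def)
    qed
  qed
qed

text \<open>For harmonic \<open>f\<close> the two partial Laplacians add up to zero, so one
  determines the other. The first claim gives no formula for the slice Laplacian, as the series
  cannot be differentiated in that variable.\<close>

lemma laplacian_slices:
  fixes f :: "'b::euclidean_space \<times> 'c::euclidean_space \<Rightarrow> 'a::real_normed_vector"
  assumes f: "has_laplacian_on \<Omega> f L" and yz: "(y, z) \<in> \<Omega>"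
  shows "has_laplacian_on {y. (y, z) \<in> \<Omega>} (\<lambda>y. f (y, z)) (laplacian (\<lambda>y. f (y, z)))"
    "L (y, z) = laplacian (\<lambda>y. f (y, z)) y + laplacian (\<lambda>z. f (y, z)) z"
proof -
  note D = has_laplacian_onD[OF f]
  have 1: "has_laplacian_on {y. (y, z) \<in> \<Omega>} (\<lambda>y. f (y, z)) (\<lambda>y. \<Sum>b\<in>Basis. pd (pd f (b, 0)) (b, 0) (y, z))" for z
  proof (rule has_laplacian_onI[where g' = "\<lambda>b y. pd f (b, 0) (y, z)" and g'' = "\<lambda>b y h. pd (pd f (b, 0)) (h, 0) (y, z)"])
    have c: "((\<lambda>y. u (y, z)) has_derivative (\<lambda>h. pd u (h, 0) (y, z))) (at y)"
      if "u differentiable (at (y, z))" for u :: "'b \<times> 'c \<Rightarrow> 'a" and y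
      by (rule has_derivative_compose[where f = "\<lambda>y. (y, z)" and f' = "\<lambda>h. (h, 0)" and g = u, OF _ has_derivative_pd[OF that]])
          (auto intro!: derivative_eq_intros)
    show "open {y. (y, z) \<in> \<Omega>}"
      using open_vimage[OF D(1), of "\<lambda>y. (y, z)"] by (simp add: vimage_def continuous_on_Pair)
    fix y assume "y \<in> {y. (y, z) \<in> \<Omega>}"
    then have yz: "(y, z) \<in> \<Omega>" by simp
    show "(\<lambda>y. f (y, z)) differentiable (at y)" using c[OF D(2)[OF yz]] differentiable_def by blast
    fix b :: 'b assume b: "b \<in> Basis"
    show "pd (\<lambda>y. f (y, z)) b y = pd f (b, 0) (y, z)" by (rule pd_eqI[OF c[OF D(2)[OF yz]]])
    show "((\<lambda>y. pd f (b, 0) (y, z)) has_derivative (\<lambda>h. pd (pd f (b, 0)) (h, 0) (y, z))) (at y)"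
      using b by (intro c D(3)[OF yz]) (simp add: Basis_prod_def)
  qed auto
  have 2: "has_laplacian_on {z. (y, z) \<in> \<Omega>} (\<lambda>z. f (y, z)) (\<lambda>z. \<Sum>b\<in>Basis. pd (pd f (0, b)) (0, b) (y, z))" for y
  proof (rule has_laplacian_onI[where g' = "\<lambda>b z. pd f (0, b) (y, z)" and g'' = "\<lambda>b z h. pd (pd f (0, b)) (0, h) (y, z)"])
    have c: "((\<lambda>z. u (y, z)) has_derivative (\<lambda>h. pd u (0, h) (y, z))) (at z)"
      if "u differentiable (at (y, z))" for u :: "'b \<times> 'c \<Rightarrow> 'a" and z
      by (rule has_derivative_compose[where f = "\<lambda>z. (y, z)" and f' = "\<lambda>h. (0, h)" and g = u, OF _ has_derivative_pd[OF that]])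
          (auto intro!: derivative_eq_intros)
    show "open {z. (y, z) \<in> \<Omega>}"
      using open_vimage[OF D(1), of "\<lambda>z. (y, z)"] by (simp add: vimage_def continuous_on_Pair)
    fix z assume "z \<in> {z. (y, z) \<in> \<Omega>}"
    then have yz: "(y, z) \<in> \<Omega>" by simp
    show "(\<lambda>z. f (y, z)) differentiable (at z)" using c[OF D(2)[OF yz]] differentiable_def by blast
    fix b :: 'c assume b: "b \<in> Basis"
    show "pd (\<lambda>z. f (y, z)) b z = pd f (0, b) (y, z)" by (rule pd_eqI[OF c[OF D(2)[OF yz]]])
    show "((\<lambda>z. pd f (0, b) (y, z)) has_derivative (\<lambda>h. pd (pd f (0, b)) (0, h) (y, z))) (at z)"
      using b by (intro c D(3)[OF yz]) (simp add: Basis_prod_def)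
  qed auto
  show "has_laplacian_on {y. (y, z) \<in> \<Omega>} (\<lambda>y. f (y, z)) (laplacian (\<lambda>y. f (y, z)))"
    using 1[of z] unfolding has_laplacian_on_def by blast
  have "L (y, z) = (\<Sum>b\<in>Basis. pd (pd f (b, 0)) (b, 0) (y, z)) + (\<Sum>b\<in>Basis. pd (pd f (0, b)) (0, b) (y, z))"
    using D(4)[OF yz] unfolding sum_Basis_prod by simp
  then show "L (y, z) = laplacian (\<lambda>y. f (y, z)) y + laplacian (\<lambda>z. f (y, z)) z"
    using 1[of z] 2[of y] yz unfolding has_laplacian_on_def by simp
qed

section \<open>Uniqueness of the coefficients\<close>

context anticommuting_units
begin

lemma qelem_axis: "qelem vq (t *\<^sub>R axis j 1) = t *\<^sub>R vq j"
proof -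
  have "qelem vq (t *\<^sub>R axis j 1) = (\<Sum>l\<in>UNIV. if l = j then t *\<^sub>R vq j else 0)"
    unfolding qelem_def by (rule sum.cong) (auto simp: axis_def)
  then show ?thesis by simp
qed

lemma apow_scaleR: "apow mul e (t *\<^sub>R v) k = t ^ k *\<^sub>R apow mul e v k"
  by (induction k) (auto simp: mul_simps mult.commute)

lemma ck_term_axis:
  "ck_term mul e vq A k (y, t *\<^sub>R axis j 1) = t ^ k *\<^sub>R mul (apow mul e (vq j) k) (A k y)"
  unfolding ck_term_def by (simp add: qelem_axis apow_scaleR mul_simps)

lemma apow_unit:
  "apow mul e (vq j) (2 * k) = (-1) ^ k *\<^sub>R e" "apow mul e (vq j) (2 * k + 1) = (-1) ^ k *\<^sub>R vq j"
  using apow_qelem[of "axis j 1" k] qelem_axis[of 1 j] by (simp_all add: inner_axis_axis)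

text \<open>The Euclidean norm need not be multiplicative, so a constant enters; it does not depend
  on \<open>k\<close> because the powers of \<open>vq j\<close> are \<open>e\<close> or
  \<open>vq j\<close> up to sign. The lower bound comes from \<open>left_square\<close>, which makes
  \<open>mul (vq j)\<close> invertible.\<close>

lemma apow_unit_norm:
  obtains K where "K \<ge> 1" "\<And>k a. norm (mul (apow mul e (vq j) k) a) \<le> K * norm a"
    "\<And>k a. norm a \<le> K * norm (mul (apow mul e (vq j) k) a)"
proof -
  obtain K0 where K0: "\<And>a. norm (mul (vq j) a) \<le> norm a * K0"
    using bounded_linear.bounded[OF bounded_linear_mul(1)] by blast
  define K where "K = max 1 K0"
  have K: "norm (mul (vq j) a) \<le> K * norm a" "norm a \<le> K * norm a" for a
    using K0[of a] mult_right_mono[of K0 K "norm a"] mult_right_mono[of 1 K "norm a"]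
    by (auto simp: K_def mult.commute)
  have K': "norm a \<le> K * norm (mul (vq j) a)" for a
    using K(1)[of "mul (vq j) a"] by (simp add: left_square)
  have "norm (mul (apow mul e (vq j) k) a) \<le> K * norm a \<and> norm a \<le> K * norm (mul (apow mul e (vq j) k) a)" for k a
  proof (cases "even k")
    case True
    then obtain l where "k = 2 * l" by (elim evenE)
    then show ?thesis using K(2)[of a] unfolding apow_unit by (simp add: mul_simps unit apow_unit)
  next
    case False
    then obtain l where "k = 2 * l + 1" by (elim oddE)
    then show ?thesis using K(1)[of a] K'[of a] unfolding apow_unit by (simp only: apow_unit mul_simps) simp
  qed
  then show thesis by (intro that[of K]) (auto simp: K_def)
qed

text \<open>For \<open>2 * B * t \<le> 1\<close> the terms from index \<open>n\<close> on are
  dominated by a geometric series of ratio \<open>1 / 2\<close>, so the sum is of the order of the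
  first term that can be nonzero.\<close>

lemma ck_series_bound:
  fixes H :: "nat \<Rightarrow> real^'p \<Rightarrow> 'a"
  assumes H: "geom_bounded U B H" and B: "B \<ge> 0" and zero: "\<And>k y. k < n \<Longrightarrow> y \<in> U \<Longrightarrow> H k y = 0"
  shows "\<exists>K\<ge>0. \<forall>y\<in>U. \<forall>t. 0 \<le> t \<and> 2 * B * t \<le> 1 \<longrightarrow>
      summable (\<lambda>k. ck_term mul e vq H k (y, t *\<^sub>R axis j 1)) \<and>
      norm (\<Sum>k. ck_term mul e vq H k (y, t *\<^sub>R axis j 1)) \<le> K * t ^ n"
proof -
  obtain M where M: "M \<ge> 0" "\<And>k y. y \<in> U \<Longrightarrow> norm (H k y) \<le> M * B ^ k"
    using H unfolding geom_bounded_def by blast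
  obtain K0 where K0: "K0 \<ge> 1" "\<And>k a. norm (mul (apow mul e (vq j) k) a) \<le> K0 * norm a"
    using apow_unit_norm[of j] by metis
  let ?K = "K0 * M * B ^ n"
  have main: "summable (\<lambda>k. ck_term mul e vq H k (y, t *\<^sub>R axis j 1)) \<and>
      norm (\<Sum>k. ck_term mul e vq H k (y, t *\<^sub>R axis j 1)) \<le> 2 * ?K * t ^ n"
    if y: "y \<in> U" and t: "0 \<le> t" "2 * B * t \<le> 1" for y t
  proof -
    let ?f = "\<lambda>k. ck_term mul e vq H k (y, t *\<^sub>R axis j 1)"
    have le: "norm (?f (k + n)) \<le> ?K * t ^ n * (1 / 2) ^ k" for k
    proof -
      have "norm (?f (k + n)) \<le> t ^ (k + n) * (K0 * (M * B ^ (k + n)))"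
        unfolding ck_term_axis norm_scaleR
        using t order_trans[OF K0(2) mult_left_mono[OF M(2)[OF y]]] K0(1)
        by (auto simp: power_abs intro!: mult_left_mono)
      also have "\<dots> = ?K * t ^ n * (B * t) ^ k"
        by (simp add: power_add power_mult_distrib mult_ac)
      also have "\<dots> \<le> ?K * t ^ n * (1 / 2) ^ k"
        using t K0 M B by (intro mult_left_mono power_mono) auto
      finally show ?thesis .
    qed
    have s: "summable (\<lambda>k. ?f (k + n))"
      by (rule summable_comparison_test'[OF summable_mult[OF summable_geometric[of "1/2"]] le]) simp
    have s': "summable ?f" using summable_iff_shift[of ?f n] s by blast
    have "(\<Sum>k. ?f k) = (\<Sum>k. ?f (k + n))"
    proof -
      have "(\<Sum>k<n. ?f k) = 0" using zero y by (intro sum.neutral) (auto simp: ck_term_axis mul_simps)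
      then show ?thesis using suminf_split_initial_segment[OF s', of n] by simp
    qed
    also have "norm \<dots> \<le> (\<Sum>k. ?K * t ^ n * (1 / 2) ^ k)"
      by (rule norm_suminf_le[OF le]) (intro summable_mult summable_geometric, simp)
    also have "\<dots> = ?K * t ^ n * 2"
      by (subst suminf_mult) (auto simp: suminf_geometric)
    finally show ?thesis using s' by (simp add: mult_ac)
  qed
  moreover have "0 \<le> 2 * ?K" using K0 M B by simp
  ultimately show ?thesis by blast
qed

text \<open>On the ball provided by Baire's theorem, \<open>f (y, t *\<^sub>R axis j 1)\<close> is of the order of \<open>t ^ m\<close>, where \<open>m\<close> is the
  first index with a nonzero coefficient, while harmonicity forces its Laplacian in \<open>y\<close> to be of the exact
  order \<open>t ^ (m - 2)\<close>; as \<open>t\<close> tends to \<open>0\<close>, this contradicts the maximum principle.\<close>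

lemma ck_coefficients_vanish:
  fixes A :: "nat \<Rightarrow> real^'p \<Rightarrow> 'a" and \<Omega> :: "((real^'p) \<times> (real^'q)) set"
  assumes \<Omega>0: "open \<Omega>0" and sub: "\<And>y. y \<in> \<Omega>0 \<Longrightarrow> (y, 0) \<in> \<Omega>"
    and cont: "\<And>k. continuous_on \<Omega>0 (A k)"
    and sm: "\<And>x. x \<in> \<Omega> \<Longrightarrow> summable (\<lambda>k. ck_term mul e vq A k x)"
    and harm: "harmonic_on \<Omega> (\<lambda>x. \<Sum>k. ck_term mul e vq A k x)"
    and init: "\<And>y. y \<in> \<Omega>0 \<Longrightarrow> A 0 y = 0" "\<And>y. y \<in> \<Omega>0 \<Longrightarrow> A 1 y = 0"
    and y: "y \<in> \<Omega>0"
  shows "A k y = 0"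
proof (rule ccontr)
  assume "A k y \<noteq> 0"
  define m where "m = (LEAST k. \<exists>y\<in>\<Omega>0. A k y \<noteq> 0)"
  have "\<exists>y\<in>\<Omega>0. A m y \<noteq> 0"
    unfolding m_def by (rule LeastI[of _ k]) (use \<open>A k y \<noteq> 0\<close> y in auto)
  then obtain x1 where x1: "x1 \<in> \<Omega>0" "A m x1 \<noteq> 0" by blast
  have below: "A k y = 0" if "k < m" "y \<in> \<Omega>0" for k y
    using not_less_Least[of k "\<lambda>k. \<exists>y\<in>\<Omega>0. A k y \<noteq> 0"] that unfolding m_def by blast
  \<comment> \<open>The initial conditions force \<open>m \<ge> 2\<close>, so the first nonzero
    coefficient is the one that \<open>ck_defect\<close> pairs with the index
    \<open>n\<close>.\<close>
  have "m \<noteq> 0" "m \<noteq> 1" using x1 init by metis+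
  then have "m = (m - 2) + 2" by simp
  then obtain n where m: "m = n + 2" by blast
  define j :: 'q where "j = undefined"
  let ?ax = "axis j 1 :: real^'q"
  let ?T = "\<lambda>k. mul (apow mul e (vq j) k)"
  let ?f = "\<lambda>x. \<Sum>k. ck_term mul e vq A k x"
  obtain K where K: "K \<ge> 1" "\<And>k a. norm (?T k a) \<le> K * norm a" "\<And>k a. norm a \<le> K * norm (?T k a)"
    using apow_unit_norm[of j] by metis
  have open\<Omega>: "open \<Omega>" using harm by (simp add: harmonic_on_def)

  \<comment> \<open>\<open>A m\<close> is kept nonzero on the whole closed ball, because Baire's
    theorem gives no control over where the smaller ball will lie.\<close>
  obtain R t0 where R: "R > 0" "cball x1 R \<subseteq> \<Omega>0" "\<And>y. y \<in> cball x1 R \<Longrightarrow> A m y \<noteq> 0"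
    and t0: "t0 > 0" "\<And>y z. y \<in> cball x1 R \<Longrightarrow> norm z \<le> t0 \<Longrightarrow> (y, z) \<in> \<Omega>"
  proof -
    have "open {y \<in> \<Omega>0. A m y \<noteq> 0}"
    proof -
      have "open (A m -` (- {0}) \<inter> \<Omega>0)"
        using continuous_on_open_vimage[OF \<Omega>0, of "A m"] cont by blast
      moreover have "A m -` (- {0}) \<inter> \<Omega>0 = {y \<in> \<Omega>0. A m y \<noteq> 0}" by auto
      ultimately show ?thesis by simp
    qed
    then obtain R1 where R1: "R1 > 0" "cball x1 R1 \<subseteq> {y \<in> \<Omega>0. A m y \<noteq> 0}"
      using x1 open_contains_cball by (metis (mono_tags, lifting) mem_Collect_eq)
    obtain \<rho> where \<rho>: "\<rho> > 0" "ball (x1, 0) \<rho> \<subseteq> \<Omega>"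
      using open\<Omega> sub[OF x1(1)] open_contains_ball by metis
    have "(y, z) \<in> \<Omega>" if "y \<in> cball x1 (min R1 (\<rho> / 3))" "norm z \<le> \<rho> / 3" for y z
    proof -
      have "norm (y - x1, z) \<le> norm (y - x1) + norm z" by (rule norm_Pair_le)
      also have "\<dots> < \<rho>" using that \<rho>(1) by (simp add: dist_norm norm_minus_commute)
      finally have "dist (y, z) (x1, 0) < \<rho>" by (simp add: dist_norm)
      then have "(y, z) \<in> ball (x1, 0) \<rho>" unfolding mem_ball by (subst dist_commute)
      then show ?thesis using \<rho>(2) by blast
    qed
    then show thesis using R1 \<rho>(1) by (intro that[of "min R1 (\<rho> / 3)" "\<rho> / 3"]) auto
  qed
  \<comment> \<open>Convergence at the single value \<open>t0 *\<^sub>R ?ax\<close> makes the terms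
    bounded, and the lower estimate \<open>K(3)\<close> passes this on to the coefficients; the
    bound still depends on \<open>y\<close>.\<close>
  have bdd: "\<exists>N. \<forall>k. t0 ^ k * norm (A k y) \<le> N" if y: "y \<in> cball x1 R" for y
  proof -
    have "(y, t0 *\<^sub>R ?ax) \<in> \<Omega>" using t0 y by simp
    then have "(\<lambda>k. ck_term mul e vq A k (y, t0 *\<^sub>R ?ax)) \<longlonglongrightarrow> 0"
      using sm summable_LIMSEQ_zero by blast
    then have "Bseq (\<lambda>k. ck_term mul e vq A k (y, t0 *\<^sub>R ?ax))"
      by (intro convergent_imp_Bseq convergentI)
    then obtain N where N: "\<And>k. norm (ck_term mul e vq A k (y, t0 *\<^sub>R ?ax)) \<le> N"
      unfolding Bseq_def by blast
    have "t0 ^ k * norm (A k y) \<le> K * N" for k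
    proof -
      have "t0 ^ k * norm (A k y) \<le> t0 ^ k * (K * norm (?T k (A k y)))"
        using t0(1) K(3) by (intro mult_left_mono) auto
      also have "\<dots> = K * norm (ck_term mul e vq A k (y, t0 *\<^sub>R ?ax))"
        using t0(1) by (simp add: ck_term_axis power_abs mult_ac)
      also have "\<dots> \<le> K * N" using N K(1) by (intro mult_left_mono) auto
      finally show ?thesis .
    qed
    then show ?thesis by blast
  qed
  obtain y0 r N where r: "r > 0" "ball y0 r \<subseteq> cball x1 R"
    and N: "\<And>k z. z \<in> ball y0 r \<Longrightarrow> t0 ^ k * norm (A k z) \<le> N"
  proof (rule Baire_uniform_bound[OF R(1), of x1 "\<lambda>k y. t0 ^ k * norm (A k y)"])
    show "continuous_on (cball x1 R) (\<lambda>y. t0 ^ k * norm (A k y))" for k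
      using continuous_on_subset[OF cont R(2)] by (intro continuous_intros)
  qed (use bdd in auto)
  let ?U = "ball y0 r"
  have y0: "y0 \<in> ?U" using r by simp
  have U\<Omega>0: "z \<in> \<Omega>0" if "z \<in> ?U" for z using that r(2) R(2) by blast
  define B where "B = 1 / t0"
  have B: "B > 0" using t0 by (simp add: B_def)
  have N0: "N \<ge> 0" using N[OF y0, of 0] order_trans[OF norm_ge_zero] by force
  have AB: "norm (A k z) \<le> N * B ^ k" if "z \<in> ?U" for k z
    using N[OF that, of k] t0(1) by (simp add: B_def field_simps)
  then have gA: "geom_bounded ?U B A" by (intro geom_boundedI[OF N0])
  define H where "H k y = ck_weight CARD('q) k *\<^sub>R A (k + 2) y" for k y
  have gH: "geom_bounded ?U (4 * B) H"
    using geom_bounded_ck_weight[OF gA, of "CARD('q)"] B unfolding H_def[abs_def] by (simp add: Suc_leI)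

  \<comment> \<open>The series with coefficients \<open>H\<close> has ratio \<open>4 * B\<close>,
    and \<open>t0 / 8\<close> makes \<open>4 * B * \<rho>\<close> equal to
    \<open>1 / 2\<close>.\<close>
  define \<rho> where "\<rho> = t0 / 8"
  have \<rho>: "0 < \<rho>" "\<rho> \<le> t0" "4 * B * \<rho> < 1" using t0(1) by (auto simp: \<rho>_def B_def)
  \<comment> \<open>The coefficients are frozen at \<open>y\<close>: \<open>?F\<close> does not
    depend on its first argument and agrees with \<open>?f\<close> on the slice over
    \<open>y\<close>. Its Laplacian is therefore the \<open>xq\<close>-part alone, computed
    termwise, and harmonicity of \<open>?f\<close> gives the other part with the opposite
    sign.\<close>
  have lap: "laplacian (\<lambda>y. ?f (y, z)) y = (\<Sum>k. ck_term mul e vq H k (y, z))"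
    if y: "y \<in> ?U" and z: "norm z < \<rho>" for y z
  proof -
    let ?c = "\<lambda>k (_::real^'p). A k y"
    let ?F = "\<lambda>x. \<Sum>k. ck_term mul e vq ?c k x"
    have g0: "geom_bounded UNIV B (\<lambda>k (_::real^'p). 0 :: 'a)"
      by (rule geom_boundedI[of 0]) auto
    have gc: "geom_bounded UNIV B ?c" by (rule geom_boundedI[OF N0]) (rule AB[OF y])
    have c2: "geom_bounded_C2 UNIV B ?c"
      using g0 gc unfolding geom_bounded_C2_def geom_bounded_C1_def by simp
    have L: "has_laplacian_on (UNIV \<times> ball (0::real^'q) \<rho>) ?F (\<lambda>x. \<Sum>k. ck_term mul e vq (ck_defect CARD('q) ?c) k x)"
      using B \<rho> by (intro laplacian_ck_series[OF _ _ c2]) auto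
    have yz: "(y, z) \<in> UNIV \<times> ball (0::real^'q) \<rho>" using z by simp
    have F1: "(\<lambda>y'. ?F (y', z)) = (\<lambda>_. ?F (y, z))" by (simp add: ck_term_def)
    have F2: "(\<lambda>z'. ?F (y, z')) = (\<lambda>z'. ?f (y, z'))" by (simp add: ck_term_def)
    have "laplacian (\<lambda>y'. ?F (y', z)) y = 0" unfolding F1 by (simp add: laplacian_def)
    then have "laplacian (\<lambda>z'. ?f (y, z')) z = (\<Sum>k. ck_term mul e vq (ck_defect CARD('q) ?c) k (y, z))"
      using laplacian_slices(2)[OF L yz] unfolding F2 by simp
    also have "\<dots> = (\<Sum>k. - ck_term mul e vq H k (y, z))"
      by (rule suminf_cong) (simp add: ck_term_def ck_defect_def H_def laplacian_def mul_simps)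
    also have "\<dots> = - (\<Sum>k. ck_term mul e vq H k (y, z))"
    proof (rule suminf_minus)
      have "4 * B * \<rho> < 1" by (rule \<rho>)
      moreover have "(y, z) \<in> ?U \<times> ball 0 \<rho>" using y z by simp
      ultimately show "summable (\<lambda>k. ck_term mul e vq H k (y, z))"
        using ck_term_sums[OF gH, of \<rho> "(y, z)"] B sums_summable by fastforce
    qed
    finally have "laplacian (\<lambda>z'. ?f (y, z')) z = - (\<Sum>k. ck_term mul e vq H k (y, z))" .
    moreover have "(y, z) \<in> \<Omega>" using t0(2)[of y z] r(2) y z \<rho>(2) by auto
    ultimately show ?thesis
      using laplacian_slices(2)[OF harm[unfolded harmonic_on_iff_has_laplacian], of y z]
      by (simp add: add_eq_0_iff)
  qed

  have "\<exists>K\<ge>0. \<forall>y\<in>?U. \<forall>t. 0 \<le> t \<and> 2 * B * t \<le> 1 \<longrightarrow>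
      summable (\<lambda>k. ck_term mul e vq A k (y, t *\<^sub>R ?ax)) \<and> norm (?f (y, t *\<^sub>R ?ax)) \<le> K * t ^ m"
    by (rule ck_series_bound[OF gA less_imp_le[OF B]]) (rule below[OF _ U\<Omega>0])
  then obtain K1 where K1: "K1 \<ge> 0" "\<forall>y\<in>?U. \<forall>t. 0 \<le> t \<and> 2 * B * t \<le> 1 \<longrightarrow>
      summable (\<lambda>k. ck_term mul e vq A k (y, t *\<^sub>R ?ax)) \<and> norm (?f (y, t *\<^sub>R ?ax)) \<le> K1 * t ^ m"
    by (elim exE conjE)
  \<comment> \<open>With the leading coefficient removed, the rest of the series is of order
    \<open>t ^ Suc n\<close>.\<close>
  define H' where "H' k y = (if k = n then 0 else H k y)" for k y
  have gH': "geom_bounded ?U (4 * B) H'"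
  proof -
    obtain M where "M \<ge> 0" "\<And>k y. y \<in> ?U \<Longrightarrow> norm (H k y) \<le> M * (4 * B) ^ k"
      using gH unfolding geom_bounded_def by blast
    then show ?thesis using B by (intro geom_boundedI[of M]) (auto simp: H'_def)
  qed
  have H'0: "H' k y = 0" if "k < Suc n" "y \<in> ?U" for k y
    using that below[of "k + 2" y] U\<Omega>0 m by (cases "k = n") (auto simp: H'_def H_def)
  have "\<exists>K\<ge>0. \<forall>y\<in>?U. \<forall>t. 0 \<le> t \<and> 2 * (4 * B) * t \<le> 1 \<longrightarrow>
      summable (\<lambda>k. ck_term mul e vq H' k (y, t *\<^sub>R ?ax)) \<and>
      norm (\<Sum>k. ck_term mul e vq H' k (y, t *\<^sub>R ?ax)) \<le> K * t ^ Suc n"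
    by (rule ck_series_bound[OF gH']) (use B H'0 in auto)
  then obtain K2 where K2: "K2 \<ge> 0" "\<forall>y\<in>?U. \<forall>t. 0 \<le> t \<and> 2 * (4 * B) * t \<le> 1 \<longrightarrow>
      summable (\<lambda>k. ck_term mul e vq H' k (y, t *\<^sub>R ?ax)) \<and>
      norm (\<Sum>k. ck_term mul e vq H' k (y, t *\<^sub>R ?ax)) \<le> K2 * t ^ Suc n"
    by (elim exE conjE)
  define D where "D y = ?T n (H n y)" for y
  have split: "norm ((\<Sum>k. ck_term mul e vq H k (y, t *\<^sub>R ?ax)) - t ^ n *\<^sub>R D y) \<le> K2 * t ^ Suc n"
    if y: "y \<in> ?U" and t: "0 \<le> t" "2 * (4 * B) * t \<le> 1" for y t
  proof -
    have "(\<lambda>k. if k = n then ck_term mul e vq H k (y, t *\<^sub>R ?ax) else 0) sums ck_term mul e vq H n (y, t *\<^sub>R ?ax)"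
      using sums_single[of n "\<lambda>k. ck_term mul e vq H k (y, t *\<^sub>R ?ax)"] by simp
    have K2': "summable (\<lambda>k. ck_term mul e vq H' k (y, t *\<^sub>R ?ax))"
      "norm (\<Sum>k. ck_term mul e vq H' k (y, t *\<^sub>R ?ax)) \<le> K2 * t ^ Suc n"
      using K2(2)[rule_format, OF y conjI[OF t]] by auto
    note S = sums_add[OF \<open>_ sums ck_term mul e vq H n _\<close> summable_sums[OF K2'(1)]]
    have "(\<lambda>k. (if k = n then ck_term mul e vq H k (y, t *\<^sub>R ?ax) else 0) + ck_term mul e vq H' k (y, t *\<^sub>R ?ax)) =
        (\<lambda>k. ck_term mul e vq H k (y, t *\<^sub>R ?ax))"
      by (rule ext) (simp add: ck_term_axis H'_def mul_simps)
    moreover have "ck_term mul e vq H n (y, t *\<^sub>R ?ax) = t ^ n *\<^sub>R D y"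
      by (simp add: ck_term_axis D_def)
    ultimately have "(\<lambda>k. ck_term mul e vq H k (y, t *\<^sub>R ?ax)) sums
        (t ^ n *\<^sub>R D y + (\<Sum>k. ck_term mul e vq H' k (y, t *\<^sub>R ?ax)))"
      using S by simp
    then show ?thesis using K2'(2) by (simp add: sums_iff)
  qed
  have "A m y0 \<noteq> 0" using R(3) r y0 by blast
  then have "H n y0 \<noteq> 0" using ck_weight_bounds(1)[of "CARD('q)" n] by (auto simp: H_def m Suc_leI)
  then have "D y0 \<noteq> 0" using K(3)[of "H n y0" n] by (auto simp: D_def)
  then obtain b0 where b0: "b0 \<in> Basis" "D y0 \<bullet> b0 \<noteq> 0"
    using euclidean_all_zero_iff[of "D y0"] by blast
  \<comment> \<open>A unit vector along which \<open>D y0\<close> has a positive component reduces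
    the rest to real-valued functions, where a maximum principle is available.\<close>
  define b where "b = sgn (D y0 \<bullet> b0) *\<^sub>R b0"
  define d where "d = D y0 \<bullet> b"
  have d: "d > 0" using b0 by (simp add: d_def b_def sgn_mult_self_eq abs_sgn[symmetric] mult.commute)
  have b1: "norm b = 1" using b0 by (simp add: b_def abs_sgn_eq)
  have "continuous_on ?U (\<lambda>y. D y \<bullet> b)"
    unfolding D_def H_def
    by (intro continuous_intros bounded_linear.continuous_on[OF bounded_linear_mul(1)]
        continuous_on_subset[OF cont]) (use U\<Omega>0 in auto)
  from continuous_on_open_vimage[OF open_ball, THEN iffD1, rule_format, OF this open_greaterThan]
  have "open ((\<lambda>y. D y \<bullet> b) -` {d / 2<..} \<inter> ?U)" .
  moreover have "y0 \<in> (\<lambda>y. D y \<bullet> b) -` {d / 2<..} \<inter> ?U" using y0 d by (simp add: d_def)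
  ultimately obtain s where s: "s > 0" "cball y0 s \<subseteq> (\<lambda>y. D y \<bullet> b) -` {d / 2<..} \<inter> ?U"
    using open_contains_cball by metis

  \<comment> \<open>Near \<open>y0\<close> the component of \<open>D\<close> exceeds
    \<open>d / 2\<close> and the remainder costs at most \<open>d / 4\<close>, both times
    \<open>t ^ n\<close>; this \<open>c\<close> gives the paraboloid the Laplacian
    \<open>d / 8\<close> times \<open>t ^ n\<close>, below what is left.\<close>
  define c where "c = d / (16 * DIM(real^'p))"
  have c: "c > 0" "2 * c * DIM(real^'p) = d / 8" using d by (auto simp: c_def)
  \<comment> \<open>The last inequality prepares the contradiction: a growth of
    \<open>c * s\<^sup>2 * t ^ n\<close> against an oscillation of at most
    \<open>2 * K1 * t ^ (n + 2)\<close>.\<close>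
  obtain t where t: "0 < t" "t < \<rho>" "2 * (4 * B) * t \<le> 1" "K2 * t \<le> d / 4" "2 * K1 * t\<^sup>2 < c * s\<^sup>2"
  proof -
    have lim: "((\<lambda>t. K2 * t) \<longlongrightarrow> K2 * 0) (at_right 0)" "((\<lambda>t. 2 * K1 * t\<^sup>2) \<longlongrightarrow> 2 * K1 * 0\<^sup>2) (at_right 0)"
      "((\<lambda>t. 2 * (4 * B) * t) \<longlongrightarrow> 2 * (4 * B) * 0) (at_right 0)"
      by (intro tendsto_intros)+
    have "\<forall>\<^sub>F t in at_right 0. 0 < t \<and> t < \<rho> \<and> 2 * (4 * B) * t < 1 \<and> K2 * t < d / 4 \<and> 2 * K1 * t\<^sup>2 < c * s\<^sup>2"
      using c d s \<rho>(1)
      by (intro eventually_conj order_tendstoD(2)[OF lim(1)] order_tendstoD(2)[OF lim(2)] order_tendstoD(2)[OF lim(3)]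
          eventually_at_right_less eventually_at_rightI[of 0 \<rho>]) auto
    then obtain t where "0 < t \<and> t < \<rho> \<and> 2 * (4 * B) * t < 1 \<and> K2 * t < d / 4 \<and> 2 * K1 * t\<^sup>2 < c * s\<^sup>2"
      using eventually_happens'[OF trivial_limit_at_right_real] by blast
    then show thesis by (intro that[of t]) auto
  qed
  let ?z = "t *\<^sub>R ?ax"
  have nz: "norm ?z = t" using t(1) by simp
  have z\<Omega>: "(w, ?z) \<in> \<Omega>" if "w \<in> ?U" for w
  proof (rule t0(2))
    show "w \<in> cball x1 R" using that r(2) by blast
    show "norm ?z \<le> t0" using nz t(2) \<rho>(2) by linarith
  qed
  let ?g = "\<lambda>y. ?f (y, ?z) \<bullet> b"
  have lapg: "has_laplacian_on {y. (y, ?z) \<in> \<Omega>} ?g (\<lambda>y. laplacian (\<lambda>y. ?f (y, ?z)) y \<bullet> b)"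
  proof (rule has_laplacian_on_linear[OF _ bounded_linear_inner_left])
    show "has_laplacian_on {y. (y, ?z) \<in> \<Omega>} (\<lambda>y. ?f (y, ?z)) (laplacian (\<lambda>y. ?f (y, ?z)))"
      by (rule laplacian_slices(1)[OF harm[unfolded harmonic_on_iff_has_laplacian] z\<Omega>[OF y0]])
  qed
  obtain y where y: "dist y0 y = s" "?g y0 + (c * t ^ n) * s\<^sup>2 \<le> ?g y"
  proof (rule strictly_subharmonic_growth[OF lapg _ s(1), of y0 "c * t ^ n"])
    show "cball y0 s \<subseteq> {y. (y, ?z) \<in> \<Omega>}"
      using s(2) z\<Omega> by blast
    fix y assume "y \<in> ball y0 s"
    then have "y \<in> cball y0 s" by simp
    then have y: "y \<in> ?U" "d / 2 < D y \<bullet> b" using s(2) by blast+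
    let ?E = "(\<Sum>k. ck_term mul e vq H k (y, ?z)) - t ^ n *\<^sub>R D y"
    have "\<bar>?E \<bullet> b\<bar> \<le> norm ?E * norm b" by (rule Cauchy_Schwarz_ineq2)
    also have "\<dots> \<le> (K2 * t) * t ^ n"
      using split[OF y(1) less_imp_le[OF t(1)] t(3)] b1 by simp
    also have "\<dots> \<le> d / 4 * t ^ n" using t by (intro mult_right_mono) auto
    finally have "\<bar>(\<Sum>k. ck_term mul e vq H k (y, ?z)) \<bullet> b - t ^ n * (D y \<bullet> b)\<bar> \<le> d / 4 * t ^ n"
      by (simp only: inner_diff_left inner_scaleR_left)
    then have "t ^ n * (D y \<bullet> b) - d / 4 * t ^ n \<le> (\<Sum>k. ck_term mul e vq H k (y, ?z)) \<bullet> b"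
      by linarith
    moreover have "d / 2 * t ^ n < t ^ n * (D y \<bullet> b)"
      using y(2) t(1) by (simp add: mult.commute)
    moreover have "2 * (c * t ^ n) * DIM(real^'p) = d / 8 * t ^ n"
      unfolding c(2)[symmetric] by (simp only: mult_ac)
    moreover have "0 < d * t ^ n" using d t(1) by simp
    ultimately show "2 * (c * t ^ n) * DIM(real^'p) < laplacian (\<lambda>y. ?f (y, ?z)) y \<bullet> b"
      unfolding lap[OF y(1), of ?z, unfolded nz, OF t(2)] by linarith
  qed auto
  have bnd: "\<bar>?g w\<bar> \<le> K1 * t ^ m" if "w \<in> ?U" for w
  proof -
    have "\<bar>?g w\<bar> \<le> norm (?f (w, ?z)) * norm b" by (rule Cauchy_Schwarz_ineq2)
    also have "\<dots> \<le> K1 * t ^ m" using K1(2)[rule_format, OF that, of t] t B b1 by simp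
    finally show ?thesis .
  qed
  have "y \<in> cball y0 s" using y(1) by simp
  then have "y \<in> ?U" using s(2) by blast
  then have "(c * s\<^sup>2) * t ^ n \<le> (2 * K1 * t\<^sup>2) * t ^ n"
    using y(2) bnd[OF y0] bnd[of y] by (simp add: m power_add mult_ac abs_le_iff power2_eq_square)
  then show False using t(1,5) by simp
qed

end

section \<open>Existence\<close>

text \<open>The inverse of the product of \<open>(2 * i + 2) * (2 * i + s)\<close> over
  \<open>i < l\<close>. These are the coefficients of the hypergeometric function 0F1 with parameter
  \<open>s / 2\<close> at a quarter of its argument, a Bessel series normalised to start with
  \<open>1\<close>. Even indices use \<open>s = q\<close>, odd ones
  \<open>s = q + 2\<close>.\<close>

definition ck_coeff :: "real \<Rightarrow> nat \<Rightarrow> real" where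
  "ck_coeff s l = 1 / (4 ^ l * fact l * pochhammer (s / 2) l)"

lemma ck_coeff_rec:
  assumes "s > 0"
  shows "(2 * real l + 2) * (2 * real l + s) * ck_coeff s (Suc l) = ck_coeff s l"
proof -
  define d where "d = (2 * real l + 2) * (2 * real l + s)"
  have "d \<noteq> 0" using assms by (simp add: d_def add_nonneg_eq_0_iff)
  have eq: "4 ^ Suc l * fact (Suc l) * pochhammer (s / 2) (Suc l) =
      d * (4 ^ l * fact l * pochhammer (s / 2) l)"
    by (simp add: d_def pochhammer_Suc field_simps)
  show ?thesis unfolding ck_coeff_def d_def[symmetric] eq using \<open>d \<noteq> 0\<close> by simp
qed

lemma ck_coeff_0 [simp]: "ck_coeff s 0 = 1"
  by (simp add: ck_coeff_def)

text \<open>At \<open>s = 1\<close> the second bound is an equality by the duplication formula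
  \<open>fact_double\<close>, and the Pochhammer symbol grows with \<open>s\<close>. The factor
  \<open>fact (2 * l)\<close> is the one by which the iterated Laplacians may grow.\<close>

lemma ck_coeff_bound:
  assumes "s \<ge> 1"
  shows "0 \<le> ck_coeff s l" "ck_coeff s l * fact (2 * l) \<le> 1"
proof -
  have "pochhammer (1 / 2) l \<le> pochhammer (s / 2) l"
    unfolding pochhammer_prod using assms by (intro prod_mono) auto
  then have "4 ^ l * fact l * pochhammer (1 / 2) l \<le> 4 ^ l * fact l * pochhammer (s / 2) l"
    by (intro mult_left_mono) auto
  moreover have "2 ^ (2 * l) = (4::real) ^ l" by (simp add: power_mult)
  ultimately have "fact (2 * l) \<le> 4 ^ l * fact l * pochhammer (s / 2) l"
    unfolding fact_double by (simp only: mult.commute mult.left_commute)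
  moreover have p: "0 < 4 ^ l * fact l * pochhammer (s / 2) l"
    using assms by (intro mult_pos_pos pochhammer_pos) auto
  ultimately show "ck_coeff s l * fact (2 * l) \<le> 1" by (simp add: ck_coeff_def)
  show "0 \<le> ck_coeff s l" using p by (simp add: ck_coeff_def)
qed

lemma ck_coeff_Gamma:
  assumes "s > 0"
  shows "Gamma (s / 2) * (-1) ^ k * (norm v / 2) ^ (2 * k) / (fact k * Gamma (real k + s / 2)) =
      ck_coeff s k * ((-1) ^ k * (v \<bullet> v) ^ k)"
proof -
  have "s / 2 \<notin> \<int>\<^sub>\<le>\<^sub>0" using assms by (auto elim!: nonpos_Ints_cases)
  then have "pochhammer (s / 2) k = Gamma (real k + s / 2) / Gamma (s / 2)"
    by (simp add: pochhammer_Gamma add.commute)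
  moreover have "(norm v / 2) ^ (2 * k) = (v \<bullet> v) ^ k / 4 ^ k"
    by (simp add: power_mult power_divide power2_norm_eq_inner)
  ultimately show ?thesis by (simp add: ck_coeff_def)
qed

text \<open>Merges the normalised iterates of \<open>A0\<close> and \<open>A1\<close> into one
  sequence; \<open>a\<close> holds the bounded factors that remain.\<close>

definition interleave :: "(nat \<Rightarrow> real) \<Rightarrow> (nat \<Rightarrow> 'b \<Rightarrow> 'a) \<Rightarrow> (nat \<Rightarrow> 'b \<Rightarrow> 'a) \<Rightarrow> nat \<Rightarrow> 'b \<Rightarrow> 'a::real_vector" where
  "interleave a V W k y = a k *\<^sub>R (if even k then V (k div 2) y else W (k div 2) y)"

text \<open>The entry at \<open>k\<close> has index \<open>k div 2\<close>, and
  \<open>C \<ge> 1\<close> lets this exponent be raised to \<open>k\<close>, a rough step that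
  avoids the square root of \<open>C\<close>.\<close>

lemma geom_bounded_interleave:
  assumes "geom_bounded U C V" "geom_bounded U C W" "C \<ge> 1" "\<And>k. \<bar>a k\<bar> \<le> 1"
  shows "geom_bounded U C (interleave a V W)"
proof -
  obtain M N where M: "M \<ge> 0" "\<And>k y. y \<in> U \<Longrightarrow> norm (V k y) \<le> M * C ^ k"
     and N: "N \<ge> 0" "\<And>k y. y \<in> U \<Longrightarrow> norm (W k y) \<le> N * C ^ k"
    using assms(1,2) unfolding geom_bounded_def by blast
  show ?thesis
  proof (rule geom_boundedI)
    show "0 \<le> M + N" using M N by simp
    fix k y assume y: "y \<in> U"
    have "norm (interleave a V W k y) \<le> 1 * norm (if even k then V (k div 2) y else W (k div 2) y)"
      unfolding interleave_def norm_scaleR using assms(4) by (intro mult_right_mono) auto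
    also have "\<dots> \<le> (M + N) * C ^ (k div 2)"
    proof -
      have "0 \<le> M * C ^ (k div 2)" "0 \<le> N * C ^ (k div 2)" using M(1) N(1) assms(3) by simp_all
      then show ?thesis using M(2)[OF y, of "k div 2"] N(2)[OF y, of "k div 2"] by (simp add: distrib_right)
    qed
    also have "\<dots> \<le> (M + N) * C ^ k"
      using M(1) N(1) assms(3) by (intro mult_left_mono power_increasing) auto
    finally show "norm (interleave a V W k y) \<le> (M + N) * C ^ k" .
  qed
qed

lemma pd_interleave:
  assumes "V (k div 2) differentiable (at y)" "W (k div 2) differentiable (at y)"
  shows "interleave a V W k differentiable (at y)"
    "pd (interleave a V W k) b y = interleave a (\<lambda>k. pd (V k) b) (\<lambda>k. pd (W k) b) k y"
proof -
  define u where "u = (if even k then V (k div 2) else W (k div 2))"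
  have u: "interleave a V W k = (\<lambda>y. a k *\<^sub>R u y)" "u differentiable (at y)"
    using assms by (auto simp: interleave_def u_def)
  show "interleave a V W k differentiable (at y)"
    unfolding u(1) by (rule differentiable_linear[OF bounded_linear_scaleR_right u(2)])
  show "pd (interleave a V W k) b y = interleave a (\<lambda>k. pd (V k) b) (\<lambda>k. pd (W k) b) k y"
    unfolding u(1) pd_linear[OF bounded_linear_scaleR_right u(2)] by (simp add: interleave_def u_def)
qed

lemma geom_bounded_C1_interleave:
  assumes "geom_bounded_C1 U C V" "geom_bounded_C1 U C W" "C \<ge> 1" "\<And>k. \<bar>a k\<bar> \<le> 1"
  shows "geom_bounded_C1 U C (interleave a V W)"
  unfolding geom_bounded_C1_def
proof (intro conjI allI ballI)
  show "geom_bounded U C (interleave a V W)"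
    using assms unfolding geom_bounded_C1_def by (intro geom_bounded_interleave) auto
  show "interleave a V W k differentiable (at y)" if "y \<in> U" for k y
    using assms that unfolding geom_bounded_C1_def by (intro pd_interleave(1)) auto
  fix b :: 'a assume b: "b \<in> Basis"
  show "geom_bounded U C (\<lambda>k. pd (interleave a V W k) b)"
  proof (rule geom_bounded_cong)
    show "geom_bounded U C (interleave a (\<lambda>k. pd (V k) b) (\<lambda>k. pd (W k) b))"
      using assms b unfolding geom_bounded_C1_def by (intro geom_bounded_interleave) auto
    show "interleave a (\<lambda>k. pd (V k) b) (\<lambda>k. pd (W k) b) k y = pd (interleave a V W k) b y" if "y \<in> U" for k y
      using assms that unfolding geom_bounded_C1_def by (intro pd_interleave(2)[symmetric]) auto
  qed
qed

lemma geom_bounded_C2_interleave: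
  assumes "geom_bounded_C2 U C V" "geom_bounded_C2 U C W" "C \<ge> 1" "\<And>k. \<bar>a k\<bar> \<le> 1" "open U"
  shows "geom_bounded_C2 U C (interleave a V W)"
  unfolding geom_bounded_C2_def
proof (intro conjI ballI)
  show "geom_bounded_C1 U C (interleave a V W)"
    using assms unfolding geom_bounded_C2_def by (intro geom_bounded_C1_interleave) auto
  fix b :: 'a assume b: "b \<in> Basis"
  show "geom_bounded_C1 U C (\<lambda>k. pd (interleave a V W k) b)"
  proof (rule geom_bounded_C1_cong[OF assms(5)])
    show "geom_bounded_C1 U C (interleave a (\<lambda>k. pd (V k) b) (\<lambda>k. pd (W k) b))"
      using assms b unfolding geom_bounded_C2_def by (intro geom_bounded_C1_interleave) auto
    show "interleave a (\<lambda>k. pd (V k) b) (\<lambda>k. pd (W k) b) k y = pd (interleave a V W k) b y" if "y \<in> U" for k y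
      using assms that unfolding geom_bounded_C2_def geom_bounded_C1_def
      by (intro pd_interleave(2)[symmetric]) auto
  qed
qed

lemma geom_bounded_C2_mono:
  assumes "geom_bounded_C2 U C W" "0 \<le> C" "C \<le> D"
  shows "geom_bounded_C2 U D W"
  using assms geom_bounded_mono[OF _ assms(2,3)] unfolding geom_bounded_C2_def geom_bounded_C1_def by auto

section \<open>Tubular domains around the initial set\<close>

lemma has_laplacian_on_Union:
  assumes "\<And>S. S \<in> \<S> \<Longrightarrow> has_laplacian_on S g L"
  shows "has_laplacian_on (\<Union>\<S>) g L"
  using assms unfolding has_laplacian_on_def by (auto intro: open_Union)

text \<open>Every piece, enlarged by the connected spine \<open>\<Omega>0 \<times> {0}\<close>, is
  connected, and all of them share the spine. The fibre type is arbitrary since the fact is needed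
  both for the full domain and for its slices, whose fibre is \<open>real\<close>.\<close>

lemma connected_tube:
  fixes G :: "('b::real_normed_vector \<times> real) set"
  assumes "connected \<Omega>0" "\<Omega>0 \<noteq> {}" "fst ` G = \<Omega>0" "\<And>x \<rho>. (x, \<rho>) \<in> G \<Longrightarrow> 0 < \<rho>"
    and sub: "\<And>x \<rho>. (x, \<rho>) \<in> G \<Longrightarrow> ball x \<rho> \<subseteq> \<Omega>0"
  shows "connected (\<Union>(x, \<rho>)\<in>G. ball x \<rho> \<times> ball (0::'c::real_normed_vector) \<rho>)"
proof -
  let ?T = "\<Omega>0 \<times> {0::'c}"
  let ?P = "\<lambda>(x, \<rho>). ball x \<rho> \<times> ball (0::'c) \<rho>"
  have "connected (\<Union>((\<lambda>g. ?T \<union> ?P g) ` G))"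
  proof (rule connected_Union)
    fix S assume "S \<in> (\<lambda>g. ?T \<union> ?P g) ` G"
    then obtain x \<rho> where g: "(x, \<rho>) \<in> G" "S = ?T \<union> (ball x \<rho> \<times> ball 0 \<rho>)" by auto
    have "(x, 0) \<in> ?T \<inter> (ball x \<rho> \<times> ball 0 \<rho>)" using g(1) assms(3,4) by force
    then have "?T \<inter> (ball x \<rho> \<times> ball 0 \<rho>) \<noteq> {}" by blast
    moreover have "connected ?T" by (rule connected_Times[OF assms(1) connected_sing])
    moreover have "connected (ball x \<rho> \<times> ball (0::'c) \<rho>)"
      by (rule connected_Times[OF connected_ball connected_ball])
    ultimately show "connected S" unfolding g(2) by (intro connected_Un)
  next
    obtain x where "x \<in> \<Omega>0" using assms(2) by blast
    then have "(x, 0) \<in> \<Inter> ((\<lambda>g. ?T \<union> ?P g) ` G)" by auto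
    then show "\<Inter> ((\<lambda>g. ?T \<union> ?P g) ` G) \<noteq> {}" by blast
  qed
  moreover have "?T \<subseteq> (\<Union>g\<in>G. ?P g)" using assms(3,4) by force
  then have "\<Union>((\<lambda>g. ?T \<union> ?P g) ` G) = (\<Union>g\<in>G. ?P g)" using assms(2,3) by auto
  ultimately show ?thesis by simp
qed

lemma tube_domain:
  fixes G :: "((real^'p) \<times> real) set" and \<Omega> :: "((real^'p) \<times> (real^'q)) set"
  assumes "connected \<Omega>0" "\<Omega>0 \<noteq> {}" "fst ` G = \<Omega>0" "\<And>x \<rho>. (x, \<rho>) \<in> G \<Longrightarrow> 0 < \<rho>"
    and sub: "\<And>x \<rho>. (x, \<rho>) \<in> G \<Longrightarrow> ball x \<rho> \<subseteq> \<Omega>0"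
    and \<Omega>: "\<Omega> = (\<Union>(x, \<rho>)\<in>G. ball x \<rho> \<times> ball 0 \<rho>)"
  shows "open \<Omega>" "connected \<Omega>" "slice_domain \<Omega>" "p_symmetric \<Omega>"
    "\<Omega> \<subseteq> {x. fst x \<in> \<Omega>0}" "(\<lambda>xp. (xp, 0)) ` \<Omega>0 \<subseteq> \<Omega>"
proof -
  show "open \<Omega>" unfolding \<Omega> by (auto intro!: open_Times)
  show "connected \<Omega>" unfolding \<Omega> by (rule connected_tube[OF assms(1-5)])
  show 1: "\<Omega> \<subseteq> {x. fst x \<in> \<Omega>0}" unfolding \<Omega> using sub by fastforce
  show 2: "(\<lambda>xp. (xp, 0)) ` \<Omega>0 \<subseteq> \<Omega>" unfolding \<Omega> using assms(3,4) by force
  show "p_symmetric \<Omega>" unfolding \<Omega> p_symmetric_def by auto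
  show "slice_domain \<Omega>"
    unfolding slice_domain_def Let_def
  proof (intro conjI allI impI)
    show ne: "{xp. (xp, 0) \<in> \<Omega>} \<noteq> {}" using 2 assms(2) by blast
    fix \<omega> :: "real^'q" assume "norm \<omega> = 1"
    \<comment> \<open>Multiplying a unit vector by a real keeps the absolute value as norm, so each
      slice is a tube over the same family \<open>G\<close> with intervals as fibres.\<close>
    then have eq: "{z :: (real^'p) \<times> real. (fst z, snd z *\<^sub>R \<omega>) \<in> \<Omega>} =
        (\<Union>(x, \<rho>)\<in>G. ball x \<rho> \<times> ball 0 \<rho>)"
      unfolding \<Omega> by (simp add: set_eq_iff mem_Times_iff case_prod_beta)
    show "open {z :: (real^'p) \<times> real. (fst z, snd z *\<^sub>R \<omega>) \<in> \<Omega>}"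
      unfolding eq by (auto intro!: open_Times)
    show "connected {z :: (real^'p) \<times> real. (fst z, snd z *\<^sub>R \<omega>) \<in> \<Omega>}"
      unfolding eq by (rule connected_tube[OF assms(1-5)])
    obtain xp where "(xp, 0) \<in> \<Omega>" using ne by blast
    then have "(xp, 0) \<in> {z :: (real^'p) \<times> real. (fst z, snd z *\<^sub>R \<omega>) \<in> \<Omega>}" by simp
    then show "{z :: (real^'p) \<times> real. (fst z, snd z *\<^sub>R \<omega>) \<in> \<Omega>} \<noteq> {}" by blast
  qed
qed

definition ck_extension_coeff :: "nat \<Rightarrow> (real^'p \<Rightarrow> 'a) \<Rightarrow> (real^'p \<Rightarrow> 'a) \<Rightarrow> nat \<Rightarrow> real^'p \<Rightarrow> 'a::euclidean_space" where
  "ck_extension_coeff q A0 A1 k y =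
     (if even k then ck_coeff (real q) (k div 2) *\<^sub>R (laplacian ^^ (k div 2)) A0 y
      else ck_coeff (real q + 2) (k div 2) *\<^sub>R (laplacian ^^ (k div 2)) A1 y)"

lemma ck_extension_coeff_geom_bounded:
  fixes A0 A1 :: "real^'p \<Rightarrow> 'a::euclidean_space"
  assumes q: "q \<ge> 1" and \<Omega>0: "open \<Omega>0" and an: "real_analytic_on \<Omega>0 A0" "real_analytic_on \<Omega>0 A1" and x: "x \<in> \<Omega>0"
  shows "\<exists>\<rho>>0. ball x \<rho> \<subseteq> \<Omega>0 \<and>
    (\<exists>C\<ge>0. 4 * C * \<rho> < 1 \<and> geom_bounded_C2 (ball x \<rho>) C (ck_extension_coeff q A0 A1))"
proof -
  let ?V = "\<lambda>u k y. (laplacian ^^ k) u y /\<^sub>R fact (2 * k)"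
  obtain r0 C0 where 0: "r0 > 0" "C0 \<ge> 0" "ball x r0 \<subseteq> \<Omega>0"
    "\<forall>r. 0 < r \<and> r \<le> r0 \<longrightarrow> geom_bounded_C2 (ball x r) C0 (?V A0)"
    using laplacian_iterate_geom_bounded[OF an(1) \<Omega>0 x] .
  obtain r1 C1 where 1: "r1 > 0" "C1 \<ge> 0" "ball x r1 \<subseteq> \<Omega>0"
    "\<forall>r. 0 < r \<and> r \<le> r1 \<longrightarrow> geom_bounded_C2 (ball x r) C1 (?V A1)"
    using laplacian_iterate_geom_bounded[OF an(2) \<Omega>0 x] .
  define C where "C = max 1 (max C0 C1)"
  \<comment> \<open>\<open>1 / (8 * C)\<close> gives \<open>4 * C * \<rho> \<le> 1 / 2\<close>;
    shrinking the ball is harmless as \<open>C\<close> is valid for all smaller radii.\<close>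
  define \<rho> where "\<rho> = min (min r0 r1) (1 / (8 * C))"
  have C: "C \<ge> 1" "C0 \<le> C" "C1 \<le> C" by (auto simp: C_def)
  have \<rho>: "\<rho> > 0" "\<rho> \<le> r0" "\<rho> \<le> r1" "\<rho> \<le> 1 / (8 * C)" using 0(1) 1(1) C(1) by (auto simp: \<rho>_def)
  have "4 * C * \<rho> \<le> 4 * C * (1 / (8 * C))" using \<rho>(4) C(1) by (intro mult_left_mono) auto
  then have C\<rho>: "4 * C * \<rho> < 1" using C(1) by simp
  \<comment> \<open>The factor \<open>fact (2 * (k div 2))\<close> undoes the division in
    \<open>?V\<close>, and \<open>ck_coeff_bound\<close> keeps the product at most
    \<open>1\<close>.\<close>
  define a where "a k = (if even k then ck_coeff (real q) (k div 2) else ck_coeff (real q + 2) (k div 2))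
      * fact (2 * (k div 2))" for k :: nat
  have a: "\<bar>a k\<bar> \<le> 1" for k
    using ck_coeff_bound[of "real q" "k div 2"] ck_coeff_bound[of "real q + 2" "k div 2"] q
    by (auto simp: a_def)
  have eq: "ck_extension_coeff q A0 A1 = interleave a (?V A0) (?V A1)"
    by (intro ext) (simp add: ck_extension_coeff_def interleave_def a_def)
  have "geom_bounded_C2 (ball x \<rho>) C (ck_extension_coeff q A0 A1)"
    unfolding eq using C \<rho> a
    by (intro geom_bounded_C2_interleave geom_bounded_C2_mono[OF 0(4)[rule_format] 0(2)] geom_bounded_C2_mono[OF 1(4)[rule_format] 1(2)]) auto
  moreover have "ball x \<rho> \<subseteq> \<Omega>0" using 0(3) \<rho>(2) by auto
  ultimately show ?thesis using \<rho>(1) C\<rho> C(1) by (intro exI[of _ \<rho>] conjI exI[of _ C]) auto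
qed

lemma ck_extension_coeff_analytic:
  assumes "open \<Omega>0" "real_analytic_on \<Omega>0 A0" "real_analytic_on \<Omega>0 A1"
  shows "real_analytic_on \<Omega>0 (ck_extension_coeff q A0 A1 k)"
  unfolding ck_extension_coeff_def[abs_def]
  using real_analytic_on_linear[OF real_analytic_on_laplacian_iterate[OF assms(2,1)] assms(1) bounded_linear_scaleR_right]
    real_analytic_on_linear[OF real_analytic_on_laplacian_iterate[OF assms(3,1)] assms(1) bounded_linear_scaleR_right]
  by (cases "even k") auto

text \<open>Both parities come from \<open>ck_coeff_rec\<close>, with \<open>s = q\<close> or
  \<open>s = q + 2\<close>; analyticity supplies the differentiability that lets constants be pulled
  out of the Laplacian.\<close>

lemma ck_defect_ck_extension_coeff:
  fixes A0 A1 :: "real^'p \<Rightarrow> 'a::euclidean_space"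
  assumes q: "q \<ge> 1" and \<Omega>0: "open \<Omega>0" and an: "real_analytic_on \<Omega>0 A0" "real_analytic_on \<Omega>0 A1" and y: "y \<in> \<Omega>0"
  shows "ck_defect q (ck_extension_coeff q A0 A1) k y = 0"
proof -
  have lap: "laplacian (\<lambda>y. c *\<^sub>R (laplacian ^^ l) u y) y = c *\<^sub>R (laplacian ^^ Suc l) u y"
    if "real_analytic_on \<Omega>0 u" for c l and u :: "real^'p \<Rightarrow> 'a"
    using has_laplacian_on_linear[OF real_analytic_on_imp_has_laplacian[OF real_analytic_on_laplacian_iterate[OF that \<Omega>0, of l] \<Omega>0]
        bounded_linear_scaleR_right[of c]] y
    by (simp add: has_laplacian_on_def)
  have rec: "ck_coeff s l = ((2 * real l + 2) * (2 * real l + s)) * ck_coeff s (Suc l)" if "s > 0" for s l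
    using ck_coeff_rec[OF that] by simp
  show ?thesis
  proof (cases "even k")
    case True
    then obtain l where k: "k = 2 * l" by (elim evenE)
    have "ck_extension_coeff q A0 A1 k = (\<lambda>y. ck_coeff (real q) l *\<^sub>R (laplacian ^^ l) A0 y)"
      by (rule ext) (simp add: ck_extension_coeff_def k)
    moreover have "ck_extension_coeff q A0 A1 (k + 2) y = ck_coeff (real q) (Suc l) *\<^sub>R (laplacian ^^ Suc l) A0 y"
      by (simp add: ck_extension_coeff_def k)
    moreover have "ck_weight q k = (2 * real l + 2) * (2 * real l + real q)"
      by (simp add: ck_weight_def k algebra_simps)
    moreover have "ck_coeff (real q) l = ((2 * real l + 2) * (2 * real l + real q)) * ck_coeff (real q) (Suc l)"
      using q by (intro rec) auto
    ultimately show ?thesis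
      unfolding ck_defect_def using lap[OF an(1), of "ck_coeff (real q) l" l] by simp
  next
    case False
    then obtain l where k: "k = 2 * l + 1" by (elim oddE)
    have "ck_extension_coeff q A0 A1 k = (\<lambda>y. ck_coeff (real q + 2) l *\<^sub>R (laplacian ^^ l) A1 y)"
      by (rule ext) (simp add: ck_extension_coeff_def k)
    moreover have "ck_extension_coeff q A0 A1 (k + 2) y = ck_coeff (real q + 2) (Suc l) *\<^sub>R (laplacian ^^ Suc l) A1 y"
      by (simp add: ck_extension_coeff_def k)
    moreover have "ck_weight q k = (2 * real l + 2) * (2 * real l + (real q + 2))"
      by (simp add: ck_weight_def k algebra_simps)
    moreover have "ck_coeff (real q + 2) l = ((2 * real l + 2) * (2 * real l + (real q + 2))) * ck_coeff (real q + 2) (Suc l)"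
      by (intro rec) auto
    ultimately show ?thesis
      unfolding ck_defect_def using lap[OF an(2), of "ck_coeff (real q + 2) l" l] by simp
  qed
qed

text \<open>An imaginary unit satisfies \<open>cj v = - v\<close>, so having norm \<open>e\<close>
  means having square \<open>- e\<close>; the left alternative law then yields
  \<open>left_square\<close>.\<close>

lemma alt_algebra_anticommuting_units:
  assumes alg: "alt_algebra mul e cj" and S: "\<forall>j. vq j \<in> unit_imag mul e cj"
    and ac: "\<forall>j j'. j \<noteq> j' \<longrightarrow> mul (vq j) (vq j') = - mul (vq j') (vq j)"
  shows "anticommuting_units mul e vq"
proof
  show bil: "bilinear mul" and u: "mul e x = x" "mul x e = x" for x
    using alg unfolding alt_algebra_def by auto
  show sq: "mul (vq j) (vq j) = - e" for j
  proof -
    have "vq j + cj (vq j) = 0" "mul (vq j) (cj (vq j)) = e" using S unfolding unit_imag_def by auto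
    then have "mul (vq j) (- vq j) = e" by (simp add: add_eq_0_iff)
    then show ?thesis using bilinear_rneg[OF bil, of "vq j" "vq j"] by (metis minus_minus)
  qed
  show "mul (vq j) (mul (vq j) a) = - a" for j a
  proof -
    have "mul (vq j) (mul (vq j) a) = mul (mul (vq j) (vq j)) a"
      using alg unfolding alt_algebra_def associator_def by auto
    then show ?thesis by (simp add: sq bilinear_lneg[OF bil] u)
  qed
  show "mul (vq j) (vq j') = - mul (vq j') (vq j)" if "j \<noteq> j'" for j j' using ac that by blast
qed

context anticommuting_units
begin

lemma ck_term_diff: "ck_term mul e vq (\<lambda>k y. B k y - A k y) k x = ck_term mul e vq B k x - ck_term mul e vq A k x"
  unfolding ck_term_def by (simp add: mul_simps)

text \<open>The difference of the two sequences has vanishing initial terms, and its series is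
  harmonic on the intersection of the two domains, which still contains
  \<open>\<Omega>0 \<times> {0}\<close>.\<close>

lemma ck_coefficients_unique:
  fixes A B :: "nat \<Rightarrow> real^'p \<Rightarrow> 'a"
  assumes \<Omega>0: "open \<Omega>0" and an: "\<And>k. real_analytic_on \<Omega>0 (A k)" "\<And>k. real_analytic_on \<Omega>0 (B k)"
    and init: "\<And>y. y \<in> \<Omega>0 \<Longrightarrow> A 0 y = B 0 y" "\<And>y. y \<in> \<Omega>0 \<Longrightarrow> A 1 y = B 1 y"
    and A: "harmonic_ck_on mul e vq \<Omega>0 A \<Omega>" and B: "harmonic_ck_on mul e vq \<Omega>0 B \<Omega>'" and y: "y \<in> \<Omega>0"
  shows "B k y = A k y"
proof -
  let ?C = "\<lambda>k y. B k y - A k y"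
  have cont: "continuous_on \<Omega>0 (?C k)" for k
    using has_laplacian_onD(2)[OF real_analytic_on_imp_has_laplacian[OF an(1) \<Omega>0]]
      has_laplacian_onD(2)[OF real_analytic_on_imp_has_laplacian[OF an(2) \<Omega>0]]
    by (intro continuous_on_diff continuous_at_imp_continuous_on ballI differentiable_imp_continuous_within) auto
  have sA: "summable (\<lambda>k. ck_term mul e vq A k x)" if "x \<in> \<Omega>" for x
    using A that unfolding harmonic_ck_on_def by blast
  have sB: "summable (\<lambda>k. ck_term mul e vq B k x)" if "x \<in> \<Omega>'" for x
    using B that unfolding harmonic_ck_on_def by blast
  have o: "open (\<Omega> \<inter> \<Omega>')" using A B unfolding harmonic_ck_on_def by blast
  have "has_laplacian_on (\<Omega> \<inter> \<Omega>') (\<lambda>x. (\<Sum>k. ck_term mul e vq B k x) + - (\<Sum>k. ck_term mul e vq A k x)) (\<lambda>x. 0 + - 0)"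
    using A B o unfolding harmonic_ck_on_def harmonic_on_iff_has_laplacian
    by (intro has_laplacian_on_add has_laplacian_on_linear[where h = uminus] bounded_linear_minus bounded_linear_ident)
      (auto intro: has_laplacian_on_subset)
  then have "harmonic_on (\<Omega> \<inter> \<Omega>') (\<lambda>x. \<Sum>k. ck_term mul e vq ?C k x)"
    unfolding harmonic_on_iff_has_laplacian
    by (rule has_laplacian_on_cong) (auto simp: ck_term_diff suminf_diff sA sB)
  then have "?C k y = 0"
    using A B init
    by (intro ck_coefficients_vanish[OF \<Omega>0 _ cont _ _ _ _ y, of "\<Omega> \<inter> \<Omega>'"])
      (auto simp: harmonic_ck_on_def ck_term_diff image_subset_iff intro: summable_diff)
  then show ?thesis by simp
qed

lemma radial_series_0: "radial_series W (y, 0) = W 0 y"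
proof -
  have "(\<lambda>k. (0::real) ^ k *\<^sub>R W k y) sums (\<Sum>k\<in>{0}. (0::real) ^ k *\<^sub>R W k y)"
    by (rule sums_finite) auto
  then show ?thesis by (simp add: radial_series_def sums_iff)
qed

lemma ck_series_at_0:
  "(\<lambda>k. ck_term mul e vq A k (y, 0)) sums A 0 y"
proof -
  \<comment> \<open>The zero vector is read as \<open>0\<close> times an arbitrary axis, so that
    \<open>ck_term_axis\<close> shows the factor \<open>0 ^ k\<close>.\<close>
  have "ck_term mul e vq A k (y, 0) = 0" if "k \<noteq> 0" for k
    using that ck_term_axis[of A k y 0 undefined] by (cases k) auto
  then have "(\<lambda>k. ck_term mul e vq A k (y, 0)) sums (\<Sum>k\<in>{0}. ck_term mul e vq A k (y, 0))"
    by (intro sums_finite) auto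
  then show ?thesis by (simp add: ck_term_def unit)
qed

text \<open>The even part depends on \<open>xq\<close> only through its squared norm and contributes
  nothing at \<open>xq = 0\<close>; of the odd part only the linear term survives, and the
  \<open>j\<close>-th axis picks out its left factor \<open>vq j\<close>.\<close>

lemma pd_ck_series_at_0:
  fixes A :: "nat \<Rightarrow> real^'p \<Rightarrow> 'a"
  assumes U: "open U" "convex U" and A: "geom_bounded_C1 U C A" and C: "0 \<le> C" "C * \<rho> < 1"
    and \<rho>: "0 < \<rho>" and y: "y \<in> U"
  shows "pd (\<lambda>x. \<Sum>k. ck_term mul e vq A k x) (0, axis j 1) (y, 0) = mul (vq j) (A 1 y)"
proof -
  let ?S = "U \<times> ball (0::real^'q) \<rho>"
  let ?O = "\<lambda>l. alt_subseq (mul (vq l)) 1 A"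
  let ?E = "alt_subseq id 0 A"
  let ?x = "(y, 0) :: (real^'p) \<times> (real^'q)"
  let ?u = "(0, axis j 1) :: (real^'p) \<times> (real^'q)"
  have bA: "geom_bounded U C A" using A unfolding geom_bounded_C1_def by blast
  have C2: "C\<^sup>2 * \<rho>\<^sup>2 < 1"
    unfolding power_mult_distrib[symmetric] using C \<rho> by (intro abs_square_less_1[THEN iffD2]) (auto simp: abs_mult)
  have x: "?x \<in> ?S" using y \<rho> by simp
  have E1: "geom_bounded_C1 U (C\<^sup>2) ?E"
    by (intro geom_bounded_C1_alt_subseq A C) (simp add: id_def)
  have O1: "geom_bounded_C1 U (C\<^sup>2) (?O l)" for l
    by (intro geom_bounded_C1_alt_subseq A C bounded_linear_mul)
  have dE: "(radial_series ?E has_derivative (\<lambda>h. pd (radial_series ?E) h ?x)) (at ?x)"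
    by (intro has_derivative_pd radial_series_C1(1)[OF U E1 _ C2 x]) simp
  have dO: "(radial_series (?O l) has_derivative (\<lambda>h. pd (radial_series (?O l)) h ?x)) (at ?x)" for l
    by (intro has_derivative_pd radial_series_C1(1)[OF U O1 _ C2 x]) simp
  have coord: "((\<lambda>x::(real^'p) \<times> (real^'q). snd x $ l) has_derivative (\<lambda>h. snd h $ l)) (at ?x)" for l
    by (rule bounded_linear_imp_has_derivative)
      (intro bounded_linear_compose[OF bounded_linear_vec_nth bounded_linear_snd])
  have "((\<lambda>x. radial_series ?E x + (\<Sum>l\<in>UNIV. (snd x $ l) *\<^sub>R radial_series (?O l) x)) has_derivative
      (\<lambda>h. pd (radial_series ?E) h ?x + (\<Sum>l\<in>UNIV. (snd ?x $ l) *\<^sub>R pd (radial_series (?O l)) h ?x +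
          (snd h $ l) *\<^sub>R radial_series (?O l) ?x))) (at ?x)"
    by (intro has_derivative_add has_derivative_sum has_derivative_scaleR dE dO coord)
  then have "((\<lambda>x. \<Sum>k. ck_term mul e vq A k x) has_derivative
      (\<lambda>h. pd (radial_series ?E) h ?x + (\<Sum>l\<in>UNIV. (snd ?x $ l) *\<^sub>R pd (radial_series (?O l)) h ?x +
          (snd h $ l) *\<^sub>R radial_series (?O l) ?x))) (at ?x)"
  proof (rule has_derivative_transform_within_open)
    show "open ?S" using U by (intro open_Times) auto
    show "?x \<in> ?S" by (rule x)
    show "radial_series ?E x + (\<Sum>l\<in>UNIV. (snd x $ l) *\<^sub>R radial_series (?O l) x) = (\<Sum>k. ck_term mul e vq A k x)"
      if "x \<in> ?S" for x
      using ck_term_sums[OF bA C that] by (simp add: sums_iff)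
  qed
  from pd_eqI[OF this, of ?u]
  have "pd (\<lambda>x. \<Sum>k. ck_term mul e vq A k x) ?u ?x =
      pd (radial_series ?E) ?u ?x + (\<Sum>l\<in>UNIV. (axis j 1 $ l) *\<^sub>R ?O l 0 y)"
    by (simp only: radial_series_0 fst_conv snd_conv zero_index scaleR_zero_left add_0_left)
  also have "pd (radial_series ?E) ?u ?x = 0"
  proof -
    have "?E 0 differentiable (at y)" using E1 y unfolding geom_bounded_C1_def by blast
    then show ?thesis
      using radial_series_C1(2)[OF U E1 _ C2 x, of ?u] linear_0[OF linear_pd] by (simp add: radial_series_0)
  qed
  also have "(\<Sum>l\<in>UNIV. (axis j (1::real) $ l) *\<^sub>R ?O l 0 y) = (\<Sum>l\<in>UNIV. if l = j then ?O j 0 y else 0)"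
    by (rule sum.cong) (auto simp: axis_def)
  finally show ?thesis by (simp add: alt_subseq_def)
qed

end

section \<open>Domain, Bessel expansion, initial values and uniqueness combined\<close>

theorem theorem3p13:
  fixes mul :: "'a::euclidean_space \<Rightarrow> 'a \<Rightarrow> 'a" and e :: 'a and cj :: "'a \<Rightarrow> 'a"
    and vp :: "'p::finite \<Rightarrow> 'a" and i0 :: 'p and vq :: "'q::finite \<Rightarrow> 'a"
    and \<Omega>0 :: "(real^'p) set" and A0 A1 :: "real^'p \<Rightarrow> 'a"
  assumes alg: "alt_algebra mul e cj" and dim: "DIM('a) > 1"
    and v0: "vp i0 = e"
    and vp_S: "\<forall>i. i \<noteq> i0 \<longrightarrow> vp i \<in> unit_imag mul e cj"
    and vq_S: "\<forall>j. vq j \<in> unit_imag mul e cj"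
    and ac_pp: "\<forall>i i'. i \<noteq> i0 \<and> i' \<noteq> i0 \<and> i \<noteq> i' \<longrightarrow> mul (vp i) (vp i') = - mul (vp i') (vp i)"
    and ac_pq: "\<forall>i j. i \<noteq> i0 \<longrightarrow> mul (vp i) (vq j) = - mul (vq j) (vp i)"
    and ac_qq: "\<forall>j j'. j \<noteq> j' \<longrightarrow> mul (vq j) (vq j') = - mul (vq j') (vq j)"
    and indep: "\<forall>a b. (\<Sum>i\<in>UNIV. a i *\<^sub>R vp i) + (\<Sum>j\<in>UNIV. b j *\<^sub>R vq j) = 0
                   \<longrightarrow> (\<forall>i. a i = 0) \<and> (\<forall>j. b j = 0)"
    and MQ: "span (range vp \<union> range vq) \<subseteq> quad_cone mul e cj"
    and dom: "open \<Omega>0" "connected \<Omega>0" "\<Omega>0 \<noteq> {}"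
    and an0: "real_analytic_on \<Omega>0 A0" and an1: "real_analytic_on \<Omega>0 A1"
  shows "\<exists>A :: nat \<Rightarrow> real^'p \<Rightarrow> 'a.
     (\<forall>xp\<in>\<Omega>0. A 0 xp = A0 xp \<and> A 1 xp = A1 xp) \<and>
     (\<forall>k. real_analytic_on \<Omega>0 (A k)) \<and>
     (\<exists>\<Omega>. harmonic_ck_on mul e vq \<Omega>0 A \<Omega> \<and>
        (let f = (\<lambda>x. \<Sum>k. ck_term mul e vq A k x); q = real CARD('q) in
          (\<forall>x\<in>\<Omega>. (\<lambda>k. (Gamma (q/2) * (-1)^k * (norm (snd x) / 2)^(2*k)
                          / (fact k * Gamma (real k + q/2))) *\<^sub>R ((laplacian ^^ k) A0 (fst x))
                     + (q/2 * Gamma (q/2) * (-1)^k * (norm (snd x) / 2)^(2*k)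
                          / (fact k * Gamma (real k + q/2 + 1)))
                         *\<^sub>R mul (qelem vq (snd x)) ((laplacian ^^ k) A1 (fst x)))
                   sums f x) \<and>
          (\<forall>xp\<in>\<Omega>0. f (xp, 0) = A0 xp) \<and>
          (\<forall>xp\<in>\<Omega>0. (\<Sum>j\<in>UNIV. mul (vq j) (pd f (0, axis j 1) (xp, 0))) = - (q *\<^sub>R A1 xp)))) \<and>
     (\<forall>B :: nat \<Rightarrow> real^'p \<Rightarrow> 'a.
        (\<forall>xp\<in>\<Omega>0. B 0 xp = A0 xp \<and> B 1 xp = A1 xp) \<and>
        (\<forall>k. real_analytic_on \<Omega>0 (B k)) \<and>
        (\<exists>\<Omega>. harmonic_ck_on mul e vq \<Omega>0 B \<Omega>)
        \<longrightarrow> (\<forall>k\<ge>2. \<forall>xp\<in>\<Omega>0. B k xp = A k xp))"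
proof -
  interpret anticommuting_units mul e vq
    by (rule alt_algebra_anticommuting_units[OF alg vq_S ac_qq])
  let ?q = "CARD('q)"
  define A where "A = ck_extension_coeff ?q A0 A1"
  let ?f = "\<lambda>x. \<Sum>k. ck_term mul e vq A k x"
  have q: "?q \<ge> 1" by (simp add: Suc_leI)
  have anA: "real_analytic_on \<Omega>0 (A k)" for k
    unfolding A_def by (rule ck_extension_coeff_analytic[OF dom(1) an0 an1])
  have init: "A 0 y = A0 y" "A 1 y = A1 y" for y by (simp_all add: A_def ck_extension_coeff_def)
  \<comment> \<open>All admissible pairs of centre and radius are collected instead of choosing a
    radius for each point; membership carries the bounds used on the corresponding piece.\<close>
  define G where "G = {(x, \<rho>). x \<in> \<Omega>0 \<and> 0 < \<rho> \<and> ball x \<rho> \<subseteq> \<Omega>0 \<and>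
      (\<exists>C\<ge>0. 4 * C * \<rho> < 1 \<and> geom_bounded_C2 (ball x \<rho>) C A)}"
  define \<Omega> :: "((real^'p) \<times> (real^'q)) set" where "\<Omega> = (\<Union>(x, \<rho>)\<in>G. ball x \<rho> \<times> ball 0 \<rho>)"
  have G: "fst ` G = \<Omega>0"
  proof
    show "fst ` G \<subseteq> \<Omega>0" by (auto simp: G_def)
    show "\<Omega>0 \<subseteq> fst ` G"
    proof
      fix x assume x: "x \<in> \<Omega>0"
      obtain \<rho> where "(x, \<rho>) \<in> G"
        using ck_extension_coeff_geom_bounded[OF q dom(1) an0 an1 x] x unfolding G_def A_def by auto
      then show "x \<in> fst ` G" by force
    qed
  qed
  have G': "0 < \<rho>" "ball x \<rho> \<subseteq> \<Omega>0" if "(x, \<rho>) \<in> G" for x \<rho> using that by (auto simp: G_def)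
  have tube: "open \<Omega>" "connected \<Omega>" "slice_domain \<Omega>" "p_symmetric \<Omega>"
    "\<Omega> \<subseteq> {x. fst x \<in> \<Omega>0}" "(\<lambda>xp. (xp, 0)) ` \<Omega>0 \<subseteq> \<Omega>"
    by (rule tube_domain[OF dom(2,3) G _ _ \<Omega>_def]; erule G')+
  have bounds: "\<exists>y \<rho> C. (y, \<rho>) \<in> G \<and> x \<in> ball y \<rho> \<times> ball 0 \<rho> \<and> 0 \<le> C \<and> C * \<rho> < 1 \<and>
      geom_bounded_C1 (ball y \<rho>) C A" if "x \<in> \<Omega>" for x
  proof -
    obtain y \<rho> where y: "(y, \<rho>) \<in> G" "x \<in> ball y \<rho> \<times> ball 0 \<rho>" using \<open>x \<in> \<Omega>\<close> by (auto simp: \<Omega>_def)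
    then obtain C where C: "C \<ge> 0" "4 * C * \<rho> < 1" "geom_bounded_C2 (ball y \<rho>) C A" by (auto simp: G_def)
    have "C * \<rho> < 1" using C(2) mult_nonneg_nonneg[OF C(1), of \<rho>] G'(1)[OF y(1)] by linarith
    then show ?thesis using y C unfolding geom_bounded_C2_def by blast
  qed
  have summ: "summable (\<lambda>k. ck_term mul e vq A k x)" if x: "x \<in> \<Omega>" for x
  proof -
    obtain y \<rho> C where "(y, \<rho>) \<in> G" "x \<in> ball y \<rho> \<times> ball 0 \<rho>" "0 \<le> C" "C * \<rho> < 1" "geom_bounded_C1 (ball y \<rho>) C A"
      using bounds[OF x] by blast
    then show ?thesis
      using ck_term_sums sums_summable unfolding geom_bounded_C1_def by blast
  qed
  have harm: "harmonic_on \<Omega> ?f"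
    unfolding harmonic_on_iff_has_laplacian \<Omega>_def
  proof (rule has_laplacian_on_Union, clarify)
    fix x \<rho> assume g: "(x, \<rho>) \<in> G"
    then obtain C where C: "C \<ge> 0" "4 * C * \<rho> < 1" "geom_bounded_C2 (ball x \<rho>) C A" by (auto simp: G_def)
    show "has_laplacian_on (ball x \<rho> \<times> ball 0 \<rho>) ?f (\<lambda>x. 0)"
    proof (rule has_laplacian_on_cong[OF laplacian_ck_series[OF open_ball convex_ball C(3,1,2)] refl])
      fix z :: "(real^'p) \<times> (real^'q)" assume "z \<in> ball x \<rho> \<times> ball 0 \<rho>"
      then have "fst z \<in> \<Omega>0" using G'(2)[OF g] by auto
      then have "ck_term mul e vq (ck_defect ?q A) k z = 0" for k
        unfolding ck_term_def A_def ck_defect_ck_extension_coeff[OF q dom(1) an0 an1 \<open>fst z \<in> \<Omega>0\<close>]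
        by (simp add: mul_simps)
      then show "(\<Sum>k. ck_term mul e vq (ck_defect ?q A) k z) = 0" by simp
    qed
  qed
  have H: "harmonic_ck_on mul e vq \<Omega>0 A \<Omega>"
    unfolding harmonic_ck_on_def using tube summ harm by blast
  have formula: "(\<lambda>k. (Gamma (real ?q/2) * (-1)^k * (norm (snd x) / 2)^(2*k)
                          / (fact k * Gamma (real k + real ?q/2))) *\<^sub>R ((laplacian ^^ k) A0 (fst x))
                     + (real ?q/2 * Gamma (real ?q/2) * (-1)^k * (norm (snd x) / 2)^(2*k)
                          / (fact k * Gamma (real k + real ?q/2 + 1)))
                         *\<^sub>R mul (qelem vq (snd x)) ((laplacian ^^ k) A1 (fst x)))
                   sums ?f x" if x: "x \<in> \<Omega>" for x
  proof -
    let ?s = "\<lambda>k. (-1) ^ k * (snd x \<bullet> snd x) ^ k"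
    have even: "ck_term mul e vq A (2 * k) x = (ck_coeff (real ?q) k * ?s k) *\<^sub>R (laplacian ^^ k) A0 (fst x)" for k
      unfolding ck_term_def apow_qelem A_def ck_extension_coeff_def by (simp add: mul_simps unit mult_ac)
    have odd: "ck_term mul e vq A (2 * k + 1) x =
        (ck_coeff (real ?q + 2) k * ?s k) *\<^sub>R mul (qelem vq (snd x)) ((laplacian ^^ k) A1 (fst x))" for k
      unfolding ck_term_def apow_qelem A_def ck_extension_coeff_def by (simp add: mul_simps mult_ac)
    \<comment> \<open>The functional equation of \<open>Gamma\<close> absorbs the prefactor
      \<open>q / 2\<close>, so the odd half takes the shape of the even one with
      \<open>q + 2\<close> for \<open>q\<close>.\<close>
    have G1: "real ?q/2 * Gamma (real ?q/2) = Gamma ((real ?q + 2)/2)"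
    proof -
      have "s \<notin> \<int>\<^sub>\<le>\<^sub>0" if "s > 0" for s :: real using that by (auto elim!: nonpos_Ints_cases)
      then have "real ?q/2 \<notin> \<int>\<^sub>\<le>\<^sub>0" using q by simp
      then show ?thesis by (simp add: add_divide_distrib Gamma_plus1)
    qed
    have G2: "real k + real ?q/2 + 1 = real k + (real ?q + 2)/2" for k by (simp add: add_divide_distrib)
    \<comment> \<open>The claimed series pairs each even term with the odd one after it; grouping is
      allowed because the full series is already known to converge.\<close>
    have "(\<lambda>n. \<Sum>k = n * 2..<n * 2 + 2. ck_term mul e vq A k x) sums ?f x"
      by (rule sums_group[OF summable_sums[OF summ[OF x]]]) simp
    moreover have "(\<Sum>k = n * 2..<n * 2 + 2. ck_term mul e vq A k x) =
        ck_term mul e vq A (2 * n) x + ck_term mul e vq A (2 * n + 1) x" for n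
      by (simp add: numeral_2_eq_2 mult.commute)
    ultimately have "(\<lambda>n. ck_term mul e vq A (2 * n) x + ck_term mul e vq A (2 * n + 1) x) sums ?f x"
      by simp
    then show ?thesis
      unfolding even odd G1 G2 using q by (subst (1 2) ck_coeff_Gamma) auto
  qed
  have at_0: "?f (xp, 0) = A0 xp" for xp
    using ck_series_at_0[of A xp] by (simp add: sums_iff init)
  have deriv_0: "(\<Sum>j\<in>UNIV. mul (vq j) (pd ?f (0, axis j 1) (xp, 0))) = - (real ?q *\<^sub>R A1 xp)"
    if xp: "xp \<in> \<Omega>0" for xp
  proof -
    have "(xp, 0) \<in> \<Omega>" using tube(6) xp by blast
    then obtain y \<rho> C where y: "(y, \<rho>) \<in> G" "(xp, 0) \<in> ball y \<rho> \<times> ball (0::real^'q) \<rho>" "0 \<le> C" "C * \<rho> < 1"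
        "geom_bounded_C1 (ball y \<rho>) C A"
      using bounds by blast
    have "xp \<in> ball y \<rho>" using y(2) by simp
    have "pd ?f (0, axis j 1) (xp, 0) = mul (vq j) (A1 xp)" for j
      using pd_ck_series_at_0[OF open_ball convex_ball y(5,3,4) G'(1)[OF y(1)] \<open>xp \<in> ball y \<rho>\<close>, of j]
      by (simp only: init)
    \<comment> \<open>Each of the \<open>q\<close> summands is
      \<open>mul (vq j) (mul (vq j) (A1 xp))\<close>, which is \<open>- A1 xp\<close>.\<close>
    then show ?thesis by (simp add: left_square sum_constant_scaleR)
  qed
  show ?thesis
  proof (intro exI[of _ A] conjI)
    show "\<forall>xp\<in>\<Omega>0. A 0 xp = A0 xp \<and> A 1 xp = A1 xp" using init by blast
    show "\<forall>k. real_analytic_on \<Omega>0 (A k)" using anA by blast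
    show "\<exists>\<Omega>. harmonic_ck_on mul e vq \<Omega>0 A \<Omega> \<and>
        (let f = (\<lambda>x. \<Sum>k. ck_term mul e vq A k x); q = real CARD('q) in
          (\<forall>x\<in>\<Omega>. (\<lambda>k. (Gamma (q/2) * (-1)^k * (norm (snd x) / 2)^(2*k)
                          / (fact k * Gamma (real k + q/2))) *\<^sub>R ((laplacian ^^ k) A0 (fst x))
                     + (q/2 * Gamma (q/2) * (-1)^k * (norm (snd x) / 2)^(2*k)
                          / (fact k * Gamma (real k + q/2 + 1)))
                         *\<^sub>R mul (qelem vq (snd x)) ((laplacian ^^ k) A1 (fst x)))
                   sums f x) \<and>
          (\<forall>xp\<in>\<Omega>0. f (xp, 0) = A0 xp) \<and>
          (\<forall>xp\<in>\<Omega>0. (\<Sum>j\<in>UNIV. mul (vq j) (pd f (0, axis j 1) (xp, 0))) = - (q *\<^sub>R A1 xp)))"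
      unfolding Let_def
      by (intro exI[of _ \<Omega>] conjI ballI H formula at_0 deriv_0)
    show "\<forall>B :: nat \<Rightarrow> real^'p \<Rightarrow> 'a.
        (\<forall>xp\<in>\<Omega>0. B 0 xp = A0 xp \<and> B 1 xp = A1 xp) \<and>
        (\<forall>k. real_analytic_on \<Omega>0 (B k)) \<and>
        (\<exists>\<Omega>. harmonic_ck_on mul e vq \<Omega>0 B \<Omega>)
        \<longrightarrow> (\<forall>k\<ge>2. \<forall>xp\<in>\<Omega>0. B k xp = A k xp)"
    proof (intro allI impI ballI, elim conjE exE)
      fix B :: "nat \<Rightarrow> real^'p \<Rightarrow> 'a" and k :: nat and xp \<Omega>'
      assume "\<forall>xp\<in>\<Omega>0. B 0 xp = A0 xp \<and> B 1 xp = A1 xp" "\<forall>k. real_analytic_on \<Omega>0 (B k)"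
        and B: "harmonic_ck_on mul e vq \<Omega>0 B \<Omega>'" and "xp \<in> \<Omega>0"
      then show "B k xp = A k xp"
        by (intro ck_coefficients_unique[OF dom(1) anA _ _ _ H B]) (auto simp: init[unfolded One_nat_def])
    qed
  qed
qed

end
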